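(* Assume that $\mathsf{TC}^0\neq\mathsf{NC}^1$. Then no modern Hopfield network with $\mathrm{poly}(n)$ precision, a constant number of layers and $O(n)$ hidden dimension can solve the undirected graph connectivity problem.
   Context: Undirected graph connectivity problem: given an undirected graph $G$ and two vertices $u,v$ of $G$ (in a standard binary encoding, e.g. adjacency matrix), decide whether some path in $G$ connects $u$ and $v$. $\mathsf{TC}^0$: languages computed by families (one circuit for each input length) of constant-depth, polynomial-size Boolean circuits with unbounded fan-in $\mathsf{AND},\mathsf{OR},\mathsf{MAJORITY}$ gates and $\mathsf{NOT}$ gates (threshold circuits). $\mathsf{NC}^1$: languages computed by families of $O(\log n)$-depth, polynomial-size circuits with bounded fan-in $\mathsf{AND},\mathsf{OR}$ gates and $\mathsf{NOT}$ gates. Floating-point numbers. A $p$-bit floating-point number is a pair $\langle m,e\rangle$ of integers with $m\in(-2^p,-2^{p-1}]\cup\{0\}\cup[2^{p-1},2^p)$, $e\in[-2^p,2^p)$, of value $m\cdot 2^e$; $\mathbb{F}_p$ is the set of these. $\mathrm{round}_p(x)$ is the closest element of $\mathbb{F}_p$, ties in favour of even significand. Sums, products, quotients are rounded exact results; iterated sums are rounded once at the end; entries of matrix products are iterated sums of rounded products; $\exp(x)$ is $\mathrm{round}_p(y)$ for some $y$ with $|y-e^x|\le2^{-p}e^x$ (a fixed approximation computable by constant-depth polynomial-size threshold circuits). No division by zero is assumed to occur. Modern Hopfield network. For $R,Y\in\mathbb{F}_p^{n\times d}$, weights $W_Q,W_K,\tilde W_V\in\mathbb{F}_p^{d\times d}$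 (where $\tilde W_V=W_KW_V$ or a stand-alone parameter matrix), $\beta>0$ in $\mathbb{F}_p$: $A_{i,j}=\exp(\beta R_{i,*}W_QW_K^\top Y_{j,*}^\top)$, $D=\mathrm{diag}(\beta\cdot A\mathbf 1_n)$, and $\mathsf{Hop}(R,Y)=D^{-1}AY\tilde W_V$. An $m$-layer network is $$\mathsf{MHN}(R)=f_m\circ\mathsf{Hop}_m(\cdots f_1\circ\mathsf{Hop}_1(f_0(R),Y_1)\cdots,Y_m),$$ where each layer $\mathsf{Hop}_i$ has its own weights and stored patterns $Y_i\in\mathbb{F}_p^{n\times d}$, and each $f_i:\mathbb{F}_p^{n\times d}\to\mathbb{F}_p^{n\times d}$, $0\le i\le m$, is computable by threshold circuits of constant depth and size $\mathrm{poly}(n)$. Solving a problem. A family of networks, one for each $n$, with $p=p(n)\le\mathrm{poly}(n)$, $d=d(n)=O(n)$, $m=O(1)$, solves a decision problem if every instance of bit length $n$, encoded as a matrix $R\in\mathbb{F}_p^{n\times d}$ by an encoding computable by constant-depth polynomial-size threshold circuits, is a yes-instance if and only if the $(1,1)$ entry of $\mathsf{MHN}(R)$ is positive. *)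

theory Defs
  imports
    "HOL-Library.Landau_Symbols"
    "HOL-Library.Log_Nat"
    "Jordan_Normal_Form.Matrix"
begin

section \<open>Boolean circuits\<close>

text \<open>
  A circuit is a straight-line program. Nodes \<open>0, \<dots>, n_in - 1\<close> are the inputs and node
  \<open>n_in + k\<close> is the \<open>k\<close>-th gate, whose arguments are earlier nodes. The empty conjunction and the
  empty disjunction provide the constants.
\<close>

datatype gate = And_gate "nat list" | Or_gate "nat list" | Maj_gate "nat list" | Not_gate nat

record circuit =
  n_in :: nat
  gates :: "gate list"
  outs :: "nat list"

fun gate_args :: "gate \<Rightarrow> nat list" where
  "gate_args (And_gate js) = js"
| "gate_args (Or_gate js) = js"
| "gate_args (Maj_gate js) = js"
| "gate_args (Not_gate j) = [j]"

fun gate_val :: "bool list \<Rightarrow> gate \<Rightarrow> bool" where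
  "gate_val v (And_gate js) = (\<forall>j\<in>set js. v ! j)"
| "gate_val v (Or_gate js) = (\<exists>j\<in>set js. v ! j)"
| "gate_val v (Maj_gate js) = (length js < 2 * length (filter (\<lambda>j. v ! j) js))"
| "gate_val v (Not_gate j) = (\<not> v ! j)"

definition circuit_wf :: "circuit \<Rightarrow> bool" where
  "circuit_wf C \<longleftrightarrow>
     (\<forall>k<length (gates C). \<forall>j\<in>set (gate_args (gates C ! k)). j < n_in C + k) \<and>
     (\<forall>j\<in>set (outs C). j < n_in C + length (gates C))"

definition node_vals :: "circuit \<Rightarrow> bool list \<Rightarrow> bool list" where
  "node_vals C x = fold (\<lambda>g v. v @ [gate_val v g]) (gates C) x"

definition circuit_eval :: "circuit \<Rightarrow> bool list \<Rightarrow> bool list" where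
  "circuit_eval C x = map (\<lambda>j. node_vals C x ! j) (outs C)"

definition node_depths :: "circuit \<Rightarrow> nat list" where
  "node_depths C =
     fold (\<lambda>g ds. ds @ [Suc (Max (insert 0 ((\<lambda>j. ds ! j) ` set (gate_args g))))])
       (gates C) (replicate (n_in C) 0)"

definition circuit_depth :: "circuit \<Rightarrow> nat" where
  "circuit_depth C = Max (insert 0 (set (node_depths C)))"

text \<open>
  Wires are counted as well as gates: a node may be listed several times among the arguments of a
  majority gate, and these multiplicities must be paid for.
\<close>

definition circuit_size :: "circuit \<Rightarrow> nat" where
  "circuit_size C = (\<Sum>g\<leftarrow>gates C. 1 + length (gate_args g))"

definition poly_bounded :: "(nat \<Rightarrow> nat) \<Rightarrow> bool" where
  "poly_bounded s \<longleftrightarrow> (\<exists>k. (\<lambda>n. real (s n)) \<in> O(\<lambda>n. real n ^ k))"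

definition decides :: "(nat \<Rightarrow> circuit) \<Rightarrow> bool list set \<Rightarrow> bool" where
  "decides C L \<longleftrightarrow>
     (\<forall>n. circuit_wf (C n) \<and> n_in (C n) = n \<and>
        (\<forall>x. length x = n \<longrightarrow> circuit_eval (C n) x = [x \<in> L]))"

definition TC0 :: "bool list set set" where
  "TC0 = {L. \<exists>C. decides C L \<and>
            (\<exists>c. \<forall>n. circuit_depth (C n) \<le> c) \<and> poly_bounded (\<lambda>n. circuit_size (C n))}"

fun bounded_fanin_gate :: "nat \<Rightarrow> gate \<Rightarrow> bool" where
  "bounded_fanin_gate b (And_gate js) = (length js \<le> b)"
| "bounded_fanin_gate b (Or_gate js) = (length js \<le> b)"
| "bounded_fanin_gate b (Maj_gate js) = False"
| "bounded_fanin_gate b (Not_gate j) = True"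

definition NC1 :: "bool list set set" where
  "NC1 = {L. \<exists>C. decides C L \<and>
            (\<exists>b. \<forall>n. \<forall>g\<in>set (gates (C n)). bounded_fanin_gate b g) \<and>
            (\<lambda>n. real (circuit_depth (C n))) \<in> O(\<lambda>n. ln (real n)) \<and>
            poly_bounded (\<lambda>n. circuit_size (C n))}"

text \<open>
  The maps \<open>f n\<close> on the domains \<open>D n\<close> are computed by threshold circuits of constant depth and of
  size polynomial in \<open>n\<close>, with respect to the bit encodings \<open>inp n\<close> of arguments and \<open>out n\<close> of
  results.
\<close>

definition tc0_computable ::
  "(nat \<Rightarrow> 'a set) \<Rightarrow> (nat \<Rightarrow> 'a \<Rightarrow> bool list) \<Rightarrow> (nat \<Rightarrow> 'b \<Rightarrow> bool list) \<Rightarrow> (nat \<Rightarrow> 'a \<Rightarrow> 'b) \<Rightarrow> bool"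
where
  "tc0_computable D inp out f \<longleftrightarrow>
     (\<exists>C. (\<forall>n. circuit_wf (C n)) \<and>
        (\<exists>c. \<forall>n. circuit_depth (C n) \<le> c) \<and> poly_bounded (\<lambda>n. circuit_size (C n)) \<and>
        (\<forall>n. \<forall>a\<in>D n. length (inp n a) = n_in (C n) \<and>
           circuit_eval (C n) (inp n a) = out n (f n a)))"


section \<open>Floating-point numbers\<close>

type_synonym fp = "int \<times> int"

definition fp_set :: "nat \<Rightarrow> fp set" where
  "fp_set p = ({-(2 ^ p)<..-(2 ^ (p - 1))} \<union> {0} \<union> {2 ^ (p - 1)..<2 ^ p}) \<times> {-(2 ^ p)..<2 ^ p}"

definition fp_val :: "fp \<Rightarrow> real" where
  "fp_val a = real_of_int (fst a) * 2 powi snd a"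

definition fp_nearest :: "nat \<Rightarrow> real \<Rightarrow> fp set" where
  "fp_nearest p x = {a \<in> fp_set p. \<forall>b\<in>fp_set p. \<bar>fp_val a - x\<bar> \<le> \<bar>fp_val b - x\<bar>}"

text \<open>
  Preferring even significands leaves some choices open. Between zero and the least positive (or
  greatest negative) number both significands can be even, and for \<open>p = 1\<close> all nonzero
  significands are odd; such a tie goes to the number of smaller absolute value. Moreover zero has
  several representations, of which rounding returns the one with exponent zero.
\<close>

definition fp_round :: "nat \<Rightarrow> real \<Rightarrow> fp" where
  "fp_round p x =
     (THE a. a \<in> fp_nearest p x \<and> (fst a = 0 \<longrightarrow> snd a = 0) \<and>
        (\<forall>b\<in>fp_nearest p x.
           (even (fst b) \<longrightarrow> even (fst a)) \<and>
           (even (fst b) = even (fst a) \<longrightarrow> \<bar>fp_val a\<bar> \<le> \<bar>fp_val b\<bar>)))"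

text \<open>The next lemmas show that \<open>THE\<close> is well-defined in the definition of \<open>fp_round\<close>.\<close>

lemma fp_zero_in: "(0, 0) \<in> fp_set p"
  by (auto simp: fp_set_def)

lemma fp_set_finite: "finite (fp_set p)"
  by (auto simp: fp_set_def)

lemma fp_val_inj_pos:
  assumes m: "2 ^ (p - 1) \<le> m" "m < 2 ^ p" and m': "2 ^ (p - 1) \<le> m'" "(m'::int) < 2 ^ p"
    and eq: "real_of_int m * 2 powi e = real_of_int m' * 2 powi e'" 
  shows "e' \<le> e"
proof (rule ccontr)
  assume "\<not> e' \<le> e"
  then have le: "e + 1 \<le> e'" by simp
  have r: "real_of_int m < 2 ^ p" "2 ^ (p - 1) \<le> real_of_int m'"
    using m(2) m'(1) by (metis of_int_less_iff of_int_numeral of_int_power, metis of_int_le_iff of_int_numeral of_int_power)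
  have p: "p \<noteq> 0" using m by (cases p) auto
  have "real_of_int m * 2 powi e < 2 ^ p * 2 powi e"
    using r(1) by (intro mult_strict_right_mono) simp_all
  also have "2 ^ p * 2 powi e = 2 ^ (p - 1) * (2::real) powi (e + 1)"
    using p by (cases p) (simp_all add: power_int_add)
  also have "\<dots> \<le> 2 ^ (p - 1) * 2 powi e'"
    using le by (intro mult_left_mono power_int_increasing) auto
  also have "\<dots> \<le> real_of_int m' * 2 powi e'"
    using r(2) by (intro mult_right_mono) simp_all
  finally show False using eq by simp
qed

lemma fp_set_bounds:
  assumes "(m, e) \<in> fp_set p"
  shows "0 < m \<Longrightarrow> 2 ^ (p - 1) \<le> m \<and> m < 2 ^ p" "m < 0 \<Longrightarrow> 2 ^ (p - 1) \<le> - m \<and> - m < 2 ^ p"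
proof -
  have z: "(0::int) < 2 ^ (p - 1)" "(0::int) < 2 ^ p" by simp_all
  have "(- (2 ^ p) < m \<and> m \<le> - (2 ^ (p - 1))) \<or> m = 0 \<or> (2 ^ (p - 1) \<le> m \<and> m < 2 ^ p)"
    using assms unfolding fp_set_def by auto
  with z show "0 < m \<Longrightarrow> 2 ^ (p - 1) \<le> m \<and> m < 2 ^ p" "m < 0 \<Longrightarrow> 2 ^ (p - 1) \<le> - m \<and> - m < 2 ^ p"
    by linarith+
qed

lemma fp_val_inj:
  assumes "a \<in> fp_set p" "b \<in> fp_set p" "fp_val a = fp_val b" "fp_val a \<noteq> 0"
  shows "a = b"
proof -
  obtain m e m' e' where ab: "a = (m, e)" "b = (m', e')" by (cases a, cases b)
  have eq: "real_of_int m * 2 powi e = real_of_int m' * 2 powi e'"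
    using assms ab by (simp add: fp_val_def)
  have nz: "m \<noteq> 0" "m' \<noteq> 0" using assms ab by (auto simp: fp_val_def)
  have sg: "0 < m \<longleftrightarrow> 0 < m'"
    using eq proof -
    have "0 < real_of_int m \<longleftrightarrow> 0 < real_of_int m * 2 powi e" using zero_less_power_int[of "2::real"] by (simp add: zero_less_mult_iff not_less_iff_gr_or_eq less_not_sym)
    moreover have "0 < real_of_int m' \<longleftrightarrow> 0 < real_of_int m' * 2 powi e'" using zero_less_power_int[of "2::real"] by (simp add: zero_less_mult_iff not_less_iff_gr_or_eq less_not_sym)
    ultimately show ?thesis using eq by simp
  qed
  have "e = e'"
  proof (cases "0 < m")
    case True
    then have "0 < m'" using sg by simp
    with True have "2 ^ (p - 1) \<le> m" "m < 2 ^ p" "2 ^ (p - 1) \<le> m'" "m' < 2 ^ p"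
      using assms(1,2) ab fp_set_bounds[of m e p] fp_set_bounds[of m' e' p] by blast+
    then show ?thesis
      using fp_val_inj_pos[OF _ _ _ _ eq] fp_val_inj_pos[OF _ _ _ _ eq[symmetric]] by (meson order_antisym)
  next
    case False
    then have "m < 0" "m' < 0" using sg nz by auto
    then have "2 ^ (p - 1) \<le> - m" "- m < 2 ^ p" "2 ^ (p - 1) \<le> - m'" "- m' < 2 ^ p"
using assms(1,2) ab fp_set_bounds[of m e p] fp_set_bounds[of m' e' p] by blast+
    moreover have eq': "real_of_int (- m) * 2 powi e = real_of_int (- m') * 2 powi e'" using eq by simp
    ultimately show ?thesis
      using fp_val_inj_pos[OF _ _ _ _ eq'] fp_val_inj_pos[OF _ _ _ _ eq'[symmetric]] by (meson order_antisym)
  qed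
  then show ?thesis using eq ab by simp
qed

lemma fp_round_unique:
  "\<exists>!a. a \<in> fp_nearest p x \<and> (fst a = 0 \<longrightarrow> snd a = 0) \<and>
        (\<forall>b\<in>fp_nearest p x.
           (even (fst b) \<longrightarrow> even (fst a)) \<and>
           (even (fst b) = even (fst a) \<longrightarrow> \<bar>fp_val a\<bar> \<le> \<bar>fp_val b\<bar>))"
    (is "\<exists>!a. ?P a")
proof -
  have fin: "finite (fp_nearest p x)"
    using fp_set_finite[of p] by (simp add: fp_nearest_def)
  have ne: "fp_nearest p x \<noteq> {}"
  proof -
    obtain a where "is_arg_min (\<lambda>a. \<bar>fp_val a - x\<bar>) (\<lambda>a. a \<in> fp_set p) a"
      using ex_is_arg_min_if_finite[OF fp_set_finite[of p]] fp_zero_in[of p] by blast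
    then have "a \<in> fp_nearest p x" by (auto simp: fp_nearest_def is_arg_min_linorder)
    then show ?thesis by blast
  qed
  define S where "S = (if \<exists>b\<in>fp_nearest p x. even (fst b) then {b\<in>fp_nearest p x. even (fst b)} else fp_nearest p x)"
  have "finite S" "S \<noteq> {}" using fin ne by (auto simp: S_def)
  then obtain a where "is_arg_min (\<lambda>a. \<bar>fp_val a\<bar>) (\<lambda>a. a \<in> S) a"
    using ex_is_arg_min_if_finite by blast
  then have a: "a \<in> S" "\<And>b. b \<in> S \<Longrightarrow> \<bar>fp_val a\<bar> \<le> \<bar>fp_val b\<bar>" by (auto simp: is_arg_min_linorder)
  define a' where "a' = (if fst a = 0 then (0, 0) else a)"
  have v: "fp_val a' = fp_val a" "even (fst a') = even (fst a)" by (auto simp: a'_def fp_val_def)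
  have aS: "a \<in> fp_nearest p x" using a(1) by (auto simp: S_def split: if_splits)
  have a'N: "a' \<in> fp_nearest p x"
    using aS v(1) fp_zero_in[of p] by (auto simp: fp_nearest_def a'_def)
  have P: "?P a'"
  proof (intro conjI ballI impI)
    show "a' \<in> fp_nearest p x" by (rule a'N)
    show "snd a' = 0" if "fst a' = 0" using that by (auto simp: a'_def split: if_splits)
    fix b assume b: "b \<in> fp_nearest p x"
    show "even (fst a')" if "even (fst b)" using that b a(1) v(2) by (auto simp: S_def split: if_splits)
    show "\<bar>fp_val a'\<bar> \<le> \<bar>fp_val b\<bar>" if "even (fst b) = even (fst a')"
      using that b a v by (auto simp: S_def split: if_splits)
  qed
  have "b = c" if b: "?P b" and c: "?P c" for b c
  proof -
    have "even (fst b) = even (fst c)" using b c by blast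
    then have ab: "\<bar>fp_val b\<bar> = \<bar>fp_val c\<bar>" using b c by (meson order_antisym)
    have bs: "b \<in> fp_set p" "c \<in> fp_set p" using b c by (auto simp: fp_nearest_def)
    have d: "\<bar>fp_val b - x\<bar> = \<bar>fp_val c - x\<bar>"
      using b c bs unfolding fp_nearest_def by (blast intro: order_antisym)
    have z: "\<bar>fp_val b - x\<bar> \<le> \<bar>x\<bar>"
      proof -
      have "\<bar>fp_val b - x\<bar> \<le> \<bar>fp_val (0, 0) - x\<bar>"
        using b fp_zero_in[of p] unfolding fp_nearest_def by blast
      then show ?thesis by (simp add: fp_val_def)
    qed
    have veq: "fp_val b = fp_val c" using ab d z by linarith
    show "b = c"
    proof (cases "fp_val b = 0")
      case True
      then have "fst b = 0" "fst c = 0" using veq by (auto simp: fp_val_def)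
      then show ?thesis using b c by (simp add: prod_eq_iff)
    next
      case False
      then show ?thesis using fp_val_inj bs veq by blast
    qed
  qed
  then show ?thesis using P by blast
qed

definition fp_mult :: "nat \<Rightarrow> fp \<Rightarrow> fp \<Rightarrow> fp" where
  "fp_mult p a b = fp_round p (fp_val a * fp_val b)"

definition fp_div :: "nat \<Rightarrow> fp \<Rightarrow> fp \<Rightarrow> fp" where
  "fp_div p a b = fp_round p (fp_val a / fp_val b)"

definition fp_sum :: "nat \<Rightarrow> fp list \<Rightarrow> fp" where
  "fp_sum p as = fp_round p (\<Sum>a\<leftarrow>as. fp_val a)"

text \<open>Significand and exponent in two's complement, \<open>p + 1\<close> bits each.\<close>

definition fp_bits :: "nat \<Rightarrow> fp \<Rightarrow> bool list" where
  "fp_bits p a = map (bit (fst a)) [0..<p + 1] @ map (bit (snd a)) [0..<p + 1]"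

definition fp_exp_approx :: "(nat \<Rightarrow> fp \<Rightarrow> fp) \<Rightarrow> bool" where
  "fp_exp_approx ex \<longleftrightarrow>
     (\<forall>p. \<forall>a\<in>fp_set p. \<exists>y. \<bar>y - exp (fp_val a)\<bar> \<le> exp (fp_val a) / 2 ^ p \<and> ex p a = fp_round p y) \<and>
     tc0_computable fp_set fp_bits fp_bits ex"


section \<open>Floating-point matrices\<close>

definition fp_mats :: "nat \<Rightarrow> nat \<Rightarrow> nat \<Rightarrow> fp mat set" where
  "fp_mats p r c = {A \<in> carrier_mat r c. elements_mat A \<subseteq> fp_set p}"

definition fp_mat_mult :: "nat \<Rightarrow> fp mat \<Rightarrow> fp mat \<Rightarrow> fp mat" where
  "fp_mat_mult p A B =
     mat (dim_row A) (dim_col B)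
       (\<lambda>(i, j). fp_sum p (map (\<lambda>k. fp_mult p (A $$ (i, k)) (B $$ (k, j))) [0..<dim_col A]))"

definition fp_smult :: "nat \<Rightarrow> fp \<Rightarrow> fp mat \<Rightarrow> fp mat" where
  "fp_smult p b A = map_mat (fp_mult p b) A"

definition fp_mat_bits :: "nat \<Rightarrow> fp mat \<Rightarrow> bool list" where
  "fp_mat_bits p A =
     concat (map (\<lambda>i. concat (map (\<lambda>j. fp_bits p (A $$ (i, j))) [0..<dim_col A])) [0..<dim_row A])"


section \<open>Modern Hopfield networks\<close>

text \<open>
  \<open>WV\<close> stands for the matrix written with a tilde in the literature. It is an arbitrary matrix of
  parameters, which includes the case that it is a product of \<open>WK\<close> with another matrix.
\<close>

record hop_params =
  WQ :: "fp mat"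
  WK :: "fp mat"
  WV :: "fp mat"
  beta :: fp
  stored :: "fp mat"

definition hop_params_wf :: "nat \<Rightarrow> nat \<Rightarrow> nat \<Rightarrow> hop_params \<Rightarrow> bool" where
  "hop_params_wf p n d H \<longleftrightarrow>
     WQ H \<in> fp_mats p d d \<and> WK H \<in> fp_mats p d d \<and> WV H \<in> fp_mats p d d \<and>
     beta H \<in> fp_set p \<and> 0 < fp_val (beta H) \<and> stored H \<in> fp_mats p n d"

text \<open>
  Floating-point products are not associative. Products of matrices are evaluated from left to
  right, and the scalar factor \<open>beta\<close> is applied to the result.
\<close>

definition hop_A :: "nat \<Rightarrow> (nat \<Rightarrow> fp \<Rightarrow> fp) \<Rightarrow> hop_params \<Rightarrow> fp mat \<Rightarrow> fp mat" where
  "hop_A p ex H R =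
     map_mat (ex p)
       (fp_smult p (beta H)
         (fp_mat_mult p
           (fp_mat_mult p (fp_mat_mult p R (WQ H)) (transpose_mat (WK H)))
           (transpose_mat (stored H))))"

text \<open>The diagonal of \<open>D\<close>, as a matrix with one column.\<close>

definition hop_D :: "nat \<Rightarrow> (nat \<Rightarrow> fp \<Rightarrow> fp) \<Rightarrow> hop_params \<Rightarrow> fp mat \<Rightarrow> fp mat" where
  "hop_D p ex H R =
     (let A = hop_A p ex H R
      in fp_smult p (beta H) (fp_mat_mult p A (mat (dim_col A) 1 (\<lambda>_. fp_round p 1))))"

definition hop_D_inv :: "nat \<Rightarrow> (nat \<Rightarrow> fp \<Rightarrow> fp) \<Rightarrow> hop_params \<Rightarrow> fp mat \<Rightarrow> fp mat" where
  "hop_D_inv p ex H R =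
     mat (dim_row R) (dim_row R)
       (\<lambda>(i, j). if i = j then fp_div p (fp_round p 1) (hop_D p ex H R $$ (i, 0)) else fp_round p 0)"

definition hop :: "nat \<Rightarrow> (nat \<Rightarrow> fp \<Rightarrow> fp) \<Rightarrow> hop_params \<Rightarrow> fp mat \<Rightarrow> fp mat" where
  "hop p ex H R =
     fp_mat_mult p
       (fp_mat_mult p (fp_mat_mult p (hop_D_inv p ex H R) (hop_A p ex H R)) (stored H))
       (WV H)"

text \<open>The \<open>i\<close>-th layer consists of the parameters of \<open>Hop\<^sub>i\<close> and of the map \<open>f\<^sub>i\<close> that follows it.\<close>

record mhn =
  pre :: "fp mat \<Rightarrow> fp mat"
  layers :: "(hop_params \<times> (fp mat \<Rightarrow> fp mat)) list"

definition run_layers ::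
  "nat \<Rightarrow> (nat \<Rightarrow> fp \<Rightarrow> fp) \<Rightarrow> (hop_params \<times> (fp mat \<Rightarrow> fp mat)) list \<Rightarrow> fp mat \<Rightarrow> fp mat"
where
  "run_layers p ex Ls X = fold (\<lambda>(H, f) X. f (hop p ex H X)) Ls X"

definition mhn_eval :: "nat \<Rightarrow> (nat \<Rightarrow> fp \<Rightarrow> fp) \<Rightarrow> mhn \<Rightarrow> fp mat \<Rightarrow> fp mat" where
  "mhn_eval p ex N R = run_layers p ex (layers N) (pre N R)"

definition no_zero_division :: "nat \<Rightarrow> (nat \<Rightarrow> fp \<Rightarrow> fp) \<Rightarrow> mhn \<Rightarrow> fp mat \<Rightarrow> bool" where
  "no_zero_division p ex N R \<longleftrightarrow>
     (\<forall>i<length (layers N). \<forall>r<dim_row R.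
        fp_val (hop_D p ex (fst (layers N ! i)) (run_layers p ex (take i (layers N)) (pre N R)) $$ (r, 0)) \<noteq> 0)"

definition mhn_wf :: "nat \<Rightarrow> nat \<Rightarrow> nat \<Rightarrow> mhn \<Rightarrow> bool" where
  "mhn_wf p n d N \<longleftrightarrow>
     pre N ` fp_mats p n d \<subseteq> fp_mats p n d \<and>
     (\<forall>(H, f)\<in>set (layers N). hop_params_wf p n d H \<and> f ` fp_mats p n d \<subseteq> fp_mats p n d)"

definition mhn_family :: "(nat \<Rightarrow> nat) \<Rightarrow> (nat \<Rightarrow> nat) \<Rightarrow> (nat \<Rightarrow> mhn) \<Rightarrow> bool" where
  "mhn_family p d N \<longleftrightarrow>
     (\<forall>n. 0 < p n \<and> 0 < d n \<and> mhn_wf (p n) n (d n) (N n)) \<and>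
     poly_bounded p \<and>
     (\<lambda>n. real (d n)) \<in> O(\<lambda>n. real n) \<and>
     (\<exists>m. \<forall>n. length (layers (N n)) \<le> m) \<and>
     tc0_computable (\<lambda>n. fp_mats (p n) n (d n)) (\<lambda>n. fp_mat_bits (p n)) (\<lambda>n. fp_mat_bits (p n))
       (\<lambda>n. pre (N n)) \<and>
     (\<forall>i. tc0_computable (\<lambda>n. if i < length (layers (N n)) then fp_mats (p n) n (d n) else {})
            (\<lambda>n. fp_mat_bits (p n)) (\<lambda>n. fp_mat_bits (p n)) (\<lambda>n. snd (layers (N n) ! i)))"

text \<open>
  A decision problem is given by the set of bit strings that encode its instances and the subset
  of those that encode yes-instances.
\<close>

definition mhn_solves ::
  "(nat \<Rightarrow> fp \<Rightarrow> fp) \<Rightarrow> (nat \<Rightarrow> nat) \<Rightarrow> (nat \<Rightarrow> nat) \<Rightarrow> (nat \<Rightarrow> mhn) \<Rightarrow> bool list set \<Rightarrow> bool list set \<Rightarrow> bool"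
where
  "mhn_solves ex p d N instances yes \<longleftrightarrow>
     (\<exists>enc. tc0_computable (\<lambda>n. {x \<in> instances. length x = n}) (\<lambda>n x. x)
              (\<lambda>n. fp_mat_bits (p n)) enc \<and>
        (\<forall>n. \<forall>x\<in>instances. length x = n \<longrightarrow>
           enc n x \<in> fp_mats (p n) n (d n) \<and>
           no_zero_division (p n) ex (N n) (enc n x) \<and>
           (x \<in> yes \<longleftrightarrow> 0 < fp_val (mhn_eval (p n) ex (N n) (enc n x) $$ (0, 0)))))"


section \<open>Undirected graph connectivity\<close>

text \<open>Simple graphs with vertex set \<open>{..<k}\<close>, given by their edge sets.\<close>

definition ugraph :: "nat \<Rightarrow> nat set set \<Rightarrow> bool" where
  "ugraph k E \<longleftrightarrow> E \<subseteq> {{a, b} | a b. a < k \<and> b < k \<and> a \<noteq> b}"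

definition connects :: "nat set set \<Rightarrow> nat list \<Rightarrow> nat \<Rightarrow> nat \<Rightarrow> bool" where
  "connects E xs u v \<longleftrightarrow>
     xs \<noteq> [] \<and> hd xs = u \<and> last xs = v \<and> distinct xs \<and> successively (\<lambda>a b. {a, b} \<in> E) xs"

text \<open>The adjacency matrix by rows, followed by the two vertices in binary.\<close>

definition ugc_bits :: "nat \<Rightarrow> nat set set \<Rightarrow> nat \<Rightarrow> nat \<Rightarrow> bool list" where
  "ugc_bits k E u v =
     concat (map (\<lambda>i. map (\<lambda>j. {i, j} \<in> E) [0..<k]) [0..<k]) @
     map (bit u) [0..<ceillog2 k] @ map (bit v) [0..<ceillog2 k]"

definition ugc_instances :: "bool list set" where
  "ugc_instances = {ugc_bits k E u v | k E u v. ugraph k E \<and> u < k \<and> v < k}"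

definition ugc_yes :: "bool list set" where
  "ugc_yes =
     {ugc_bits k E u v | k E u v. ugraph k E \<and> u < k \<and> v < k \<and> (\<exists>xs. connects E xs u v)}"

end

theory Submission
  imports Defs "HOL-Library.Discrete_Functions"
begin

text \<open>
  A network of constantly many layers is computed by threshold formulas of constant depth and
  polynomial fan-in, since this holds for each floating-point operation. Iterated addition reduces,
  by column sums in a large base, to one carry-lookahead addition. In an iterated sum of
  floating-point numbers, the summands are grouped into clusters with close exponents; the result
  is determined by the highest nonzero cluster and the sign of the next one. For a reciprocal
  \<open>1 / m\<close>, a truncated geometric series in \<open>2 ^ p - m\<close> is recovered from its remainders modulo small
  numbers, which depend only on the remainders of \<open>m\<close>.

  On the other hand, a formula of logarithmic depth is a series-parallel graph of polynomial size,
  whose terminals are connected if and only if the formula is true. A network that solves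
  connectivity would thus put \<open>NC1\<close> into \<open>TC0\<close>. The reverse inclusion holds because carry-save
  addition counts in logarithmic depth.
\<close>

section \<open>Functions computed by threshold formulas\<close>

text \<open>The obstacle is precision. With \<open>p\<close> polynomial in \<open>n\<close>,
  exponents range over \<open>2 ^ (p + 1)\<close> values, so shifting the summands of an iterated
  sum to a common exponent would take exponentially many bits; inside a cluster the offsets stay
  polynomial. Reciprocals are harder, because powers of a \<open>p\<close>-bit number are iterated
  products. Modulo a number of polynomial size, however, such powers are looked up in a table, and
  the value is then a linear combination of remainders, reduced by trying every possible quotient.
  Formulas replace circuits because at constant depth the loss of sharing costs only a polynomial
  factor, and because functions on a domain compose by substitution, without renumbering of gates.
  The domain also carries the promises: encodings have to behave well on valid instances only, and
  there no division by zero occurs. The reduction to connectivity has to be cheap as well. The shape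
  of the graph depends on the input length alone, and the input only switches edges on and off, so
  each adjacency bit is a disjunction of literals.\<close>

text \<open>
  Formulas are treated semantically: \<open>thr D X s mj d f\<close> says that on the domain \<open>D\<close> the Boolean
  function \<open>f\<close> has a formula of depth \<open>d\<close> and fan-in \<open>s\<close> over the input functions \<open>X\<close>, and
  \<open>mj\<close> tells whether majority gates are allowed.
\<close>

inductive thr ::
  "'a set \<Rightarrow> ('a \<Rightarrow> bool) set \<Rightarrow> nat \<Rightarrow> bool \<Rightarrow> nat \<Rightarrow> ('a \<Rightarrow> bool) \<Rightarrow> bool" for D X s mj where
  thr_input: "f \<in> X \<Longrightarrow> thr D X s mj d f"
| thr_const: "thr D X s mj d (\<lambda>_. b)"
| thr_Not: "thr D X s mj d f \<Longrightarrow> thr D X s mj (Suc d) (\<lambda>a. \<not> f a)"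
| thr_And: "(\<And>f. f \<in> set fs \<Longrightarrow> thr D X s mj d f) \<Longrightarrow> length fs \<le> s \<Longrightarrow>
    thr D X s mj (Suc d) (\<lambda>a. \<forall>f\<in>set fs. f a)"
| thr_Or: "(\<And>f. f \<in> set fs \<Longrightarrow> thr D X s mj d f) \<Longrightarrow> length fs \<le> s \<Longrightarrow>
    thr D X s mj (Suc d) (\<lambda>a. \<exists>f\<in>set fs. f a)"
| thr_Maj: "(\<And>f. f \<in> set fs \<Longrightarrow> thr D X s mj d f) \<Longrightarrow> length fs \<le> s \<Longrightarrow> mj \<Longrightarrow>
    thr D X s mj (Suc d) (\<lambda>a. length fs < 2 * length (filter (\<lambda>f. f a) fs))"
| thr_cong: "thr D X s mj d f \<Longrightarrow> (\<And>a. a \<in> D \<Longrightarrow> f a = g a) \<Longrightarrow> thr D X s mj d g"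

text \<open>Depths add when formulas are substituted for the inputs. The change of domain through
  \<open>h\<close> lets a formula for one encoding act on the data of another; exponentials, the
  maps between layers and the final reduction are composed in this way.\<close>

lemma thr_comp:
  assumes "thr D' Y s mj c f" "\<And>a. a \<in> D \<Longrightarrow> h a \<in> D'"
    "\<And>g. g \<in> Y \<Longrightarrow> thr D X s' mj d (\<lambda>a. g (h a))" "s \<le> s'"
  shows "thr D X s' mj (d + c) (\<lambda>a. f (h a))"
proof -
  have "thr D X s' mj (c' + d) (\<lambda>a. f (h a))" if "c \<le> c'" for c'
    using assms(1) that
  proof (induction arbitrary: c')
    case (thr_input f dd)
    \<comment> \<open>Monotonicity in the depth, proved on the spot because \<open>thr_mono\<close>
      is itself derived from this lemma.\<close>
    have m: "thr D X s' mj d f \<Longrightarrow> thr D X s' mj (k + d) f" for k d f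
    proof (induction rule: thr.induct)
      case (thr_cong d f g)
      then show ?case using thr.thr_cong by blast
    qed (auto intro: thr.intros)
    show ?case using m[OF assms(3)[OF thr_input(1)]] .
  next
    case (thr_const dd b)
    show ?case by (rule thr.thr_const)
  next
    case (thr_Not dd f)
    then obtain c'' where c'': "c' = Suc c''" by (cases c') auto
    with thr_Not show ?case by (auto intro!: thr.thr_Not)
  next
    case (thr_And fs dd)
    then obtain c'' where c'': "c' = Suc c''" by (cases c') auto
    have "thr D X s' mj (Suc (c'' + d)) (\<lambda>a. \<forall>f\<in>set (map (\<lambda>f a. f (h a)) fs). f a)"
      using thr_And c'' assms(4) by (intro thr.thr_And) auto
    then show ?case by (simp add: c'')
  next
    case (thr_Or fs dd)
    then obtain c'' where c'': "c' = Suc c''" by (cases c') auto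
    have "thr D X s' mj (Suc (c'' + d)) (\<lambda>a. \<exists>f\<in>set (map (\<lambda>f a. f (h a)) fs). f a)"
      using thr_Or c'' assms(4) by (intro thr.thr_Or) auto
    then show ?case by (simp add: c'')
  next
    case (thr_Maj fs dd)
    then obtain c'' where c'': "c' = Suc c''" by (cases c') auto
    have "thr D X s' mj (Suc (c'' + d)) (\<lambda>a. length (map (\<lambda>f a. f (h a)) fs) <
        2 * length (filter (\<lambda>f. f a) (map (\<lambda>f a. f (h a)) fs)))"
      using thr_Maj c'' assms(4) by (intro thr.thr_Maj) auto
    then show ?case by (simp add: c'' filter_map comp_def)
  next
    case (thr_cong dd f g)
    show ?case
      by (rule thr.thr_cong[OF thr_cong.IH[OF thr_cong.prems]]) (use thr_cong.hyps assms(2) in auto)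
  qed
  from this[of c] show ?thesis by (simp add: add.commute)
qed

text \<open>An input counts as a formula of every depth. Substituting the inputs, taken at depth
  \<open>d' - d\<close>, for themselves raises the depth.\<close>

lemma thr_mono:
  assumes "thr D X s mj d f" "d \<le> d'"
  shows "thr D X s mj d' f"
proof -
  have "thr D X s mj ((d' - d) + d) (\<lambda>a. f ((\<lambda>x. x) a))"
    using assms(1) by (rule thr_comp) (auto intro: thr_input)
  then show ?thesis using assms(2) by simp
qed

lemma thr_subdomain: "thr D X s mj d f \<Longrightarrow> D' \<subseteq> D \<Longrightarrow> thr D' X s mj d f"
  using thr_comp[where h = "\<lambda>x. x" and d = 0 and c = d and D = D' and D' = D and X = X and Y = X and s = s and s' = s]
  by (auto intro: thr_input)

lemma thr_conj:
  assumes "thr D X s mj i f" "thr D X s mj j g" "2 \<le> s"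
  shows "thr D X s mj (Suc (max i j)) (\<lambda>a. f a \<and> g a)"
proof -
  have "thr D X s mj (Suc (max i j)) (\<lambda>a. \<forall>f\<in>set [f, g]. f a)"
    using assms by (intro thr_And) (auto intro: thr_mono)
  then show ?thesis by simp
qed

lemma thr_disj:
  assumes "thr D X s mj i f" "thr D X s mj j g" "2 \<le> s"
  shows "thr D X s mj (Suc (max i j)) (\<lambda>a. f a \<or> g a)"
proof -
  have "thr D X s mj (Suc (max i j)) (\<lambda>a. \<exists>f\<in>set [f, g]. f a)"
    using assms by (intro thr_Or) (auto intro: thr_mono)
  then show ?thesis by simp
qed

lemma thr_xor:
  assumes "thr D X s mj i f" "thr D X s mj j g" "2 \<le> s"
  shows "thr D X s mj (Suc (Suc (Suc (max i j)))) (\<lambda>a. f a \<noteq> g a)"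
proof -
  have f: "thr D X s mj (max i j) f" and g: "thr D X s mj (max i j) g"
    using assms by (auto intro: thr_mono)
  have "thr D X s mj (Suc (max (Suc (max (Suc (max i j)) (max i j)))
      (Suc (max (max i j) (Suc (max i j)))))) (\<lambda>a. (\<not> f a \<and> g a) \<or> (f a \<and> \<not> g a))"
    by (intro thr_disj thr_conj thr_Not f g assms(3))
  then show ?thesis by (rule thr_mono[THEN thr_cong]) auto
qed

lemma thr_all_less:
  assumes "\<And>i. i < N \<Longrightarrow> thr D X s mj d (f i)" "N \<le> s"
  shows "thr D X s mj (Suc d) (\<lambda>a. \<forall>i<N. f i a)"
proof -
  have "thr D X s mj (Suc d) (\<lambda>a. \<forall>f\<in>set (map f [0..<N]). f a)"
    using assms by (intro thr_And) auto
  then show ?thesis by (rule thr_cong) (auto simp: atLeast0LessThan)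
qed

lemma thr_ex_less:
  assumes "\<And>i. i < N \<Longrightarrow> thr D X s mj d (f i)" "N \<le> s"
  shows "thr D X s mj (Suc d) (\<lambda>a. \<exists>i<N. f i a)"
proof -
  have "thr D X s mj (Suc d) (\<lambda>a. \<exists>f\<in>set (map f [0..<N]). f a)"
    using assms by (intro thr_Or) auto
  then show ?thesis by (rule thr_cong) (auto simp: atLeast0LessThan)
qed

lemma length_filter_replicates:
  "length (filter P (concat (map (\<lambda>(c, f). replicate c f) cs))) = (\<Sum>(c, f)\<leftarrow>cs. c * of_bool (P f))"
  by (induction cs) auto

text \<open>Padding with constants moves the threshold of a majority gate from one half to
  \<open>t\<close>, and a weight is realized by repeating a wire. At most \<open>W + 1\<close>
  constants are added, whence the fan-in \<open>2 * W + 2\<close>.\<close>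

lemma thr_count_ge:
  assumes "\<And>c f. (c, f) \<in> set cs \<Longrightarrow> thr D X s True d f"
    "sum_list (map fst cs) \<le> W" "2 * W + 2 \<le> s"
  shows "thr D X s True (Suc d) (\<lambda>a. t \<le> (\<Sum>(c, f)\<leftarrow>cs. c * of_bool (f a)))"
proof -
  define W0 where "W0 = sum_list (map fst cs)"
  have le: "(\<Sum>(c, f)\<leftarrow>cs. c * of_bool (f a)) \<le> W0" for a
    unfolding W0_def by (induction cs) (auto intro: add_mono)
  show ?thesis
  proof (cases "t \<le> W0")
    case False
    then have "thr D X s True (Suc d) (\<lambda>a. False)" by (intro thr_const)
    moreover have "\<not> t \<le> (\<Sum>(c, f)\<leftarrow>cs. c * of_bool (f a))" for a
      using False le[of a] by linarith
    ultimately show ?thesis by (auto intro: thr_cong)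
  next
    case True
    define x y where "x = W0 + 1 - 2 * t" and "y = 2 * t - (W0 + 1)"
    let ?cs = "concat (map (\<lambda>(c, f). replicate c f) cs)"
    define fs where "fs = ?cs @ replicate x (\<lambda>_. True) @ replicate y (\<lambda>_. False)"
    have len: "length ?cs = W0" unfolding W0_def by (induction cs) auto
    have "thr D X s True d f" if "f \<in> set fs" for f
      using that assms(1) by (auto simp: fs_def intro: thr_const split: if_splits)
    moreover have "length fs \<le> s"
      using assms(2,3) True by (simp only: fs_def length_append len length_replicate x_def y_def W0_def[symmetric])
    ultimately have "thr D X s True (Suc d) (\<lambda>a. length fs < 2 * length (filter (\<lambda>f. f a) fs))"
      by (intro thr_Maj) auto
    moreover have "length fs < 2 * length (filter (\<lambda>f. f a) fs) \<longleftrightarrow> t \<le> (\<Sum>(c, f)\<leftarrow>cs. c * of_bool (f a))" for a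
      unfolding fs_def filter_append length_append len length_filter_replicates
      using True unfolding x_def y_def by (cases "2 * t \<le> W0 + 1") (simp_all add: filter_replicate, linarith+)
    ultimately show ?thesis by (rule thr_cong)
  qed
qed

text \<open>The sum takes at most \<open>W + 1\<close> values, so any predicate of it is a
  disjunction over the admissible values, each recognized by two thresholds.\<close>

lemma thr_count:
  assumes "\<And>c f. (c, f) \<in> set cs \<Longrightarrow> thr D X s True d f"
    "sum_list (map fst cs) \<le> W" "2 * W + 2 \<le> s"
  shows "thr D X s True (d + 5) (\<lambda>a. P (\<Sum>(c, f)\<leftarrow>cs. c * of_bool (f a)))"
proof -
  let ?S = "\<lambda>a. \<Sum>(c, f)\<leftarrow>cs. c * of_bool (f a)"
  have le: "?S a \<le> W" for a
  proof -
    have "?S a \<le> sum_list (map fst cs)" by (induction cs) (auto intro: add_mono)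
    with assms(2) show ?thesis by simp
  qed
  have "thr D X s True (Suc (Suc (max 0 (Suc (max (Suc d) (Suc (Suc d)))))))
     (\<lambda>a. \<exists>v<W + 1. P v \<and> v \<le> ?S a \<and> \<not> v + 1 \<le> ?S a)"
    using assms by (intro thr_ex_less thr_conj thr_Not thr_count_ge thr_const) auto
  moreover have "(\<exists>v<W + 1. P v \<and> v \<le> ?S a \<and> \<not> v + 1 \<le> ?S a) \<longleftrightarrow> P (?S a)" for a
    using le[of a] le_antisym[of _ "?S a"] by (auto simp: not_less_eq_eq intro: exI[of _ "?S a"])
  ultimately show ?thesis by (simp add: eval_nat_numeral)
qed


section \<open>Circuits and formulas\<close>

definition gvals :: "gate list \<Rightarrow> bool list \<Rightarrow> bool list" where
  "gvals gs x = fold (\<lambda>g v. v @ [gate_val v g]) gs x"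

definition gdepths :: "nat \<Rightarrow> gate list \<Rightarrow> nat list" where
  "gdepths n gs = fold (\<lambda>g ds. ds @ [Suc (Max (insert 0 ((\<lambda>j. ds ! j) ` set (gate_args g))))])
     gs (replicate n 0)"

definition gates_wf :: "nat \<Rightarrow> gate list \<Rightarrow> bool" where
  "gates_wf n gs \<longleftrightarrow> (\<forall>k<length gs. \<forall>j\<in>set (gate_args (gs ! k)). j < n + k)"

fun gate_ok :: "nat \<Rightarrow> bool \<Rightarrow> gate \<Rightarrow> bool" where
  "gate_ok s mj (And_gate js) = (length js \<le> s)"
| "gate_ok s mj (Or_gate js) = (length js \<le> s)"
| "gate_ok s mj (Maj_gate js) = (mj \<and> length js \<le> s)"
| "gate_ok s mj (Not_gate j) = True"

lemma gvals_Nil [simp]: "gvals [] x = x"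
  by (simp add: gvals_def)

lemma gvals_snoc [simp]: "gvals (gs @ [g]) x = gvals gs x @ [gate_val (gvals gs x) g]"
  by (simp add: gvals_def)

lemma length_gvals [simp]: "length (gvals gs x) = length x + length gs"
  by (induction gs rule: rev_induct) auto

lemma gvals_append_nth: "j < length x + length gs \<Longrightarrow> gvals (gs @ hs) x ! j = gvals gs x ! j"
  by (induction hs rule: rev_induct) (auto simp: append_assoc[symmetric] nth_append simp del: append_assoc)

lemma gdepths_Nil [simp]: "gdepths n [] = replicate n 0"
  by (simp add: gdepths_def)

lemma gdepths_snoc [simp]: "gdepths n (gs @ [g]) =
    gdepths n gs @ [Suc (Max (insert 0 ((\<lambda>j. gdepths n gs ! j) ` set (gate_args g))))]"
  by (simp add: gdepths_def)

lemma length_gdepths [simp]: "length (gdepths n gs) = n + length gs"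
  by (induction gs rule: rev_induct) auto

lemma gdepths_append_nth: "j < n + length gs \<Longrightarrow> gdepths n (gs @ hs) ! j = gdepths n gs ! j"
  by (induction hs rule: rev_induct) (auto simp: append_assoc[symmetric] nth_append simp del: append_assoc)

lemma gates_wf_Nil [simp]: "gates_wf n []"
  by (simp add: gates_wf_def)

lemma gates_wf_snoc [simp]:
  "gates_wf n (gs @ [g]) \<longleftrightarrow> gates_wf n gs \<and> (\<forall>j\<in>set (gate_args g). j < n + length gs)"
  by (auto simp: gates_wf_def nth_append less_Suc_eq)

text \<open>Unfolding shared gates into a tree preserves depth and fan-in, and these are all that
  \<open>thr\<close> measures.\<close>

lemma gates_thr:
  assumes "gates_wf n gs" "\<forall>g\<in>set gs. gate_ok s mj g" "j < n + length gs"
  shows "thr {x. length x = n} ((\<lambda>i x. x ! i) ` {..<n}) s mj (gdepths n gs ! j) (\<lambda>x. gvals gs x ! j)"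
  using assms
proof (induction gs arbitrary: j rule: rev_induct)
  case Nil
  then show ?case by (auto intro!: thr_input)
next
  case (snoc g gs)
  let ?X = "(\<lambda>i x. x ! i) ` {..<n} :: (bool list \<Rightarrow> bool) set" and ?D = "{x :: bool list. length x = n}"
  note IH = snoc.IH[of j] snoc.prems
  show ?case
  proof (cases "j < n + length gs")
    case True
    with snoc have "thr ?D ?X s mj (gdepths n gs ! j) (\<lambda>x. gvals gs x ! j)" by auto
    then show ?thesis
      using True by (auto simp: nth_append intro: thr_cong)
  next
    case False
    with snoc have j: "j = n + length gs" by auto
    let ?d = "Max (insert 0 ((\<lambda>j. gdepths n gs ! j) ` set (gate_args g)))"
    have args: "thr ?D ?X s mj ?d (\<lambda>x. gvals gs x ! i)" if "i \<in> set (gate_args g)" for i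
      by (rule thr_mono[of _ _ _ _ "gdepths n gs ! i"]) (use snoc that in auto)
    have "thr ?D ?X s mj (Suc ?d) (\<lambda>x. gate_val (gvals gs x) g)"
    proof (cases g)
      case (And_gate js)
      have "thr ?D ?X s mj (Suc ?d) (\<lambda>x. \<forall>f\<in>set (map (\<lambda>i x. gvals gs x ! i) js). f x)"
        using args snoc And_gate by (intro thr_And) auto
      then show ?thesis by (simp add: And_gate)
    next
      case (Or_gate js)
      have "thr ?D ?X s mj (Suc ?d) (\<lambda>x. \<exists>f\<in>set (map (\<lambda>i x. gvals gs x ! i) js). f x)"
        using args snoc Or_gate by (intro thr_Or) auto
      then show ?thesis by (simp add: Or_gate)
    next
      case (Maj_gate js)
      have "thr ?D ?X s mj (Suc ?d) (\<lambda>x. length (map (\<lambda>i x. gvals gs x ! i) js) <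
          2 * length (filter (\<lambda>f. f x) (map (\<lambda>i x. gvals gs x ! i) js)))"
        using args snoc Maj_gate by (intro thr_Maj) auto
      then show ?thesis by (simp add: Maj_gate filter_map comp_def)
    next
      case (Not_gate i)
      have "thr ?D ?X s mj (Suc ?d) (\<lambda>x. \<not> gvals gs x ! i)"
        using args[of i] Not_gate by (intro thr_Not) auto
      then show ?thesis by (simp add: Not_gate)
    qed
    moreover have "gdepths n (gs @ [g]) ! j = Suc ?d"
      by (simp add: j nth_append)
    ultimately show ?thesis
      by (auto intro!: thr_cong[of ?D _ _ _ _ "\<lambda>x. gate_val (gvals gs x) g"] simp: j nth_append)
  qed
qed

lemma circuit_thr:
  assumes "circuit_wf C" "\<forall>g\<in>set (gates C). gate_ok s mj g" "j < length (outs C)" "circuit_depth C \<le> c"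
  shows "thr {x. length x = n_in C} ((\<lambda>i x. x ! i) ` {..<n_in C}) s mj c (\<lambda>x. circuit_eval C x ! j)"
proof -
  have wf: "gates_wf (n_in C) (gates C)" and o: "outs C ! j < n_in C + length (gates C)"
    using assms by (auto simp: circuit_wf_def gates_wf_def)
  have "gdepths (n_in C) (gates C) ! (outs C ! j) \<in> set (node_depths C)"
    using o by (auto simp: node_depths_def gdepths_def[symmetric])
  then have "gdepths (n_in C) (gates C) ! (outs C ! j) \<le> c"
    using assms(4) by (auto simp: circuit_depth_def)
  from thr_mono[OF gates_thr[OF wf assms(2) o] this] show ?thesis
    using assms(3) by (simp add: circuit_eval_def node_vals_def gvals_def[symmetric])
qed

text \<open>Wires count towards the size, so the size bounds every fan-in.\<close>

lemma gate_ok_size: "circuit_size C \<le> s \<Longrightarrow> g \<in> set (gates C) \<Longrightarrow> gate_ok s True g"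
proof -
  assume s: "circuit_size C \<le> s" and g: "g \<in> set (gates C)"
  have "1 + length (gate_args g) \<le> circuit_size C"
    unfolding circuit_size_def using g by (intro member_le_sum_list) auto
  with s show ?thesis by (cases g) auto
qed

section \<open>From formulas back to circuits\<close>

definition gates_size :: "gate list \<Rightarrow> nat" where
  "gates_size gs = (\<Sum>g\<leftarrow>gs. 1 + length (gate_args g))"

lemma gates_size_simps [simp]:
  "gates_size [] = 0" "gates_size (gs @ hs) = gates_size gs + gates_size hs"
  "gates_size [g] = 1 + length (gate_args g)"
  by (auto simp: gates_size_def)

definition node_ok :: "'a set \<Rightarrow> ('a \<Rightarrow> bool list) \<Rightarrow> nat \<Rightarrow> gate list \<Rightarrow> nat \<Rightarrow> ('a \<Rightarrow> bool) \<Rightarrow> nat \<Rightarrow> bool" where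
  "node_ok D inp n gs d f j \<longleftrightarrow> j < n + length gs \<and> gdepths n gs ! j \<le> d \<and>
     (\<forall>a\<in>D. gvals gs (inp a) ! j = f a)"

text \<open>New gates are appended to a list already in use. Earlier node numbers and values stay
  valid, so the subformulas of a formula can be compiled one after another into the same
  list.\<close>

definition prolongs :: "nat \<Rightarrow> nat \<Rightarrow> bool \<Rightarrow> gate list \<Rightarrow> nat \<Rightarrow> nat \<Rightarrow> gate list \<Rightarrow> bool" where
  "prolongs n s mj gs d k hs \<longleftrightarrow> gates_wf n (gs @ hs) \<and> (\<forall>g\<in>set hs. gate_ok s mj g) \<and>
     gates_size hs \<le> k \<and> (\<forall>j\<in>{n + length gs..<n + length gs + length hs}. gdepths n (gs @ hs) ! j \<le> d)"

lemma prolongs_append: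
  assumes "prolongs n s mj gs d k hs" "prolongs n s mj (gs @ hs) d' l hs'" "d \<le> d'"
  shows "prolongs n s mj gs d' (k + l) (hs @ hs')"
proof -
  have "gdepths n (gs @ hs @ hs') ! j \<le> d'" if "j \<in> {n + length gs..<n + length gs + length (hs @ hs')}" for j
  proof (cases "j < n + length (gs @ hs)")
    case True
    then have "gdepths n (gs @ hs @ hs') ! j = gdepths n (gs @ hs) ! j"
      using gdepths_append_nth[of j n "gs @ hs" hs'] by simp
    moreover have "j \<in> {n + length gs..<n + length gs + length hs}" using True that by auto
    then have "gdepths n (gs @ hs) ! j \<le> d" using assms(1) by (simp add: prolongs_def)
    ultimately show ?thesis using assms(3) by simp
  next
    case False
    with that assms(2) show ?thesis by (auto simp: prolongs_def)
  qed
  with assms show ?thesis by (auto simp: prolongs_def)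
qed

lemma node_ok_append:
  assumes "node_ok D inp n gs d f j" "\<And>a. a \<in> D \<Longrightarrow> length (inp a) = n"
  shows "node_ok D inp n (gs @ hs) d f j"
  using assms by (auto simp: node_ok_def gdepths_append_nth gvals_append_nth)

lemma prolongs_list:
  assumes "\<And>f gs. f \<in> set fs \<Longrightarrow> gates_wf n gs \<Longrightarrow> \<exists>hs j. prolongs n s mj gs d k hs \<and> node_ok D inp n (gs @ hs) d f j"
    "\<And>a. a \<in> D \<Longrightarrow> length (inp a) = n" "gates_wf n gs"
  shows "\<exists>hs js. prolongs n s mj gs d (length fs * k) hs \<and> list_all2 (node_ok D inp n (gs @ hs) d) fs js"
  using assms(1,3)
proof (induction fs arbitrary: gs)
  case Nil
  then show ?case by (intro exI[of _ "[]"]) (auto simp: prolongs_def)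
next
  case (Cons f fs)
  obtain hs j where 1: "prolongs n s mj gs d k hs" "node_ok D inp n (gs @ hs) d f j"
    using Cons.prems by fastforce
  have "gates_wf n (gs @ hs)" using 1 by (auto simp: prolongs_def)
  with Cons obtain hs' js where 2: "prolongs n s mj (gs @ hs) d (length fs * k) hs'"
    "list_all2 (node_ok D inp n ((gs @ hs) @ hs') d) fs js" by fastforce
  have "prolongs n s mj gs d (length (f # fs) * k) (hs @ hs')"
    using prolongs_append[OF 1(1) 2(1)] by simp
  moreover have "list_all2 (node_ok D inp n (gs @ hs @ hs') d) (f # fs) (j # js)"
    using 2(2) node_ok_append[OF 1(2) assms(2), of hs'] by simp
  ultimately show ?case by blast
qed

lemma prolongs_gate:
  assumes p: "prolongs n s mj gs d k hs" and js: "list_all2 (node_ok D inp n (gs @ hs) d) fs js"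
    and g: "set (gate_args g) = set js" "length (gate_args g) = length fs" "gate_ok s mj g"
    and v: "\<And>a. a \<in> D \<Longrightarrow> gate_val (gvals (gs @ hs) (inp a)) g = f a"
    and inp: "\<And>a. a \<in> D \<Longrightarrow> length (inp a) = n"
  shows "\<exists>hs j. prolongs n s mj gs (Suc d) (k + 1 + length fs) hs \<and> node_ok D inp n (gs @ hs) (Suc d) f j"
proof -
  have j: "i < n + length (gs @ hs) \<and> gdepths n (gs @ hs) ! i \<le> d" if "i \<in> set js" for i
  proof -
    from that obtain t where "t < length js" "i = js ! t" by (auto simp: in_set_conv_nth)
    with js have "node_ok D inp n (gs @ hs) d (fs ! t) i" by (auto simp: list_all2_conv_all_nth)
    then show ?thesis by (auto simp: node_ok_def)
  qed
  have dep: "Max (insert 0 ((\<lambda>j. gdepths n (gs @ hs) ! j) ` set (gate_args g))) \<le> d"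
    using j g(1) by auto
  have pg: "prolongs n s mj (gs @ hs) (Suc d) (1 + length fs) [g]"
    using p j g dep by (auto simp: prolongs_def append_assoc[symmetric] nth_append less_Suc_eq simp del: append_assoc)
  have "prolongs n s mj gs (Suc d) (k + (1 + length fs)) (hs @ [g])"
    by (rule prolongs_append[OF p pg]) simp
  moreover have "node_ok D inp n (gs @ hs @ [g]) (Suc d) f (n + length (gs @ hs))"
    using dep v inp unfolding node_ok_def append_assoc[symmetric]
    by (simp add: nth_append del: append_assoc)
  ultimately show ?thesis by (auto simp: add.assoc)
qed

lemma gate_val_list:
  assumes "list_all2 (node_ok D inp n gs d) fs js" "a \<in> D"
  shows "(\<forall>j\<in>set js. gvals gs (inp a) ! j) \<longleftrightarrow> (\<forall>f\<in>set fs. f a)"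
    "(\<exists>j\<in>set js. gvals gs (inp a) ! j) \<longleftrightarrow> (\<exists>f\<in>set fs. f a)"
    "length (filter (\<lambda>j. gvals gs (inp a) ! j) js) = length (filter (\<lambda>f. f a) fs)"
  using assms by (induction rule: list_all2_induct) (auto simp: node_ok_def)

text \<open>The recursion for the size: \<open>m\<close> subformulas, one gate and its
  \<open>m\<close> wires.\<close>

lemma size_step: "m \<le> s \<Longrightarrow> m * (s + 2) ^ Suc d + 1 + m \<le> (s + 2) ^ Suc (Suc d)" for s :: nat
proof -
  assume "m \<le> s"
  then have "m * (s + 2) ^ Suc d \<le> s * (s + 2) ^ Suc d" by (rule mult_right_mono) simp
  moreover have "s + 1 \<le> (s + 2) ^ Suc d" using self_le_power[of "s + 2" "Suc d"] by linarith
  moreover have "(s + 2) ^ Suc (Suc d) = s * (s + 2) ^ Suc d + 2 * (s + 2) ^ Suc d" by (simp add: algebra_simps)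
  ultimately show ?thesis using \<open>m \<le> s\<close> by linarith
qed

text \<open>The depth is \<open>Suc d\<close> because a constant, a formula of depth 0, becomes a
  gate without arguments. The size bound serves twice: it is polynomial for polynomial
  \<open>s\<close> and constant depth, and also for constant \<open>s\<close> and logarithmic
  depth.\<close>

lemma thr_prolongs:
  assumes "thr D X s mj d f" "X = (\<lambda>i a. inp a ! i) ` {..<n}" "\<And>a. a \<in> D \<Longrightarrow> length (inp a) = n"
    "gates_wf n gs" "0 < s"
  shows "\<exists>hs j. prolongs n s mj gs (Suc d) ((s + 2) ^ Suc d) hs \<and> node_ok D inp n (gs @ hs) (Suc d) f j"
  using assms(1,4)
proof (induction arbitrary: gs)
  case (thr_input f d)
  then obtain i where i: "i < n" "f = (\<lambda>a. inp a ! i)" using assms(2) by auto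
  have "gvals gs (inp a) ! i = inp a ! i" if "a \<in> D" for a
    using gvals_append_nth[of i "inp a" "[]" gs] i assms(3)[OF that] by simp
  moreover have "gdepths n gs ! i = 0"
    using gdepths_append_nth[of i n "[]" gs] i by simp
  ultimately have "node_ok D inp n gs (Suc d) f i" using i by (auto simp: node_ok_def)
  then show ?case using thr_input by (intro exI[of _ "[]"]) (auto simp: prolongs_def)
next
  case (thr_const d b)
  let ?g = "if b then And_gate [] else Or_gate []"
  have "\<exists>hs j. prolongs n s mj gs (Suc 0) (0 + 1 + length ([] :: ('a \<Rightarrow> bool) list)) hs \<and>
      node_ok D inp n (gs @ hs) (Suc 0) (\<lambda>_. b) j"
    by (rule prolongs_gate[where hs = "[]" and g = ?g and js = "[]"]) (use thr_const assms(3) in \<open>auto simp: prolongs_def\<close>)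
  then obtain hs j where 1: "prolongs n s mj gs (Suc 0) 1 hs" "node_ok D inp n (gs @ hs) (Suc 0) (\<lambda>_. b) j"
    by auto
  have "1 \<le> (s + 2) ^ Suc d" by (rule one_le_power) simp
  with 1 have "prolongs n s mj gs (Suc d) ((s + 2) ^ Suc d) hs" "node_ok D inp n (gs @ hs) (Suc d) (\<lambda>_. b) j"
    unfolding prolongs_def node_ok_def by (meson le_trans Suc_le_mono le0)+
  then show ?case by blast
next
  case (thr_Not d f)
  then obtain hs j where 1: "prolongs n s mj gs (Suc d) ((s + 2) ^ Suc d) hs" "node_ok D inp n (gs @ hs) (Suc d) f j"
    by blast
  have "\<exists>hs j. prolongs n s mj gs (Suc (Suc d)) ((s + 2) ^ Suc d + 1 + length [f]) hs \<and>
      node_ok D inp n (gs @ hs) (Suc (Suc d)) (\<lambda>a. \<not> f a) j"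
    by (rule prolongs_gate[where g = "Not_gate j" and js = "[j]", OF 1(1)])
      (use 1 assms(3) in \<open>auto simp: node_ok_def\<close>)
  moreover have "(s + 2) ^ Suc d + 1 + length [f] \<le> (s + 2) ^ Suc (Suc d)"
    using size_step[of 1 s d] assms(5) by simp
  ultimately show ?case unfolding prolongs_def by (meson le_trans)
next
  case (thr_And fs d)
  have "\<exists>hs js. prolongs n s mj gs (Suc d) (length fs * (s + 2) ^ Suc d) hs \<and> list_all2 (node_ok D inp n (gs @ hs) (Suc d)) fs js"
    by (rule prolongs_list) (use thr_And assms(3) in auto)
  then obtain hs js where 1: "prolongs n s mj gs (Suc d) (length fs * (s + 2) ^ Suc d) hs"
    "list_all2 (node_ok D inp n (gs @ hs) (Suc d)) fs js" by blast
  have "\<exists>hs j. prolongs n s mj gs (Suc (Suc d)) (length fs * (s + 2) ^ Suc d + 1 + length fs) hs \<and>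
      node_ok D inp n (gs @ hs) (Suc (Suc d)) (\<lambda>a. \<forall>f\<in>set fs. f a) j"
    by (rule prolongs_gate[where g = "And_gate js", OF 1])
      (use thr_And 1 gate_val_list[OF 1(2)] assms(3) in \<open>auto dest: list_all2_lengthD\<close>)
  then show ?case using size_step[OF thr_And.hyps(2), of d] unfolding prolongs_def by (meson le_trans)
next
  case (thr_Or fs d)
  have "\<exists>hs js. prolongs n s mj gs (Suc d) (length fs * (s + 2) ^ Suc d) hs \<and> list_all2 (node_ok D inp n (gs @ hs) (Suc d)) fs js"
    by (rule prolongs_list) (use thr_Or assms(3) in auto)
  then obtain hs js where 1: "prolongs n s mj gs (Suc d) (length fs * (s + 2) ^ Suc d) hs"
    "list_all2 (node_ok D inp n (gs @ hs) (Suc d)) fs js" by blast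
  have "\<exists>hs j. prolongs n s mj gs (Suc (Suc d)) (length fs * (s + 2) ^ Suc d + 1 + length fs) hs \<and>
      node_ok D inp n (gs @ hs) (Suc (Suc d)) (\<lambda>a. \<exists>f\<in>set fs. f a) j"
    by (rule prolongs_gate[where g = "Or_gate js", OF 1])
      (use thr_Or 1 gate_val_list[OF 1(2)] assms(3) in \<open>auto dest: list_all2_lengthD\<close>)
  then show ?case using size_step[OF thr_Or.hyps(2), of d] unfolding prolongs_def by (meson le_trans)
next
  case (thr_Maj fs d)
  have "\<exists>hs js. prolongs n s mj gs (Suc d) (length fs * (s + 2) ^ Suc d) hs \<and> list_all2 (node_ok D inp n (gs @ hs) (Suc d)) fs js"
    by (rule prolongs_list) (use thr_Maj assms(3) in auto)
  then obtain hs js where 1: "prolongs n s mj gs (Suc d) (length fs * (s + 2) ^ Suc d) hs"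
    "list_all2 (node_ok D inp n (gs @ hs) (Suc d)) fs js" by blast
  have "\<exists>hs j. prolongs n s mj gs (Suc (Suc d)) (length fs * (s + 2) ^ Suc d + 1 + length fs) hs \<and>
      node_ok D inp n (gs @ hs) (Suc (Suc d)) (\<lambda>a. length fs < 2 * length (filter (\<lambda>f. f a) fs)) j"
    by (rule prolongs_gate[where g = "Maj_gate js", OF 1])
      (use thr_Maj 1 gate_val_list[OF 1(2)] assms(3) in \<open>auto dest: list_all2_lengthD\<close>)
  then show ?case using size_step[OF thr_Maj.hyps(2), of d] unfolding prolongs_def by (meson le_trans)
next
  case (thr_cong d f g)
  then show ?case by (fastforce simp: node_ok_def)
qed

lemma thr_circuit:
  assumes "thr {x. length x = n} ((\<lambda>i x. x ! i) ` {..<n}) s mj d f" "0 < s"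
  shows "\<exists>C. circuit_wf C \<and> n_in C = n \<and> circuit_depth C \<le> Suc d \<and> circuit_size C \<le> (s + 2) ^ Suc d \<and>
     (\<forall>g\<in>set (gates C). gate_ok s mj g) \<and> (\<forall>x. length x = n \<longrightarrow> circuit_eval C x = [f x])"
proof -
  obtain hs j where hs: "prolongs n s mj [] (Suc d) ((s + 2) ^ Suc d) hs"
    and j: "node_ok {x. length x = n} (\<lambda>x. x) n ([] @ hs) (Suc d) f j"
    using thr_prolongs[OF assms(1), of "\<lambda>x. x" n "[]"] assms(2) by auto
  let ?C = "\<lparr>n_in = n, gates = hs, outs = [j]\<rparr>"
  have "gdepths n hs ! i \<le> Suc d" if "i < n + length hs" for i
  proof (cases "i < n")
    case True
    then show ?thesis using gdepths_append_nth[of i n "[]" hs] by simp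
  next
    case False
    with hs that show ?thesis by (auto simp: prolongs_def)
  qed
  then have "circuit_depth ?C \<le> Suc d"
    by (auto simp: circuit_depth_def node_depths_def gdepths_def[symmetric] in_set_conv_nth)
  moreover have "circuit_wf ?C"
    using hs j by (auto simp: circuit_wf_def prolongs_def gates_wf_def node_ok_def)
  ultimately show ?thesis
    using hs j by (intro exI[of _ ?C])
      (auto simp: prolongs_def node_ok_def circuit_size_def gates_size_def circuit_eval_def node_vals_def gvals_def[symmetric])
qed

section \<open>Arithmetic by threshold formulas\<close>

lemma carry_lookahead:
  fixes x y :: nat
  shows "2 ^ i \<le> take_bit i x + take_bit i y \<longleftrightarrow>
    (\<exists>j<i. bit x j \<and> bit y j \<and> (\<forall>k<i. j < k \<longrightarrow> bit x k \<or> bit y k))"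
proof (induction i)
  case (Suc i)
  have x: "take_bit i x < 2 ^ i" and y: "take_bit i y < 2 ^ i" by simp_all
  have "(\<exists>j<Suc i. bit x j \<and> bit y j \<and> (\<forall>k<Suc i. j < k \<longrightarrow> bit x k \<or> bit y k)) \<longleftrightarrow>
    (bit x i \<and> bit y i) \<or> ((bit x i \<or> bit y i) \<and>
      (\<exists>j<i. bit x j \<and> bit y j \<and> (\<forall>k<i. j < k \<longrightarrow> bit x k \<or> bit y k)))"
    by (auto simp: less_Suc_eq)
  moreover have "2 ^ Suc i \<le> take_bit (Suc i) x + take_bit (Suc i) y \<longleftrightarrow>
    (bit x i \<and> bit y i) \<or> ((bit x i \<or> bit y i) \<and> 2 ^ i \<le> take_bit i x + take_bit i y)"
    unfolding take_bit_Suc_from_most using x y by (cases "bit x i"; cases "bit y i"; simp; linarith?)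
  ultimately show ?case using Suc.IH by simp
qed simp

lemma bit_add_nat:
  fixes x y :: nat
  shows "bit (x + y) i \<longleftrightarrow> (bit x i \<noteq> (bit y i \<noteq>
    (\<exists>j<i. bit x j \<and> bit y j \<and> (\<forall>k<i. j < k \<longrightarrow> bit x k \<or> bit y k))))"
proof -
  define c where "c \<longleftrightarrow> 2 ^ i \<le> take_bit i x + take_bit i y"
  have "take_bit i x + take_bit i y < 2 ^ i + 2 ^ i" by (intro add_strict_mono) simp_all
  then have "(take_bit i x + take_bit i y) div 2 ^ i = of_bool c"
    by (auto simp: c_def not_le intro: div_nat_eqI)
  then have "(x + y) div 2 ^ i = x div 2 ^ i + y div 2 ^ i + of_bool c"
    unfolding div_add1_eq[of x y] take_bit_eq_mod by simp
  then have "bit (x + y) i \<longleftrightarrow> (bit x i \<noteq> (bit y i \<noteq> c))"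
    by (auto simp: bit_iff_odd)
  then show ?thesis by (simp add: c_def carry_lookahead)
qed

lemma digit_sum_less:
  fixes r :: "nat \<Rightarrow> nat"
  assumes "\<And>j. r j < b"
  shows "(\<Sum>j<J. r j * b ^ j) < b ^ J"
proof (induction J)
  case (Suc J)
  have "r J * b ^ J + b ^ J \<le> b * b ^ J"
    using mult_right_mono[of "r J + 1" b "b ^ J"] assms[of J] by (simp add: algebra_simps)
  with Suc show ?case by simp
qed simp

lemma digit_sum_digit:
  fixes r :: "nat \<Rightarrow> nat"
  assumes "\<And>j. r j < b" "m < J"
  shows "(\<Sum>j<J. r j * b ^ j) div b ^ m mod b = r m"
proof -
  have b: "0 < b" using assms(1)[of 0] by simp
  have "(\<Sum>j<J. r j * b ^ j) = (\<Sum>j<m. r j * b ^ j) + (\<Sum>j=m..<J. r j * b ^ j)"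
    using assms(2) by (metis less_imp_le_nat atLeast0LessThan sum.atLeastLessThan_concat zero_le)
  also have "(\<Sum>j=m..<J. r j * b ^ j) = r m * b ^ m + (\<Sum>j=Suc m..<J. r j * b ^ j)"
    using assms(2) by (simp add: sum.atLeast_Suc_lessThan)
  also have "(\<Sum>j=Suc m..<J. r j * b ^ j) = (\<Sum>j=Suc m..<J. r j * b ^ (j - Suc m)) * b * b ^ m"
    unfolding sum_distrib_right
  proof (rule sum.cong)
    fix j assume "j \<in> {Suc m..<J}"
    then have "b ^ j = b ^ (j - Suc m) * b * b ^ m"
      by (metis atLeastLessThan_iff le_add_diff_inverse2 mult.assoc power_Suc power_add)
    then show "r j * b ^ j = r j * b ^ (j - Suc m) * b * b ^ m" by simp
  qed simp
  finally have "(\<Sum>j<J. r j * b ^ j) =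
      (\<Sum>j<m. r j * b ^ j) + (r m + (\<Sum>j=Suc m..<J. r j * b ^ (j - Suc m)) * b) * b ^ m"
    by (simp add: algebra_simps)
  then have "(\<Sum>j<J. r j * b ^ j) div b ^ m = r m + (\<Sum>j=Suc m..<J. r j * b ^ (j - Suc m)) * b"
    using digit_sum_less[of r b m, OF assms(1)] b by simp
  then show ?thesis using assms(1) by simp
qed

lemma digit_sum_bit:
  fixes r :: "nat \<Rightarrow> nat"
  assumes "\<And>j. r j < 2 ^ B" "i < B * J"
  shows "bit (\<Sum>j<J. r j * (2 ^ B) ^ j) i \<longleftrightarrow> bit (r (i div B)) (i mod B)"
proof -
  let ?S = "\<Sum>j<J. r j * (2 ^ B) ^ j"
  have B: "0 < B" using assms(2) by (cases B) auto
  have m: "i div B < J" using assms(2) by (simp add: less_mult_imp_div_less mult.commute)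
  have "bit ?S i = bit (?S div (2 ^ B) ^ (i div B)) (i mod B)"
    by (simp add: bit_iff_odd div_mult2_eq[symmetric] power_mult[symmetric] power_add[symmetric])
  also have "\<dots> = bit (take_bit B (?S div (2 ^ B) ^ (i div B))) (i mod B)"
    using B by (simp add: bit_take_bit_iff)
  also have "take_bit B (?S div (2 ^ B) ^ (i div B)) = r (i div B)"
    using digit_sum_digit[of r "2 ^ B" "i div B" J] assms(1) m by (simp add: take_bit_eq_mod)
  finally show ?thesis .
qed

lemma digits_mod: "(\<Sum>j<J. (c div b ^ j mod b) * b ^ j) = c mod b ^ J" for c :: nat
  by (induction J) (simp_all add: mod_mult2_eq mult.commute[of b])

lemma sum_list_sum_swap:
  fixes g :: "nat \<Rightarrow> 'b \<Rightarrow> 'c :: comm_semiring_1"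
  shows "(\<Sum>j<J. (\<Sum>x\<leftarrow>xs. g j x)) = (\<Sum>x\<leftarrow>xs. \<Sum>j<J. g j x)"
  by (induction xs) (simp_all add: sum.distrib)

lemma sum_list_mod: "(\<Sum>x\<leftarrow>xs. g x mod m) mod m = (\<Sum>x\<leftarrow>xs. g x) mod (m::'b::euclidean_semiring_cancel)"
  by (induction xs) (auto simp: mod_simps intro: mod_add_cong)

text \<open>
  Write the weights in base \<open>b = 2 ^ B\<close>. If \<open>b\<close> exceeds the number of summands, then every column
  sum has two digits, so that an iterated sum is, modulo a power of \<open>b\<close>, the sum of two numbers
  whose bits depend on one column sum each.
\<close>

lemma iterated_sum_split:
  fixes cs :: "(nat \<times> ('a \<Rightarrow> bool)) list"
  assumes K: "length cs < 2 ^ B" and B: "0 < B"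
  defines "clm \<equiv> \<lambda>j. map (\<lambda>(c, f). (c div (2 ^ B) ^ j mod 2 ^ B, f)) cs"
  defines "cnt \<equiv> \<lambda>j a. (\<Sum>(c, f)\<leftarrow>clm j. c * of_bool (f a))"
  shows "\<exists>(x::nat) y. (\<forall>i. bit (\<Sum>(c, f)\<leftarrow>cs. c * of_bool (f a)) i = bit (x + y) i \<or> n < i) \<and>
     (\<forall>i\<le>n. bit x i = bit (cnt (i div B) a mod 2 ^ B) (i mod B)) \<and>
     (\<forall>i\<le>n. bit y i = (B \<le> i \<and> bit (cnt (i div B - 1) a div 2 ^ B) (i mod B)))"
proof -
  let ?b = "2 ^ B :: nat"
  \<comment> \<open>\<open>Suc n\<close> digits in base \<open>2 ^ B\<close> cover all bits up to
    \<open>n\<close>, because \<open>0 < B\<close>.\<close>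
  define J where "J = Suc n"
  \<comment> \<open>The high digit of column \<open>j\<close> moves to place \<open>j + 1\<close>,
    which leaves the digit 0 at place 0.\<close>
  define q where "q j = (case j of 0 \<Rightarrow> 0 | Suc j \<Rightarrow> cnt j a div ?b)" for j
  define x where "x = (\<Sum>j<J. (cnt j a mod ?b) * ?b ^ j)"
  define y where "y = (\<Sum>j<Suc J. q j * ?b ^ j)"
  have J: "i < B * J" if "i \<le> n" for i
    using B that mult_le_mono[of 1 B "Suc n" "Suc n"] by (simp add: J_def)
  have cnt: "cnt j a < ?b * ?b" for j
  proof -
    have "(\<Sum>(c, f)\<leftarrow>cs. (c div ?b ^ j mod ?b) * of_bool (f a)) \<le> length cs * ?b"
    proof (induction cs)
      case (Cons p cs)
      have "(fst p div ?b ^ j mod ?b) * of_bool (snd p a) \<le> ?b" by (simp add: less_imp_le)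
      from add_mono[OF this Cons] show ?case by (simp add: case_prod_unfold)
    qed simp
    also have "\<dots> < ?b * ?b" using K by simp
    finally show ?thesis by (simp add: cnt_def clm_def comp_def case_prod_unfold)
  qed
  have qb: "q j < ?b" for j
    using cnt by (auto simp: q_def less_mult_imp_div_less split: nat.splits)
  have xy: "x + y = (\<Sum>j<J. cnt j a * ?b ^ j)"
  proof -
    have "y = (\<Sum>j<J. (cnt j a div ?b) * ?b ^ Suc j)"
      unfolding y_def by (subst sum.lessThan_Suc_shift) (simp add: q_def)
    then have "x + y = (\<Sum>j<J. (cnt j a mod ?b) * ?b ^ j + (cnt j a div ?b) * ?b ^ Suc j)"
      by (simp add: x_def sum.distrib)
    also have "\<dots> = (\<Sum>j<J. (cnt j a mod ?b + cnt j a div ?b * ?b) * ?b ^ j)"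
      by (simp only: power_Suc distrib_left distrib_right mult_ac)
    also have "\<dots> = (\<Sum>j<J. cnt j a * ?b ^ j)"
      by (simp only: mod_div_mult_eq)
    finally show ?thesis .
  qed
  have "(x + y) mod ?b ^ J = (\<Sum>p\<leftarrow>cs. (fst p mod ?b ^ J) * of_bool (snd p a)) mod ?b ^ J"
  proof -
    have "x + y = (\<Sum>j<J. \<Sum>p\<leftarrow>cs. (fst p div ?b ^ j mod ?b) * ?b ^ j * of_bool (snd p a))"
      unfolding xy cnt_def clm_def
      by (simp add: comp_def case_prod_unfold sum_list_const_mult[symmetric] mult_ac)
    also have "\<dots> = (\<Sum>p\<leftarrow>cs. (fst p mod ?b ^ J) * of_bool (snd p a))"
      unfolding sum_list_sum_swap by (simp add: sum_distrib_right[symmetric] digits_mod)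
    finally show ?thesis by simp
  qed
  also have "\<dots> = (\<Sum>p\<leftarrow>cs. fst p * of_bool (snd p a)) mod ?b ^ J"
    by (subst (1 2) sum_list_mod[symmetric]) (simp add: mod_simps)
  finally have "take_bit (B * J) (x + y) = take_bit (B * J) (\<Sum>(c, f)\<leftarrow>cs. c * of_bool (f a))"
    by (simp add: take_bit_eq_mod power_mult case_prod_unfold)
  then have "bit (\<Sum>(c, f)\<leftarrow>cs. c * of_bool (f a)) i = bit (x + y) i" if "i \<le> n" for i
    using J[OF that] by (metis bit_take_bit_iff)
  moreover have "bit x i = bit (cnt (i div B) a mod ?b) (i mod B)" if "i \<le> n" for i
    unfolding x_def by (rule digit_sum_bit) (use J[OF that] in auto)
  moreover have "bit y i = (B \<le> i \<and> bit (cnt (i div B - 1) a div ?b) (i mod B))" if "i \<le> n" for i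
  proof -
    have "bit y i = bit (q (i div B)) (i mod B)"
      unfolding y_def by (rule digit_sum_bit) (use qb J[OF that] in auto)
    then show ?thesis
      using B div_greater_zero_iff[of i B] by (cases "B \<le> i") (auto simp: q_def split: nat.splits)
  qed
  ultimately show ?thesis by (intro exI[of _ x] exI[of _ y]) (auto simp: not_less)
qed

lemma thr_implies_const: "(P \<Longrightarrow> thr D X s mj d f) \<Longrightarrow> thr D X s mj d (\<lambda>a. P \<longrightarrow> f a)"
  using thr_const[of D X s mj d True] by (cases P) auto

lemma thr_and_const: "(P \<Longrightarrow> thr D X s mj d f) \<Longrightarrow> thr D X s mj d (\<lambda>a. P \<and> f a)"
  using thr_const[of D X s mj d False] by (cases P) auto

text \<open>
  All sizes, among them the fan-in \<open>Z 40\<close>, are bounded by fixed powers \<open>Z k = z ^ k\<close>. A function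
  satisfies \<open>tl\<close> if it is a linear form in few formulas, and \<open>ti\<close> if its two's complement bits
  are given by formulas.
\<close>

locale tc =
  fixes D :: "'a set" and X :: "('a \<Rightarrow> bool) set" and z :: nat
  assumes z16: "16 \<le> z"
begin

definition Z :: "nat \<Rightarrow> nat" where "Z k = z ^ k"

abbreviation T :: "nat \<Rightarrow> ('a \<Rightarrow> bool) \<Rightarrow> bool" where
  "T \<equiv> thr D X (Z 40) True"

lemma Z_mono: "M \<le> Z i \<Longrightarrow> i \<le> j \<Longrightarrow> M \<le> Z j"
  unfolding Z_def using z16 by (meson le_trans one_le_numeral power_increasing)

lemma Z_mult: "M \<le> Z i \<Longrightarrow> N \<le> Z j \<Longrightarrow> M * N \<le> Z (i + j)"
  unfolding Z_def power_add by (rule mult_le_mono)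

lemma Z_add: "M \<le> Z i \<Longrightarrow> N \<le> Z j \<Longrightarrow> M + N \<le> Z (Suc (max i j))"
proof -
  assume "M \<le> Z i" "N \<le> Z j"
  then have "M \<le> Z (max i j)" "N \<le> Z (max i j)" by (auto intro: Z_mono)
  then have "M + N \<le> 2 * Z (max i j)" by simp
  also have "\<dots> \<le> z * Z (max i j)" using z16 by (intro mult_right_mono) auto
  finally show ?thesis by (simp add: Z_def)
qed

lemma Z_Suc: "M \<le> Z i \<Longrightarrow> Suc M \<le> Z (Suc i)"
  using Z_add[of M i 1 0] by (simp add: Z_def)

lemma Z_const: "c \<le> 16 \<Longrightarrow> c \<le> Z 1"
  unfolding Z_def using z16 by simp

lemma two_le_s: "2 \<le> Z 40"
  by (rule Z_mono[OF Z_const]) auto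

lemmas Zs = Z_mult Z_add Z_Suc Z_const

lemmas T_conj = thr_conj[OF _ _ two_le_s] and T_disj = thr_disj[OF _ _ two_le_s]
  and T_xor = thr_xor[OF _ _ two_le_s]

lemmas T_mono = thr_mono

text \<open>Each column has small weights, so \<open>thr_count\<close> reads off the digits of its
  sum; carry-lookahead then adds the two resulting numbers. The coefficients are constants of the
  formula and may be arbitrarily large.\<close>

lemma T_linear_nat:
  fixes cs :: "(nat \<times> ('a \<Rightarrow> bool)) list"
  assumes cs: "\<And>c f. (c, f) \<in> set cs \<Longrightarrow> T d f" and K: "length cs \<le> Z 9" and i: "i \<le> Z 9"
  shows "T (d + 16) (\<lambda>a. bit (\<Sum>(c, f)\<leftarrow>cs. c * of_bool (f a)) i)"
proof -
  define B where "B = Suc (floor_log (length cs))"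
  have B: "length cs < 2 ^ B" "0 < B"
    using floor_log_exp2_gt[of "length cs"] by (auto simp: B_def)
  have "2 ^ B \<le> 2 * length cs + 2"
    using floor_log_exp2_le[of "length cs"] by (cases "length cs = 0") (auto simp: B_def)
  also have "\<dots> \<le> Z (Suc (max (1 + 9) 1))"
    by (intro Zs K) auto
  finally have B11: "2 ^ B \<le> Z 11" by simp
  define clm where "clm = (\<lambda>j. map (\<lambda>(c, f). (c div (2 ^ B) ^ j mod 2 ^ B, f)) cs)"
  define cnt where "cnt = (\<lambda>j a. (\<Sum>(c, f)\<leftarrow>clm j. c * of_bool (f a)))"
  \<comment> \<open>The two summands are chosen for each argument \<open>a\<close>; only their bits
    up to \<open>i\<close> are prescribed.\<close>
  have "\<forall>a. \<exists>(x::nat) y. (\<forall>k. bit (\<Sum>(c, f)\<leftarrow>cs. c * of_bool (f a)) k = bit (x + y) k \<or> i < k) \<and>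
     (\<forall>k\<le>i. bit x k = bit (cnt (k div B) a mod 2 ^ B) (k mod B)) \<and>
     (\<forall>k\<le>i. bit y k = (B \<le> k \<and> bit (cnt (k div B - 1) a div 2 ^ B) (k mod B)))"
    unfolding cnt_def clm_def by (rule allI, rule iterated_sum_split[OF B])
  from choice[OF this] obtain x where "\<forall>a. \<exists>y::nat. (\<forall>k. bit (\<Sum>(c, f)\<leftarrow>cs. c * of_bool (f a)) k = bit (x a + y) k \<or> i < k) \<and>
     (\<forall>k\<le>i. bit (x a) k = bit (cnt (k div B) a mod 2 ^ B) (k mod B)) \<and>
     (\<forall>k\<le>i. bit y k = (B \<le> k \<and> bit (cnt (k div B - 1) a div 2 ^ B) (k mod B)))"
    by (elim exE)
  from choice[OF this] obtain y where "\<forall>a. (\<forall>k. bit (\<Sum>(c, f)\<leftarrow>cs. c * of_bool (f a)) k = bit (x a + y a :: nat) k \<or> i < k) \<and>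
     (\<forall>k\<le>i. bit (x a) k = bit (cnt (k div B) a mod 2 ^ B) (k mod B)) \<and>
     (\<forall>k\<le>i. bit (y a) k = (B \<le> k \<and> bit (cnt (k div B - 1) a div 2 ^ B) (k mod B)))"
    by (elim exE)
  then have xy:
    "\<And>a k. k \<le> i \<Longrightarrow> bit (\<Sum>(c, f)\<leftarrow>cs. c * of_bool (f a)) k = bit (x a + y a :: nat) k"
    "\<And>a k. k \<le> i \<Longrightarrow> bit (x a) k = bit (cnt (k div B) a mod 2 ^ B) (k mod B)"
    "\<And>a k. k \<le> i \<Longrightarrow> bit (y a) k = (B \<le> k \<and> bit (cnt (k div B - 1) a div 2 ^ B) (k mod B))"
    by (meson leD)+
  have count: "T (d + 5) (\<lambda>a. P (cnt j a))" for P j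
    unfolding cnt_def
  proof (rule thr_count[where W = "Z 20"])
    show "T d f" if "(c, f) \<in> set (clm j)" for c f
      using that cs by (auto simp: clm_def)
    have "sum_list (map fst (clm j)) \<le> length cs * 2 ^ B"
      unfolding clm_def
    proof (induction cs)
      case (Cons p cs)
      have "fst p div (2 ^ B) ^ j mod 2 ^ B \<le> (2::nat) ^ B" by (simp add: less_imp_le)
      from add_mono[OF this Cons] show ?case by (simp add: case_prod_unfold)
    qed simp
    also have "\<dots> \<le> Z (9 + 11)" by (intro Z_mult K B11)
    finally show "sum_list (map fst (clm j)) \<le> Z 20" by simp
    \<comment> \<open>Of the two uses of \<open>thr_count\<close> this one has the larger total
      weight; the fan-in \<open>Z 40\<close> accommodates it with room to spare.\<close>
    show "2 * Z 20 + 2 \<le> Z 40"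
      by (rule Z_mono[OF Z_add[OF Z_mult[OF Z_const order_refl] Z_const]]) auto
  qed
  have xb: "T (d + 5) (\<lambda>a. bit (x a) k)" if "k \<le> i" for k
    unfolding xy(2)[OF that] by (rule count)
  have yb: "T (d + 5) (\<lambda>a. bit (y a) k)" if "k \<le> i" for k
    unfolding xy(3)[OF that] by (intro thr_and_const count)
  have i40: "i \<le> Z 40" using i by (rule Z_mono) simp
  have "T (d + 16) (\<lambda>a. bit (x a + y a) i)"
    unfolding bit_add_nat
    by (rule T_mono) (rule T_xor thr_ex_less T_conj thr_all_less thr_implies_const T_disj xb yb i40 | simp)+
  then show ?thesis using xy(1) by simp
qed

text \<open>Bit \<open>i\<close> depends only on the sum modulo \<open>2 ^ Suc i\<close>, so integer
  coefficients may be replaced by their nonnegative remainders.\<close>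

lemma T_linear:
  fixes cs :: "(int \<times> ('a \<Rightarrow> bool)) list"
  assumes cs: "\<And>c f. (c, f) \<in> set cs \<Longrightarrow> T d f" and K: "length cs \<le> Z 9" and i: "i \<le> Z 9"
  shows "T (d + 16) (\<lambda>a. bit (\<Sum>(c, f)\<leftarrow>cs. c * of_bool (f a)) i)"
proof -
  let ?m = "2 ^ Suc i :: int"
  have "T (d + 16) (\<lambda>a. bit (\<Sum>(c, f)\<leftarrow>map (\<lambda>(c, f). (nat (c mod ?m), f)) cs. c * of_bool (f a)) i)"
    by (rule T_linear_nat) (use assms in auto)
  moreover have "bit (\<Sum>(c, f)\<leftarrow>map (\<lambda>(c, f). (nat (c mod ?m), f)) cs. c * of_bool (f a)) i =
      bit (\<Sum>(c, f)\<leftarrow>cs. c * of_bool (f a)) i" for a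
  proof -
    have "int (\<Sum>(c, f)\<leftarrow>map (\<lambda>(c, f). (nat (c mod ?m), f)) cs. c * of_bool (f a)) =
        (\<Sum>(c, f)\<leftarrow>cs. (c mod ?m) * of_bool (f a))"
      by (induction cs) auto
    moreover have "(\<Sum>(c, f)\<leftarrow>cs. (c mod ?m) * of_bool (f a)) mod ?m = (\<Sum>(c, f)\<leftarrow>cs. c * of_bool (f a)) mod ?m"
      by (subst (1 2) sum_list_mod[symmetric]) (simp add: mod_simps case_prod_unfold)
    ultimately have "take_bit (Suc i) (int (\<Sum>(c, f)\<leftarrow>map (\<lambda>(c, f). (nat (c mod ?m), f)) cs. c * of_bool (f a))) =
        take_bit (Suc i) (\<Sum>(c, f)\<leftarrow>cs. c * of_bool (f a))"
      unfolding take_bit_eq_mod by (simp only:)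
    from arg_cong[OF this, of "\<lambda>x. bit x i"] show ?thesis
      by (simp only: bit_take_bit_iff bit_of_nat_iff_bit lessI simp_thms)
  qed
  ultimately show ?thesis by simp
qed

section \<open>Linear forms and two's complement integers\<close>

definition tl :: "nat \<Rightarrow> nat \<Rightarrow> ('a \<Rightarrow> int) \<Rightarrow> bool" where
  "tl d K F \<longleftrightarrow> (\<exists>cs. length cs \<le> K \<and> (\<forall>(c, f)\<in>set cs. T d f) \<and>
     (\<forall>a\<in>D. F a = (\<Sum>(c, f)\<leftarrow>cs. c * of_bool (f a))))"

definition ti :: "nat \<Rightarrow> nat \<Rightarrow> ('a \<Rightarrow> int) \<Rightarrow> bool" where
  "ti d w F \<longleftrightarrow> (\<forall>a\<in>D. \<bar>F a\<bar> < 2 ^ w) \<and> (\<forall>i. T d (\<lambda>a. bit (F a) i))"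

lemma tl_mono: "tl d K F \<Longrightarrow> d \<le> d' \<Longrightarrow> K \<le> K' \<Longrightarrow> tl d' K' F"
  unfolding tl_def by (elim exE, rule exI) (auto intro: T_mono order_trans)

lemma tl_cong: "tl d K F \<Longrightarrow> (\<And>a. a \<in> D \<Longrightarrow> F a = G a) \<Longrightarrow> tl d K G"
  unfolding tl_def by fastforce

lemma tl_zero: "tl d 0 (\<lambda>_. 0)"
  unfolding tl_def by auto

lemma tl_const: "tl d 1 (\<lambda>_. c)"
  unfolding tl_def by (intro exI[of _ "[(c, \<lambda>_. True)]"]) (auto intro: thr_const)

lemma tl_of_bool: "T d f \<Longrightarrow> tl d 1 (\<lambda>a. of_bool (f a))"
  unfolding tl_def by (intro exI[of _ "[(1, f)]"]) auto

lemma tl_add: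
  assumes "tl d K F" "tl d' L G"
  shows "tl (max d d') (K + L) (\<lambda>a. F a + G a)"
proof -
  from assms obtain cs cs' where "length cs \<le> K" "\<forall>(c, f)\<in>set cs. T d f" "length cs' \<le> L" "\<forall>(c, f)\<in>set cs'. T d' f"
    "\<And>a. a \<in> D \<Longrightarrow> F a = (\<Sum>(c, f)\<leftarrow>cs. c * of_bool (f a))" "\<And>a. a \<in> D \<Longrightarrow> G a = (\<Sum>(c, f)\<leftarrow>cs'. c * of_bool (f a))"
    unfolding tl_def by auto
  then show ?thesis unfolding tl_def
    by (intro exI[of _ "cs @ cs'"]) (fastforce intro: T_mono)
qed

lemma tl_scale:
  assumes "tl d K F"
  shows "tl d K (\<lambda>a. k * F a)"
proof -
  from assms obtain cs where cs: "length cs \<le> K" "\<forall>(c, f)\<in>set cs. T d f"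
    "\<And>a. a \<in> D \<Longrightarrow> F a = (\<Sum>(c, f)\<leftarrow>cs. c * of_bool (f a))"
    unfolding tl_def by auto
  have "k * (\<Sum>(c, f)\<leftarrow>cs. c * of_bool (f a)) = (\<Sum>(c, f)\<leftarrow>map (\<lambda>(c, f). (k * c, f)) cs. c * of_bool (f a))" for a
    by (induction cs) (auto simp: algebra_simps)
  with cs show ?thesis unfolding tl_def
    by (intro exI[of _ "map (\<lambda>(c, f). (k * c, f)) cs"]) auto
qed

lemma tl_uminus: "tl d K F \<Longrightarrow> tl d K (\<lambda>a. - F a)"
  using tl_scale[of d K F "-1"] by simp

lemma tl_diff: "tl d K F \<Longrightarrow> tl d' L G \<Longrightarrow> tl (max d d') (K + L) (\<lambda>a. F a - G a)"
  using tl_add[OF _ tl_uminus] by fastforce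

lemma tl_sum:
  assumes "\<And>k. k < N \<Longrightarrow> tl d K (F k)"
  shows "tl d (N * K) (\<lambda>a. \<Sum>k<N. F k a)"
  using assms
proof (induction N)
  case (Suc N)
  then have "tl (max d d) (N * K + K) (\<lambda>a. (\<Sum>k<N. F k a) + F N a)"
    by (intro tl_add) auto
  then show ?case by (simp add: add.commute)
qed (simp add: tl_zero)

lemma sum_list_product:
  "(\<Sum>x\<leftarrow>xs. g x) * (\<Sum>y\<leftarrow>ys. h y) = (\<Sum>(x, y)\<leftarrow>List.product xs ys. g x * (h y :: int))"
proof (induction xs)
  case (Cons x xs)
  have "(\<Sum>(x, y)\<leftarrow>map (Pair x) ys. g x * h y) = g x * (\<Sum>y\<leftarrow>ys. h y)"
    by (simp add: comp_def sum_list_const_mult)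
  with Cons show ?case by (simp add: algebra_simps)
qed simp

text \<open>A product of Boolean values is a conjunction, so a product of linear forms is again a
  linear form, indexed by pairs of terms.\<close>

lemma tl_mult:
  assumes "tl d K F" "tl d' L G"
  shows "tl (Suc (max d d')) (K * L) (\<lambda>a. F a * G a)"
proof -
  from assms obtain cs cs' where cs: "length cs \<le> K" "\<forall>(c, f)\<in>set cs. T d f" "length cs' \<le> L" "\<forall>(c, f)\<in>set cs'. T d' f"
    "\<And>a. a \<in> D \<Longrightarrow> F a = (\<Sum>(c, f)\<leftarrow>cs. c * of_bool (f a))" "\<And>a. a \<in> D \<Longrightarrow> G a = (\<Sum>(c, f)\<leftarrow>cs'. c * of_bool (f a))"
    unfolding tl_def by auto
  let ?cs = "map (\<lambda>((c, f), (c', f')). (c * c', \<lambda>a. f a \<and> f' a)) (List.product cs cs')"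
  have "F a * G a = (\<Sum>(c, f)\<leftarrow>?cs. c * of_bool (f a))" if "a \<in> D" for a
    unfolding cs(5,6)[OF that] sum_list_product
    by (auto simp: comp_def case_prod_unfold mult_ac of_bool_conj intro!: arg_cong[of _ _ sum_list])
  moreover have "length ?cs \<le> K * L" using cs(1,3) by (auto intro: mult_le_mono)
  moreover have "\<forall>(c, f)\<in>set ?cs. T (Suc (max d d')) f" using cs(2,4) by (auto intro!: T_conj)
  ultimately show ?thesis unfolding tl_def by blast
qed

lemma div_eq_minus_one: "- b \<le> x \<Longrightarrow> x < 0 \<Longrightarrow> x div b = - 1" for x b :: int
proof -
  assume "- b \<le> x" "x < 0"
  then have "(x + b) div b = 0" and "b \<noteq> 0" by (auto intro: div_pos_pos_trivial)
  then show ?thesis using div_add_self2[of b x] by simp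
qed

lemma bit_eq_sign:
  assumes "\<bar>x\<bar> < (2::int) ^ w" "w \<le> i"
  shows "bit x i \<longleftrightarrow> x < 0"
proof -
  have "(2::int) ^ w \<le> 2 ^ i" using assms(2) by (rule power_increasing) simp
  with assms(1) have "\<bar>x\<bar> < 2 ^ i" by (rule order.strict_trans2)
  then have "x div 2 ^ i = (if x < 0 then - 1 else 0)"
    using div_eq_minus_one[of "2 ^ i" x] div_pos_pos_trivial[of x "2 ^ i"] by (cases "x < 0") auto
  then show ?thesis by (simp add: bit_iff_odd)
qed

lemma int_bits:
  assumes "\<bar>x\<bar> < (2::int) ^ w"
  shows "x = (\<Sum>i<w. 2 ^ i * of_bool (bit x i)) + - (2 ^ w) * of_bool (bit x w)"
proof -
  have "(\<Sum>i<w. 2 ^ i * of_bool (bit x i)) = take_bit w x"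
    by (induction w) (simp_all add: take_bit_Suc_from_most)
  moreover have "x div 2 ^ w = - of_bool (bit x w)"
    using assms bit_eq_sign[OF assms, of w] by (auto simp: div_eq_minus_one)
  ultimately show ?thesis
    using mult_div_mod_eq[of "2 ^ w" x] by (simp add: take_bit_eq_mod)
qed

lemma ti_tl:
  assumes "ti d w F"
  shows "tl d (Suc w) F"
proof -
  have "tl (max d d) (w * 1 + 1) (\<lambda>a. (\<Sum>i<w. 2 ^ i * of_bool (bit (F a) i)) + - (2 ^ w) * of_bool (bit (F a) w))"
    using assms by (intro tl_add tl_sum tl_scale tl_of_bool) (auto simp: ti_def)
  then have "tl d (Suc w) (\<lambda>a. (\<Sum>i<w. 2 ^ i * of_bool (bit (F a) i)) + - (2 ^ w) * of_bool (bit (F a) w))"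
    by simp
  then show ?thesis
    by (rule tl_cong) (use assms int_bits[of _ w] in \<open>simp add: ti_def\<close>)
qed

lemma ti_mono: "ti d w F \<Longrightarrow> d \<le> d' \<Longrightarrow> w \<le> w' \<Longrightarrow> ti d' w' F"
  unfolding ti_def by (auto intro: T_mono order.strict_trans2 power_increasing)

lemma T_tl_bit: "tl d K F \<Longrightarrow> K \<le> Z 9 \<Longrightarrow> i \<le> Z 9 \<Longrightarrow> T (d + 16) (\<lambda>a. bit (F a) i)"
proof -
  assume "tl d K F" and K: "K \<le> Z 9" and i: "i \<le> Z 9"
  then obtain cs where cs: "length cs \<le> K" "\<forall>(c, f)\<in>set cs. T d f"
    "\<And>a. a \<in> D \<Longrightarrow> F a = (\<Sum>(c, f)\<leftarrow>cs. c * of_bool (f a))"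
    unfolding tl_def by auto
  with K have "T (d + 16) (\<lambda>a. bit (\<Sum>(c, f)\<leftarrow>cs. c * of_bool (f a)) i)"
    using i by (intro T_linear) auto
  then show ?thesis using cs(3) by (auto intro: thr_cong)
qed

text \<open>All bits from position \<open>w\<close> on equal the sign. Hence \<open>ti\<close>
  speaks of infinitely many bits, but only those up to \<open>w\<close> have to be computed.\<close>

lemma tl_ti:
  assumes "tl d K F" "K \<le> Z 9" "\<And>a. a \<in> D \<Longrightarrow> \<bar>F a\<bar> < 2 ^ w" "w \<le> Z 9"
  shows "ti (d + 16) w F"
proof -
  have "T (d + 16) (\<lambda>a. bit (F a) i)" for i
  proof (cases "i \<le> w")
    case True
    then show ?thesis using assms by (intro T_tl_bit[OF assms(1,2)]) auto
  next
    case False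
    have "T (d + 16) (\<lambda>a. bit (F a) w)" using assms by (intro T_tl_bit[OF assms(1,2)]) auto
    then show ?thesis
      using False assms(3) bit_eq_sign[of _ w i] bit_eq_sign[of _ w w] by (auto elim!: thr_cong)
  qed
  then show ?thesis using assms(3) by (auto simp: ti_def)
qed

lemma T_neg:
  assumes "ti d w F"
  shows "T d (\<lambda>a. F a < 0)"
proof -
  have "T d (\<lambda>a. bit (F a) w)" using assms by (simp add: ti_def)
  then show ?thesis by (rule thr_cong) (use assms bit_eq_sign[of _ w w] in \<open>auto simp: ti_def\<close>)
qed

lemma ti_const: "\<bar>c\<bar> < 2 ^ w \<Longrightarrow> ti d w (\<lambda>_. c)"
  unfolding ti_def by (auto intro: thr_const)

lemma abs_less_pow_add:
  assumes "\<bar>x\<bar> < (2::int) ^ v" "\<bar>y\<bar> < 2 ^ w"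
  shows "\<bar>x + y\<bar> < 2 ^ Suc (max v w)"
proof -
  have "(2::int) ^ v \<le> 2 ^ max v w" "(2::int) ^ w \<le> 2 ^ max v w" by (simp_all add: power_increasing)
  with assms show ?thesis unfolding power_Suc by linarith
qed

lemma ti_add:
  assumes "ti d v F" "ti d' w G" "v \<le> Z 7" "w \<le> Z 7"
  shows "ti (max d d' + 16) (Suc (max v w)) (\<lambda>a. F a + G a)"
proof (rule tl_ti[OF tl_add[OF ti_tl[OF assms(1)] ti_tl[OF assms(2)]]])
  have "Suc v + Suc w \<le> Z (Suc (max (Suc 7) (Suc 7)))" by (intro Zs assms)
  then show "Suc v + Suc w \<le> Z 9" by simp
  have "Suc (max v w) \<le> Z (Suc 7)" using assms by (intro Zs) auto
  then show "Suc (max v w) \<le> Z 9" by (rule Z_mono) simp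
qed (use assms in \<open>auto simp: ti_def abs_less_pow_add simp del: power_Suc\<close>)

lemma ti_uminus:
  assumes "ti d v F" "v \<le> Z 8"
  shows "ti (d + 16) v (\<lambda>a. - F a)"
  by (rule tl_ti[OF tl_uminus[OF ti_tl[OF assms(1)]]])
    (use assms in \<open>auto simp: ti_def intro: Z_mono dest: Z_Suc\<close>)

lemma ti_diff:
  assumes "ti d v F" "ti d' w G" "v \<le> Z 7" "w \<le> Z 7"
  shows "ti (max d d' + 16) (Suc (max v w)) (\<lambda>a. F a - G a)"
proof (rule tl_ti[OF tl_diff[OF ti_tl[OF assms(1)] ti_tl[OF assms(2)]]])
  have "Suc v + Suc w \<le> Z (Suc (max (Suc 7) (Suc 7)))" by (intro Zs assms)
  then show "Suc v + Suc w \<le> Z 9" by simp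
  have "Suc (max v w) \<le> Z (Suc 7)" using assms by (intro Zs) auto
  then show "Suc (max v w) \<le> Z 9" by (rule Z_mono) simp
  show "\<bar>F a - G a\<bar> < 2 ^ Suc (max v w)" if "a \<in> D" for a
    using assms that abs_less_pow_add[of "F a" v "- G a" w] by (auto simp: ti_def)
qed

lemma ti_mult:
  assumes "ti d v F" "ti d' w G" "v \<le> Z 3" "w \<le> Z 3"
  shows "ti (max d d' + 17) (v + w) (\<lambda>a. F a * G a)"
proof -
  have "ti (Suc (max d d') + 16) (v + w) (\<lambda>a. F a * G a)"
  proof (rule tl_ti[OF tl_mult[OF ti_tl[OF assms(1)] ti_tl[OF assms(2)]]])
    have "Suc v * Suc w \<le> Z (Suc 3 + Suc 3)" by (intro Zs assms)
    then show "Suc v * Suc w \<le> Z 9" by (rule Z_mono) simp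
    have "v + w \<le> Z (Suc (max 3 3))" using assms by (intro Zs) auto
    then show "v + w \<le> Z 9" by (rule Z_mono) simp
    show "\<bar>F a * G a\<bar> < 2 ^ (v + w)" if "a \<in> D" for a
      using assms that unfolding abs_mult power_add by (intro mult_strict_mono) (auto simp: ti_def)
  qed
  then show ?thesis by (simp add: eval_nat_numeral)
qed

lemma T_less:
  assumes "ti d v F" "ti d' w G" "v \<le> Z 7" "w \<le> Z 7"
  shows "T (max d d' + 16) (\<lambda>a. F a < G a)"
  using T_neg[OF ti_diff[OF assms]] by simp

lemma T_le:
  assumes "ti d v F" "ti d' w G" "v \<le> Z 7" "w \<le> Z 7"
  shows "T (max d d' + 17) (\<lambda>a. F a \<le> G a)"
  using thr_Not[OF T_less[OF assms(2,1,4,3)]] by (simp add: not_less max.commute eval_nat_numeral)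

lemma T_eq:
  assumes "ti d v F" "ti d' w G" "v \<le> Z 7" "w \<le> Z 7"
  shows "T (max d d' + 18) (\<lambda>a. F a = G a)"
  using T_conj[OF T_le[OF assms] T_le[OF assms(2,1,4,3)]] by (simp add: max.commute eq_iff eval_nat_numeral)

lemma T_if:
  assumes "T d c" "T d' f" "T d'' g"
  shows "T (max d (max d' d'') + 3) (\<lambda>a. if c a then f a else g a)"
proof -
  have "T (max d (max d' d'') + 3) (\<lambda>a. (c a \<and> f a) \<or> (\<not> c a \<and> g a))"
    by (rule T_mono[OF T_disj[OF T_conj[OF assms(1,2)] T_conj[OF thr_Not[OF assms(1)] assms(3)]]]) (simp add: max_def)
  then show ?thesis by (rule thr_cong) auto
qed

lemma ti_if:
  assumes "T d c" "ti d' v F" "ti d'' w G"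
  shows "ti (max d (max d' d'') + 3) (max v w) (\<lambda>a. if c a then F a else G a)"
proof -
  have m: "ti d' (max v w) F" "ti d'' (max v w) G" using assms by (auto intro: ti_mono)
  have "T (max d (max d' d'') + 3) (\<lambda>a. if c a then bit (F a) i else bit (G a) i)" for i
    using m assms(1) by (intro T_if) (auto simp: ti_def)
  then have "T (max d (max d' d'') + 3) (\<lambda>a. bit (if c a then F a else G a) i)" for i
    by (simp add: if_distrib[of "\<lambda>x. bit x i"])
  then show ?thesis using m unfolding ti_def by auto
qed

lemma ti_abs:
  assumes "ti d v F" "v \<le> Z 8"
  shows "ti (d + 19) v (\<lambda>a. \<bar>F a\<bar>)"
  using ti_if[OF T_neg[OF assms(1)] ti_uminus[OF assms] assms(1)]
  by (simp add: abs_if add.commute)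

lemma ti_of_bool: "T d f \<Longrightarrow> ti (d + 16) 1 (\<lambda>a. of_bool (f a))"
  by (rule tl_ti[OF tl_of_bool]) (auto intro: Z_mono[OF Z_const])

end

section \<open>Rounding\<close>

lemma fp_round_eqI:
  assumes "a \<in> fp_set p" "fst a = 0 \<longrightarrow> snd a = 0"
    "\<And>b. b \<in> fp_set p \<Longrightarrow> \<bar>fp_val a - x\<bar> \<le> \<bar>fp_val b - x\<bar>"
    "\<And>b. b \<in> fp_set p \<Longrightarrow> \<bar>fp_val a - x\<bar> = \<bar>fp_val b - x\<bar> \<Longrightarrow>
       (even (fst b) \<longrightarrow> even (fst a)) \<and> (even (fst b) = even (fst a) \<longrightarrow> \<bar>fp_val a\<bar> \<le> \<bar>fp_val b\<bar>)"
  shows "fp_round p x = a"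
  unfolding fp_round_def
proof (rule the1_equality[OF fp_round_unique])
  have "a \<in> fp_nearest p x" using assms by (auto simp: fp_nearest_def)
  moreover have "\<bar>fp_val a - x\<bar> = \<bar>fp_val b - x\<bar>" "b \<in> fp_set p" if "b \<in> fp_nearest p x" for b
  proof -
    show b: "b \<in> fp_set p" using that by (simp add: fp_nearest_def)
    have "\<bar>fp_val b - x\<bar> \<le> \<bar>fp_val a - x\<bar>" using that assms(1) unfolding fp_nearest_def by blast
    with assms(3)[OF b] show "\<bar>fp_val a - x\<bar> = \<bar>fp_val b - x\<bar>" by (rule order_antisym)
  qed
  ultimately show "a \<in> fp_nearest p x \<and> (fst a = 0 \<longrightarrow> snd a = 0) \<and>
        (\<forall>b\<in>fp_nearest p x.
           (even (fst b) \<longrightarrow> even (fst a)) \<and>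
           (even (fst b) = even (fst a) \<longrightarrow> \<bar>fp_val a\<bar> \<le> \<bar>fp_val b\<bar>))"
    using assms(2,4) by blast
qed

lemma fp_round_props:
  "fp_round p x \<in> fp_nearest p x \<and> (fst (fp_round p x) = 0 \<longrightarrow> snd (fp_round p x) = 0) \<and>
    (\<forall>b\<in>fp_nearest p x. (even (fst b) \<longrightarrow> even (fst (fp_round p x))) \<and>
       (even (fst b) = even (fst (fp_round p x)) \<longrightarrow> \<bar>fp_val (fp_round p x)\<bar> \<le> \<bar>fp_val b\<bar>))"
  unfolding fp_round_def by (rule theI'[OF fp_round_unique])

lemma fp_round_in: "fp_round p x \<in> fp_set p"
  using fp_round_props[of p x] by (auto simp: fp_nearest_def)

definition fp_uminus :: "fp \<Rightarrow> fp" where "fp_uminus a = (- fst a, snd a)"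

lemma fp_uminus_simps [simp]:
  "fst (fp_uminus a) = - fst a" "snd (fp_uminus a) = snd a" "fp_val (fp_uminus a) = - fp_val a"
  "fp_uminus (fp_uminus a) = a"
  by (simp_all add: fp_uminus_def fp_val_def)

lemma fp_uminus_in [simp]: "fp_uminus a \<in> fp_set p \<longleftrightarrow> a \<in> fp_set p"
  by (cases a) (auto simp: fp_uminus_def fp_set_def)

text \<open>Distance, parity and magnitude are all symmetric in the sign; therefore later only
  magnitudes are rounded.\<close>

lemma fp_round_uminus: "fp_round p (- x) = fp_uminus (fp_round p x)"
proof (rule fp_round_eqI)
  let ?a = "fp_round p x"
  note P = fp_round_props[of p x]
  have in_near: "?a \<in> fp_set p" "\<And>b. b \<in> fp_set p \<Longrightarrow> \<bar>fp_val ?a - x\<bar> \<le> \<bar>fp_val b - x\<bar>"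
    using P by (auto simp: fp_nearest_def)
  then show "fp_uminus ?a \<in> fp_set p" by simp
  show "fst (fp_uminus ?a) = 0 \<longrightarrow> snd (fp_uminus ?a) = 0" using P by simp
  have eq: "\<bar>fp_val b - - x\<bar> = \<bar>fp_val (fp_uminus b) - x\<bar>" for b by simp
  show "\<bar>fp_val (fp_uminus ?a) - - x\<bar> \<le> \<bar>fp_val b - - x\<bar>" if "b \<in> fp_set p" for b
    unfolding eq using in_near(2)[of "fp_uminus b"] that by simp
  fix b assume b: "b \<in> fp_set p" "\<bar>fp_val (fp_uminus ?a) - - x\<bar> = \<bar>fp_val b - - x\<bar>"
  then have "\<bar>fp_val ?a - x\<bar> = \<bar>fp_val (fp_uminus b) - x\<bar>" unfolding eq by simp
  with in_near(2) have "fp_uminus b \<in> fp_nearest p x" using b(1) unfolding fp_nearest_def by simp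
  with P have "(even (fst (fp_uminus b)) \<longrightarrow> even (fst ?a)) \<and>
       (even (fst (fp_uminus b)) = even (fst ?a) \<longrightarrow> \<bar>fp_val ?a\<bar> \<le> \<bar>fp_val (fp_uminus b)\<bar>)" by blast
  then show "(even (fst b) \<longrightarrow> even (fst (fp_uminus ?a))) \<and>
       (even (fst b) = even (fst (fp_uminus ?a)) \<longrightarrow> \<bar>fp_val (fp_uminus ?a)\<bar> \<le> \<bar>fp_val b\<bar>)" by simp
qed

lemma fp_round_zero: "fp_round p 0 = (0, 0)"
proof (rule fp_round_eqI)
  show "(0, 0) \<in> fp_set p" by (rule fp_zero_in)
qed (auto simp: fp_val_def)

text \<open>Zero has many representations, but all with significand 0; so the parity used in ties is
  a function of the value.\<close>

lemma fp_eq_parity: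
  assumes "a \<in> fp_set p" "b \<in> fp_set p" "fp_val a = fp_val b"
  shows "fst a = fst b"
proof (cases "fp_val a = 0")
  case True
  then have "fp_val b = 0" using assms(3) by simp
  with True show ?thesis by (simp add: fp_val_def)
qed (use fp_val_inj[OF assms] in simp)

text \<open>Only the two neighbours of a nonnegative \<open>x\<close> compete. A tie goes to the
  even significand, and between equal parities to the smaller magnitude, that is to
  \<open>lo\<close>.\<close>

locale adjacent =
  fixes p :: nat and lo hi :: fp and x :: real
  assumes lo: "lo \<in> fp_set p" and hi: "hi \<in> fp_set p"
    and gap: "\<And>c. c \<in> fp_set p \<Longrightarrow> fp_val c \<le> fp_val lo \<or> fp_val hi \<le> fp_val c"
    and x: "fp_val lo \<le> x" "x \<le> fp_val hi" "0 \<le> fp_val lo" "fp_val lo < fp_val hi"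
begin

lemma round_lo:
  assumes "fst lo = 0 \<longrightarrow> snd lo = 0"
    and c: "2 * x < fp_val lo + fp_val hi \<or> (2 * x = fp_val lo + fp_val hi \<and> (even (fst hi) \<longrightarrow> even (fst lo)))"
  shows "fp_round p x = lo"
proof (rule fp_round_eqI[OF lo assms(1)])
  fix b assume b: "b \<in> fp_set p"
  show "\<bar>fp_val lo - x\<bar> \<le> \<bar>fp_val b - x\<bar>" using gap[OF b] x c by linarith
  assume eq: "\<bar>fp_val lo - x\<bar> = \<bar>fp_val b - x\<bar>"
  with gap[OF b] x c have "fp_val b = fp_val lo \<or>
      (fp_val b = fp_val hi \<and> (even (fst hi) \<longrightarrow> even (fst lo)))" by linarith
  then show "(even (fst b) \<longrightarrow> even (fst lo)) \<and> (even (fst b) = even (fst lo) \<longrightarrow> \<bar>fp_val lo\<bar> \<le> \<bar>fp_val b\<bar>)"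
    using fp_eq_parity[OF b lo] fp_eq_parity[OF b hi] x by auto
qed

lemma round_hi:
  assumes "fp_val lo + fp_val hi < 2 * x \<or> (2 * x = fp_val lo + fp_val hi \<and> even (fst hi) \<and> odd (fst lo))"
  shows "fp_round p x = hi"
proof (rule fp_round_eqI[OF hi])
  have "fp_val hi \<noteq> 0" using x by simp
  then show "fst hi = 0 \<longrightarrow> snd hi = 0" by (auto simp: fp_val_def)
  fix b assume b: "b \<in> fp_set p"
  show "\<bar>fp_val hi - x\<bar> \<le> \<bar>fp_val b - x\<bar>" using gap[OF b] x assms by linarith
  assume eq: "\<bar>fp_val hi - x\<bar> = \<bar>fp_val b - x\<bar>"
  with gap[OF b] x assms have "fp_val b = fp_val hi \<or>
      (fp_val b = fp_val lo \<and> even (fst hi) \<and> odd (fst lo))" by linarith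
  then show "(even (fst b) \<longrightarrow> even (fst hi)) \<and> (even (fst b) = even (fst hi) \<longrightarrow> \<bar>fp_val hi\<bar> \<le> \<bar>fp_val b\<bar>)"
    using fp_eq_parity[OF b lo] fp_eq_parity[OF b hi] x by auto
qed

end

lemma fp_pos_bounds:
  assumes "(m, e) \<in> fp_set p" "0 < m"
  shows "2 ^ (p - 1) * 2 powi e \<le> fp_val (m, e)" "fp_val (m, e) < 2 ^ p * 2 powi e"
proof -
  have "2 ^ (p - 1) \<le> m" "m < 2 ^ p" using fp_set_bounds(1)[OF assms] by auto
  then have "2 ^ (p - 1) \<le> real_of_int m" "real_of_int m < 2 ^ p"
    by (metis of_int_le_iff of_int_numeral of_int_power, metis of_int_less_iff of_int_numeral of_int_power)
  then show "2 ^ (p - 1) * 2 powi e \<le> fp_val (m, e)" "fp_val (m, e) < 2 ^ p * 2 powi e"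
    by (auto simp: fp_val_def)
qed

text \<open>Positive numbers with exponent at least \<open>e\<close> are integer multiples of
  \<open>2 powi e\<close>. Those with a smaller exponent lie below
  \<open>2 ^ (p - 1) * 2 powi e\<close>, hence below \<open>m * 2 powi e\<close>.\<close>

lemma fp_gap:
  assumes p: "1 \<le> p" and m: "2 ^ (p - 1) \<le> m" and c: "c \<in> fp_set p"
  shows "fp_val c \<le> real_of_int m * 2 powi e \<or> real_of_int (m + 1) * 2 powi e \<le> fp_val c"
proof -
  obtain m' e' where ce: "c = (m', e')" by (cases c)
  have "(0::int) < 2 ^ (p - 1)" by simp
  with m have m0: "0 < m" by linarith
  show ?thesis
  proof (cases "0 < m'")
    case False
    then have "fp_val c \<le> 0" by (simp add: ce fp_val_def mult_nonpos_nonneg)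
    also have "0 \<le> real_of_int m * 2 powi e" using m0 by simp
    finally show ?thesis by simp
  next
    case True
    show ?thesis
    proof (cases "e \<le> e'")
      case True
      define k where "k = m' * 2 ^ nat (e' - e)"
      have "2 powi e' = 2 ^ nat (e' - e) * (2::real) powi e"
        using True by (simp add: power_int_def[of 2 "e' - e", symmetric] power_int_add[symmetric] flip: power_int_of_nat)
      then have "fp_val c = real_of_int k * 2 powi e" by (simp add: ce fp_val_def k_def)
      moreover have "k \<le> m \<or> m + 1 \<le> k" by linarith
      then have "real_of_int k \<le> real_of_int m \<or> real_of_int (m + 1) \<le> real_of_int k" by linarith
      ultimately show ?thesis by (auto simp: mult_right_mono)
    next
      case False
      have "fp_val c < 2 ^ p * 2 powi e'" using fp_pos_bounds(2) c True by (simp add: ce)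
      also have "\<dots> = 2 ^ (p - 1) * (2::real) powi (e' + 1)" using p by (cases p) (simp_all add: power_int_add)
      also have "\<dots> \<le> 2 ^ (p - 1) * 2 powi e" using False by (intro mult_left_mono power_int_increasing) auto
      also have "\<dots> \<le> real_of_int m * 2 powi e"
        using m by (intro mult_right_mono) (metis of_int_le_iff of_int_numeral of_int_power, simp)
      finally show ?thesis by simp
    qed
  qed
qed

text \<open>There are no subnormal numbers: the gap above zero is \<open>2 ^ (p - 1)\<close> times
  as wide as the one that follows it, so underflow needs cases of its own.\<close>

lemma fp_min_gap:
  assumes c: "c \<in> fp_set p"
  shows "fp_val c \<le> 0 \<or> 2 ^ (p - 1) * 2 powi (- (2 ^ p)) \<le> fp_val c"
proof (cases "0 < fst c")
  case True
  obtain m e where ce: "c = (m, e)" by (cases c)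
  have "2 ^ (p - 1) * (2::real) powi (- (2 ^ p)) \<le> 2 ^ (p - 1) * 2 powi e"
    using c ce by (intro mult_left_mono power_int_increasing) (auto simp: fp_set_def)
  also have "\<dots> \<le> fp_val c" using fp_pos_bounds(1) c True ce by simp
  finally show ?thesis by simp
qed (simp add: fp_val_def mult_nonpos_nonneg)

lemma fp_max:
  assumes p: "1 \<le> p" and c: "c \<in> fp_set p"
  shows "fp_val c \<le> real_of_int (2 ^ p - 1) * 2 powi (2 ^ p - 1)"
proof (cases "0 < fst c")
  case True
  obtain m e where ce: "c = (m, e)" by (cases c)
  have "e \<le> 2 ^ p - 1" using c ce by (auto simp: fp_set_def)
  moreover have "m \<le> 2 ^ p - 1" using fp_set_bounds(1)[of m e p] c ce True by simp
  then have "real_of_int m \<le> real_of_int (2 ^ p - 1)" by (rule iffD2[OF of_int_le_iff])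
  ultimately show ?thesis unfolding ce fp_val_def fst_conv snd_conv
    using True ce by (intro mult_mono power_int_increasing) auto
next
  case False
  then have "fp_val c \<le> 0" by (simp add: fp_val_def mult_nonpos_nonneg)
  also have "0 \<le> real_of_int (2 ^ p - 1) * 2 powi (2 ^ p - 1)" by (intro mult_nonneg_nonneg) auto
  finally show ?thesis .
qed

lemma fp_max_in: "1 \<le> p \<Longrightarrow> (2 ^ p - 1, 2 ^ p - 1) \<in> fp_set p"
  by (cases p) (auto simp: fp_set_def)

lemma fp_round_saturate:
  assumes p: "1 \<le> p" and x: "real_of_int (2 ^ p - 1) * 2 powi (2 ^ p - 1) \<le> x"
  shows "fp_round p x = (2 ^ p - 1, 2 ^ p - 1)"
proof (rule fp_round_eqI[OF fp_max_in[OF p]])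
  let ?a = "(2 ^ p - 1, 2 ^ p - 1) :: fp"
  have v: "fp_val ?a = real_of_int (2 ^ p - 1) * 2 powi (2 ^ p - 1)" by (simp add: fp_val_def)
  have "(2::int) ^ 1 \<le> 2 ^ p" using p by (intro power_increasing) auto
  then show "fst ?a = 0 \<longrightarrow> snd ?a = 0" by simp
  fix b assume b: "b \<in> fp_set p"
  show "\<bar>fp_val ?a - x\<bar> \<le> \<bar>fp_val b - x\<bar>" using fp_max[OF p b] x v by linarith
  assume "\<bar>fp_val ?a - x\<bar> = \<bar>fp_val b - x\<bar>"
  then have "fp_val b = fp_val ?a" using fp_max[OF p b] x v by linarith
  then show "(even (fst b) \<longrightarrow> even (fst ?a)) \<and> (even (fst b) = even (fst ?a) \<longrightarrow> \<bar>fp_val ?a\<bar> \<le> \<bar>fp_val b\<bar>)"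
    using fp_eq_parity[OF b fp_max_in[OF p]] by simp
qed

text \<open>
  The rounding of a number in \<open>[M, M + 1) * 2 powi t\<close>, where \<open>M\<close> has one bit more than a
  significand and \<open>st\<close> tells whether the number differs from \<open>M * 2 powi t\<close>.
\<close>

definition round_guard :: "nat \<Rightarrow> int \<Rightarrow> int \<Rightarrow> bool \<Rightarrow> fp" where
  "round_guard p M t st =
     (let m = M div 2; m' = m + of_bool (odd M \<and> (st \<or> (odd m \<and> 2 \<le> p)))
      in if t + 1 < - (2 ^ p) - 1 then (0, 0)
         else if t + 1 = - (2 ^ p) - 1 then (if M = 2 ^ p \<and> \<not> st then (0, 0) else (2 ^ (p - 1), - (2 ^ p)))
         else if 2 ^ p \<le> t + 1 \<or> (t + 1 = 2 ^ p - 1 \<and> m' = 2 ^ p) then (2 ^ p - 1, 2 ^ p - 1)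
         else if m' = 2 ^ p then (2 ^ (p - 1), t + 2) else (m', t + 1))"

lemma power_int_Suc: "(2::real) powi (t + 1) = 2 * 2 powi t" "(2::real) powi (t + 2) = 4 * 2 powi t"
  by (simp_all add: power_int_add)

lemma fp_round_guard:
  assumes p: "1 \<le> p" and M: "2 ^ p \<le> M" "M < 2 ^ (p + 1)"
    and xM: "real_of_int M * 2 powi t \<le> x" "x < real_of_int (M + 1) * 2 powi t"
    and st: "st \<longleftrightarrow> x \<noteq> real_of_int M * 2 powi t"
  shows "fp_round p x = round_guard p M t st"
proof -
  define u :: real where "u = 2 powi t"
  have u: "0 < u" by (simp add: u_def)
  have pp: "(2::int) ^ p = 2 * 2 ^ (p - 1)" using p by (cases p) auto
  have e: "2 powi (t + 1) = 2 * u" "2 powi (t + 2) = 4 * u" by (simp_all add: u_def power_int_Suc)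
  have Mr: "2 ^ p \<le> real_of_int M" "real_of_int (M + 1) \<le> 2 ^ (p + 1)"
    using M(1) apply (metis of_int_le_iff of_int_numeral of_int_power)
    using M(2) by (metis of_int_le_iff of_int_numeral of_int_power zless_imp_add1_zle)
  have x': "2 ^ p * u \<le> x" "x < 2 ^ (p + 1) * u"
    using order_trans[OF mult_right_mono[OF Mr(1)] xM(1)] order.strict_trans2[OF xM(2) mult_right_mono[OF Mr(2)]] u
    by (simp_all add: u_def)
  define mn :: fp where "mn = (2 ^ (p - 1), - (2 ^ p))"
  have mn: "mn \<in> fp_set p" "fp_val mn = 2 ^ (p - 1) * 2 powi (- (2 ^ p))" "even (fst (0, 0) :: int)"
    using pp by (auto simp: mn_def fp_set_def fp_val_def)
  have mn0: "0 < fp_val mn" by (simp add: mn)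
  have adj0: "adjacent p (0, 0) mn x" if "x \<le> fp_val mn"
    using that mn fp_min_gap[of _ p] fp_zero_in[of p] x'(1) u mn0
    by unfold_locales (auto simp: fp_val_def[of "(0, 0)"] intro: order_trans[of 0 "2 ^ p * u"])
  define m where "m = M div 2"
  have m: "2 ^ (p - 1) \<le> m" "m + 1 \<le> 2 ^ p" using M pp by (auto simp: m_def)
  consider (under) "t + 1 < - (2 ^ p) - 1" | (border) "t + 1 = - (2 ^ p) - 1"
    | (over) "2 ^ p \<le> t + 1" | (top) "t + 1 = 2 ^ p - 1" "m + 1 = 2 ^ p"
    | (normal) "- (2 ^ p) \<le> t + 1" "t + 1 < 2 ^ p" "\<not> (t + 1 = 2 ^ p - 1 \<and> m + 1 = 2 ^ p)" by linarith
  then show ?thesis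
  proof cases
    \<comment> \<open>Here \<open>x\<close> is below half of the least positive number
      \<open>mn\<close>.\<close>
    case under
    have "2 * x < 2 ^ (p - 1) * 2 powi (t + 3)"
      using x'(2) p by (cases p) (auto simp: u_def power_int_add mult_ac)
    also have "\<dots> \<le> 2 ^ (p - 1) * (2::real) powi (- (2 ^ p))"
      using under by (intro mult_left_mono power_int_increasing) auto
    also note mn(2)[symmetric]
    finally have lt: "2 * x < fp_val mn" .
    interpret adjacent p "(0, 0)" mn x using lt mn0 x'(1) u by (intro adj0) linarith
    have "fp_round p x = (0, 0)" by (rule round_lo) (use lt in \<open>auto simp: fp_val_def[of "(0, 0)"]\<close>)
    then show ?thesis using under by (simp add: round_guard_def Let_def)
  next
    \<comment> \<open>Half of \<open>mn\<close> is exactly \<open>2 ^ p * 2 powi t\<close>, the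
      least possible \<open>x\<close> in this case. This single value is a tie, and it goes to
      zero.\<close>
    case border
    then have t: "t + 2 = - (2 ^ p)" by simp
    have "fp_val mn = 2 ^ (p - 1) * 2 powi (t + 2)" unfolding mn(2) t ..
    then have val: "fp_val mn = 2 * (2 ^ p * u)" using p by (cases p) (auto simp: e)
    interpret adjacent p "(0, 0)" mn x using val x'(2) by (intro adj0) simp
    have eq: "real_of_int M * u = 2 ^ p * u \<longleftrightarrow> M = 2 ^ p"
    proof -
      have "real_of_int M = real_of_int (2 ^ p) \<longleftrightarrow> M = 2 ^ p" by (rule of_int_eq_iff)
      then show ?thesis using u by simp
    qed
    show ?thesis
    proof (cases "M = 2 ^ p \<and> \<not> st")
      case True
      then have "x = 2 ^ p * u" using st by (simp add: u_def)
      then have "fp_round p x = (0, 0)" by (intro round_lo) (auto simp: fp_val_def[of "(0, 0)"] val)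
      then show ?thesis using border True by (simp add: round_guard_def Let_def)
    next
      case False
      have "2 ^ p * u < x"
      proof (cases "M = 2 ^ p")
        case True
        then show ?thesis using False st x'(1) by (auto simp: u_def)
      next
        case ne: False
        then have "2 ^ p * u < real_of_int M * u" using eq mult_right_mono[OF Mr(1), of u] u by simp
        then show ?thesis using xM(1) unfolding u_def by linarith
      qed
      then have "fp_round p x = mn" by (intro round_hi) (auto simp: fp_val_def[of "(0, 0)"] val)
      then show ?thesis using border False by (simp add: round_guard_def Let_def mn_def)
    qed
  next
    case over
    have "real_of_int (2 ^ p - 1) * 2 powi (2 ^ p - 1) \<le> 2 ^ p * 2 powi t"
      using over by (intro mult_mono power_int_increasing) auto
    also have "\<dots> \<le> x" using x'(1) by (simp add: u_def)
    finally have "fp_round p x = (2 ^ p - 1, 2 ^ p - 1)" by (rule fp_round_saturate[OF p])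
    moreover have "(0::int) < 2 ^ p" by simp
    then have "\<not> t + 1 < - (2 ^ p) - 1" "t + 1 \<noteq> - (2 ^ p) - 1" using over by linarith+
    ultimately show ?thesis using over by (simp add: round_guard_def Let_def)
  next
    \<comment> \<open>The significand consists of ones and the exponent is the greatest one, so
      there is no upper neighbour. Whether or not \<open>m'\<close> is rounded up,
      \<open>round_guard\<close> yields the greatest number.\<close>
    case top
    have "2 * m \<le> M" by (simp add: m_def)
    then have "real_of_int (2 * m) \<le> real_of_int M" by (rule iffD2[OF of_int_le_iff])
    then have "real_of_int (2 * m) * u \<le> x" using xM(1) u mult_right_mono[of "real_of_int (2 * m)" "real_of_int M" u] unfolding u_def by linarith
    moreover have "m = 2 ^ p - 1" using top by simp
    then have "real_of_int (2 ^ p - 1) * 2 powi (2 ^ p - 1) = real_of_int (2 * m) * u"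
      unfolding top(1)[symmetric] e by simp
    ultimately have "fp_round p x = (2 ^ p - 1, 2 ^ p - 1)" by (intro fp_round_saturate[OF p]) simp
    moreover have "(0::int) < 2 ^ p" by simp
    then have "\<not> t + 1 < - (2 ^ p) - 1" "t + 1 \<noteq> - (2 ^ p) - 1" using top by linarith+
    ultimately show ?thesis using top by (auto simp: round_guard_def Let_def m_def[symmetric])
  next
    case normal
    \<comment> \<open>A carry out of the significand puts the upper neighbour at the next
      exponent.\<close>
    define hi :: fp where "hi = (if m + 1 = 2 ^ p then (2 ^ (p - 1), t + 2) else (m + 1, t + 1))"
    have lo: "(m, t + 1) \<in> fp_set p" using m normal by (auto simp: fp_set_def)
    have hi: "hi \<in> fp_set p" using m normal pp by (auto simp: hi_def fp_set_def)
    have vlo: "fp_val (m, t + 1) = real_of_int m * (2 * u)" by (simp add: fp_val_def e)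
    have vhi: "fp_val hi = real_of_int (m + 1) * (2 * u)"
    proof (cases "m + 1 = 2 ^ p")
      case True
      have "(2::real) ^ p = 2 * 2 ^ (p - 1)" using p by (cases p) auto
      moreover have "real_of_int (m + 1) = 2 ^ p" unfolding True by simp
    ultimately have "real_of_int (m + 1) = 2 * 2 ^ (p - 1)" by (simp only:)
    with True show ?thesis by (simp only: hi_def if_True) (simp add: fp_val_def e)
    qed (simp add: hi_def fp_val_def e)
    have Mm: "M = 2 * m + of_bool (odd M)" by (simp add: m_def)
    then have xu: "(2 * real_of_int m + of_bool (odd M)) * u \<le> x" "x < (2 * real_of_int m + of_bool (odd M) + 1) * u"
      "st \<longleftrightarrow> x \<noteq> (2 * real_of_int m + of_bool (odd M)) * u"
      using xM st by (metis (no_types, lifting) of_int_add of_int_mult of_int_numeral of_int_of_bool of_int_1 u_def)+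
    have bnd: "real_of_int m * (2 * u) \<le> x" "x \<le> real_of_int (m + 1) * (2 * u)"
      using xu u by (auto simp: algebra_simps of_bool_def split: if_splits)
    interpret adjacent p "(m, t + 1)" hi x
    proof
      show "fp_val c \<le> fp_val (m, t + 1) \<or> fp_val hi \<le> fp_val c" if "c \<in> fp_set p" for c
        using fp_gap[OF p m(1) that, of "t + 1"] by (simp only: vlo vhi e)
      have "0 < (2::int) ^ (p - 1)" by simp
      then have "0 \<le> m" using m(1) by linarith
      then show "0 \<le> fp_val (m, t + 1)" using u by (simp add: vlo)
      show "fp_val (m, t + 1) < fp_val hi" unfolding vlo vhi using u by (simp add: algebra_simps)
    qed (use lo hi bnd vlo vhi in auto)
    have m0: "m \<noteq> 0" using m(1) by (smt (verit) zero_less_power)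
    \<comment> \<open>For \<open>p = 1\<close> both neighbours have the odd significand 1, so a tie
      goes down; this is the reason for the test \<open>2 \<le> p\<close> in
      \<open>round_guard\<close>.\<close>
    have parity: "even (fst hi) \<longleftrightarrow> odd m \<and> 2 \<le> p"
    proof (cases "m + 1 = 2 ^ p")
      case True
      then have "m = 2 ^ p - 1" by simp
      with p have "odd m" by simp
      with True p show ?thesis by (cases p) (auto simp: hi_def)
    next
      case False
      have "p \<noteq> 1" using False m by auto
      with False p show ?thesis by (auto simp: hi_def)
    qed
    define up where "up \<longleftrightarrow> odd M \<and> (st \<or> (odd m \<and> 2 \<le> p))"
    have "fp_round p x = (if up then hi else (m, t + 1))"
    proof (cases up)
      case True
      then have "fp_val (m, t + 1) + fp_val hi < 2 * x \<or>
          (2 * x = fp_val (m, t + 1) + fp_val hi \<and> even (fst hi) \<and> odd (fst (m, t + 1)))"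
        using xu parity unfolding vlo vhi up_def by (auto simp: algebra_simps)
      then show ?thesis using True by (simp add: round_hi)
    next
      case False
      then have "2 * x < fp_val (m, t + 1) + fp_val hi \<or>
          (2 * x = fp_val (m, t + 1) + fp_val hi \<and> (even (fst hi) \<longrightarrow> even (fst (m, t + 1))))"
        using xu parity unfolding vlo vhi up_def by (auto simp: algebra_simps of_bool_def split: if_splits)
      then have "fp_round p x = (m, t + 1)" using m0 by (intro round_lo) auto
      then show ?thesis using False by simp
    qed
    moreover have "m \<noteq> 2 ^ p" using m by linarith
    ultimately show ?thesis
      using normal unfolding round_guard_def Let_def m_def[symmetric] up_def[symmetric]
      by (auto simp: hi_def)
  qed
qed

text \<open>Of the bits after the first \<open>p + 1\<close> it only matters whether all of them
  vanish, so they are merged into the sticky flag.\<close>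

lemma fp_round_bits:
  assumes p: "1 \<le> p" and L: "p \<le> L" "2 ^ L \<le> M" "M < 2 ^ (L + 1)"
    and x: "real_of_int M * 2 powi t \<le> x" "x < real_of_int (M + 1) * 2 powi t"
    and st: "st \<longleftrightarrow> x \<noteq> real_of_int M * 2 powi t"
  shows "fp_round p x = round_guard p (M div 2 ^ (L - p)) (t + int (L - p)) (st \<or> M mod 2 ^ (L - p) \<noteq> 0)"
proof (rule fp_round_guard[OF p])
  define k where "k = L - p"
  define N where "N = M div 2 ^ k"
  define r where "r = M mod 2 ^ k"
  have L': "L = p + k" using L(1) by (simp add: k_def)
  have r: "0 \<le> r" "r < 2 ^ k" "M = N * 2 ^ k + r" by (simp_all only: r_def N_def div_mult_mod_eq) simp_all
  show "2 ^ p \<le> M div 2 ^ (L - p)"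
    using zdiv_mono1[OF L(2), of "2 ^ k"] by (simp add: L' power_add k_def[symmetric])
  show "M div 2 ^ (L - p) < 2 ^ (p + 1)"
  proof -
    have "N * 2 ^ k < 2 ^ (p + 1) * 2 ^ k"
    proof (rule order.strict_trans1)
      show "N * 2 ^ k \<le> M" using r(1) by (subst r(3)) simp
      show "M < 2 ^ (p + 1) * 2 ^ k" using L(3) by (simp add: L' power_add mult_ac)
    qed
    then show ?thesis by (simp add: k_def[symmetric] N_def)
  qed
  define u :: real where "u = 2 powi t"
  have u: "0 < u" by (simp add: u_def)
  have tk: "2 powi (t + int (L - p)) = 2 ^ k * u"
    by (simp add: k_def[symmetric] power_int_add u_def)
  have Mr: "real_of_int M = real_of_int N * 2 ^ k + real_of_int r" unfolding r(3) by simp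
  have "r + 1 \<le> 2 ^ k" using r by simp
  then have "real_of_int (r + 1) \<le> real_of_int (2 ^ k)" by (rule iffD2[OF of_int_le_iff])
  then have rr: "real_of_int r + 1 \<le> 2 ^ k" by simp
  have x': "real_of_int M * u \<le> x" "x < (real_of_int M + 1) * u" using x by (simp_all add: u_def)
  have Nu: "real_of_int N * 2 ^ k * u \<le> real_of_int M * u" using r u by (intro mult_right_mono) (auto simp: Mr)
  have eq: "real_of_int (M div 2 ^ (L - p)) * 2 powi (t + int (L - p)) = real_of_int N * 2 ^ k * u"
    by (simp only: tk) (simp add: k_def[symmetric] N_def[symmetric])
  show "real_of_int (M div 2 ^ (L - p)) * 2 powi (t + int (L - p)) \<le> x"
    unfolding eq using Nu x'(1) by (rule order_trans)
  have "(real_of_int M + 1) * u \<le> (real_of_int N * 2 ^ k + 2 ^ k) * u" using rr u by (intro mult_right_mono) (auto simp: Mr)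
  also have "\<dots> = real_of_int (M div 2 ^ (L - p) + 1) * 2 powi (t + int (L - p))"
    using eq by (simp only: of_int_add of_int_1 distrib_right tk) (simp only: k_def[symmetric] mult_1)?
  finally show "x < real_of_int (M div 2 ^ (L - p) + 1) * 2 powi (t + int (L - p))"
    using x'(2) by (rule order.strict_trans2[rotated])
  show "(st \<or> M mod 2 ^ (L - p) \<noteq> 0) \<longleftrightarrow> x \<noteq> real_of_int (M div 2 ^ (L - p)) * 2 powi (t + int (L - p))"
  proof (cases "r = 0")
    case True
    then show ?thesis using st unfolding tk by (simp add: k_def[symmetric] N_def[symmetric] r_def[symmetric] Mr u_def mult.assoc)
  next
    case False
    then have "real_of_int N * 2 ^ k * u < real_of_int M * u" using r u by (intro mult_strict_right_mono) (auto simp: Mr)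
    then have "x \<noteq> real_of_int N * 2 ^ k * u" using x(1) unfolding u_def by linarith
    then show ?thesis using False unfolding tk by (simp add: k_def[symmetric] N_def[symmetric] r_def[symmetric] mult.assoc)
  qed
qed


section \<open>Sums of numbers with widely differing exponents\<close>

text \<open>
  An index is a bottom if no exponent lies within distance \<open>G\<close> below its own. The indices from a
  bottom up to the next one form a cluster, whose sum is a short multiple of the power of two at the
  bottom. The sign of a sum is that of its highest nonzero cluster, since all the lower clusters
  together are much smaller.
\<close>

locale clusters =
  fixes e m :: "nat \<Rightarrow> int" and G :: int
  assumes G: "0 \<le> G"
begin

definition bottom :: "nat set \<Rightarrow> nat \<Rightarrow> bool" where
  "bottom I b \<longleftrightarrow> b \<in> I \<and> (\<forall>j\<in>I. \<not> (e b - G \<le> e j \<and> e j < e b))"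

definition clus :: "nat set \<Rightarrow> nat \<Rightarrow> nat set" where
  "clus I b = {k \<in> I. e b \<le> e k \<and> \<not> (\<exists>c\<in>I. bottom I c \<and> e b < e c \<and> e c \<le> e k)}"

definition csum :: "nat set \<Rightarrow> nat \<Rightarrow> int" where
  "csum I b = (\<Sum>k\<in>clus I b. m k * 2 ^ nat (e k - e b))"

definition top :: "nat set \<Rightarrow> nat \<Rightarrow> bool" where
  "top I b \<longleftrightarrow> bottom I b \<and> csum I b \<noteq> 0 \<and> (\<forall>c\<in>I. bottom I c \<and> e b < e c \<longrightarrow> csum I c = 0)"

definition val :: "nat \<Rightarrow> real" where "val k = real_of_int (m k) * 2 powi e k"

text \<open>A member above the bottom of its cluster is not a bottom itself, so some exponent lies
  within \<open>G\<close> below it. The descent visits strictly decreasing exponents and takes at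
  most \<open>card I\<close> steps.\<close>

lemma clus_span:
  assumes "finite I" "bottom I b" "k \<in> clus I b"
  shows "e k - e b \<le> G * int (card I)"
proof -
  have "e k - e b \<le> G * int (card {j\<in>I. e b \<le> e j \<and> e j < e k})"
    using assms(3)
  proof (induction "nat (e k - e b)" arbitrary: k rule: less_induct)
    case less
    then have k: "k \<in> I" "e b \<le> e k" and no: "\<not> (\<exists>c\<in>I. bottom I c \<and> e b < e c \<and> e c \<le> e k)"
      by (auto simp: clus_def)
    show ?case
    proof (cases "e k = e b")
      case False
      then obtain j where j: "j \<in> I" "e k - G \<le> e j" "e j < e k"
        using k no by (auto simp: bottom_def)
      have jb: "e b \<le> e j"
        using assms(2) j k unfolding bottom_def by (smt (verit))
      have "j \<in> clus I b" using no j jb by (auto simp: clus_def)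
      with less(1)[of j] j jb have "e j - e b \<le> G * int (card {i\<in>I. e b \<le> e i \<and> e i < e j})" by auto
      moreover have "card {i\<in>I. e b \<le> e i \<and> e i < e j} < card {i\<in>I. e b \<le> e i \<and> e i < e k}"
        using assms(1) j jb by (intro psubset_card_mono) auto
      then have "G * (int (card {i\<in>I. e b \<le> e i \<and> e i < e j}) + 1) \<le> G * int (card {i\<in>I. e b \<le> e i \<and> e i < e k})"
        using G by (intro mult_left_mono) auto
      ultimately show ?thesis using j by (simp add: algebra_simps)
    qed (simp add: G)
  qed
  also have "\<dots> \<le> G * int (card I)"
    using G assms(1) by (intro mult_left_mono) (auto intro: card_mono)
  finally show ?thesis .
qed

text \<open>Everything from \<open>b\<close> upwards consists of the cluster of \<open>b\<close> and
  of the tail that starts at the next bottom, which vanishes by induction.\<close>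

lemma tail_sum:
  assumes "finite I" "bottom I b" "\<And>c. c \<in> I \<Longrightarrow> bottom I c \<Longrightarrow> e b < e c \<Longrightarrow> csum I c = 0"
  shows "(\<Sum>k | k \<in> I \<and> e b \<le> e k. val k) = real_of_int (csum I b) * 2 powi e b"
  using assms(2,3)
proof (induction "card {k\<in>I. e b < e k}" arbitrary: b rule: less_induct)
  case less
  let ?B = "{c\<in>I. bottom I c \<and> e b < e c}"
  have clus_val: "(\<Sum>k\<in>clus I b. val k) = real_of_int (csum I b) * 2 powi e b"
    unfolding csum_def of_int_sum sum_distrib_right
  proof (rule sum.cong)
    fix k assume "k \<in> clus I b"
    then have "e b \<le> e k" by (simp add: clus_def)
    then have "2 powi e k = 2 ^ nat (e k - e b) * (2::real) powi e b"
      by (simp add: power_int_add[symmetric] flip: power_int_of_nat)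
    then show "val k = real_of_int (m k * 2 ^ nat (e k - e b)) * 2 powi e b"
      by (simp add: val_def)
  qed simp
  show ?case
  proof (cases "?B = {}")
    case True
    then have "{k. k \<in> I \<and> e b \<le> e k} = clus I b" by (auto simp: clus_def)
    then show ?thesis using clus_val by simp
  next
    case False
    then obtain c where c: "c \<in> ?B" "\<And>c'. c' \<in> ?B \<Longrightarrow> e c \<le> e c'"
      using assms(1) ex_min_if_finite[of "e ` ?B"] by (fastforce simp: not_less)
    have split: "{k. k \<in> I \<and> e b \<le> e k} = clus I b \<union> {k. k \<in> I \<and> e c \<le> e k}"
      using c by (fastforce simp: clus_def)
    have disj: "clus I b \<inter> {k. k \<in> I \<and> e c \<le> e k} = {}"
      using c(1) by (auto simp: clus_def)
    have "card {k\<in>I. e c < e k} < card {k\<in>I. e b < e k}"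
      using c(1) assms(1) by (intro psubset_card_mono) auto
    then have "(\<Sum>k | k \<in> I \<and> e c \<le> e k. val k) = real_of_int (csum I c) * 2 powi e c"
      using c(1) less by (intro less.hyps) auto
    moreover have "csum I c = 0" using less c(1) by auto
    ultimately show ?thesis
      unfolding split using assms(1) disj clus_val by (subst sum.union_disjoint) (auto simp: clus_def)
  qed
qed

lemma sum_zero:
  assumes "finite I" "\<And>c. c \<in> I \<Longrightarrow> bottom I c \<Longrightarrow> csum I c = 0"
  shows "(\<Sum>k\<in>I. val k) = 0"
proof (cases "I = {}")
  case False
  then obtain b where b: "b \<in> I" "\<And>c. c \<in> I \<Longrightarrow> e b \<le> e c"
    using assms(1) ex_min_if_finite[of "e ` I"] by (fastforce simp: not_less)
  then have bb: "bottom I b" by (fastforce simp: bottom_def)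
  have "I = {k. k \<in> I \<and> e b \<le> e k}" using b by auto
  then show ?thesis using tail_sum[OF assms(1) bb] assms(2) bb b(1) by simp
qed simp

lemma ex_top:
  assumes "finite I" "c \<in> I" "bottom I c" "csum I c \<noteq> 0"
  shows "\<exists>b\<in>I. top I b"
proof -
  let ?B = "{c\<in>I. bottom I c \<and> csum I c \<noteq> 0}"
  obtain b where b: "b \<in> ?B" "\<And>c'. c' \<in> ?B \<Longrightarrow> e c' \<le> e b"
    using assms ex_min_if_finite[of "(\<lambda>c. - e c) ` ?B"] by (fastforce simp: not_less)
  then have "top I b" by (fastforce simp: top_def)
  then show ?thesis using b by auto
qed

text \<open>The origin of \<open>G = p + q + K\<close>: fewer than \<open>2 ^ K\<close> terms lie
  below \<open>b\<close>, their significands are below \<open>2 ^ p\<close> and their exponents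
  below \<open>e b - G\<close>, so \<open>q\<close> binary places remain free.\<close>

lemma rest_small:
  assumes "finite I" "bottom I b" "\<And>k. k \<in> I \<Longrightarrow> \<bar>m k\<bar> < 2 ^ p" "card I \<le> K" "G = int (p + q + K)"
  shows "\<bar>\<Sum>k | k \<in> I \<and> e k < e b. val k\<bar> * 2 ^ q < 2 powi e b"
proof -
  have "\<bar>val k\<bar> \<le> 2 ^ p * 2 powi (e b - G)" if k: "k \<in> I" "e k < e b" for k
  proof -
    have "e k \<le> e b - G" using assms(2) k by (fastforce simp: bottom_def)
    then have "(2::real) powi e k \<le> 2 powi (e b - G)" by (intro power_int_increasing) auto
    moreover have "\<bar>m k\<bar> \<le> 2 ^ p" using assms(3)[OF k(1)] by simp
    then have "\<bar>real_of_int (m k)\<bar> \<le> 2 ^ p"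
      by (metis of_int_abs of_int_le_iff of_int_numeral of_int_power)
    ultimately show ?thesis unfolding val_def abs_mult by (intro mult_mono) auto
  qed
  then have "\<bar>\<Sum>k | k \<in> I \<and> e k < e b. val k\<bar> \<le> (\<Sum>k | k \<in> I \<and> e k < e b. 2 ^ p * 2 powi (e b - G))"
    by (intro order_trans[OF sum_abs] sum_mono) auto
  also have "\<dots> = real (card {k. k \<in> I \<and> e k < e b}) * (2 ^ p * 2 powi (e b - G))" by simp
  also have "\<dots> < 2 ^ K * (2 ^ p * 2 powi (e b - G))"
  proof (intro mult_strict_right_mono)
    have "card {k. k \<in> I \<and> e k < e b} \<le> K"
      using card_mono[OF assms(1), of "{k. k \<in> I \<and> e k < e b}"] assms(4) by auto
    also have "K < 2 ^ K" by (rule less_exp)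
    finally show "real (card {k. k \<in> I \<and> e k < e b}) < 2 ^ K"
      by (metis of_nat_less_iff of_nat_numeral of_nat_power)
  qed simp
  finally have "\<bar>\<Sum>k | k \<in> I \<and> e k < e b. val k\<bar> * 2 ^ q < 2 ^ K * (2 ^ p * 2 powi (e b - G)) * 2 ^ q"
    by simp
  also have "\<dots> = 2 ^ (p + q + K) * 2 powi (e b - G)" by (simp add: power_add)
  also have "\<dots> = 2 powi (int (p + q + K) + (e b - G))" by (subst power_int_add) (simp, simp only: power_int_of_nat)
  also have "\<dots> = 2 powi e b" by (simp add: assms(5))
  finally show ?thesis .
qed

lemma bottom_below: "bottom {k\<in>I. e k < t} b \<longleftrightarrow> bottom I b \<and> e b < t"
  by (auto simp: bottom_def)

text \<open>No cluster that starts below the bottom \<open>v\<close> reaches across it. After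
  removal of the indices from \<open>v\<close> upwards, the second highest nonzero cluster is thus
  the top of what remains.\<close>

lemma csum_below:
  assumes "bottom I v" "bottom I b" "e b < e v"
  shows "csum {k\<in>I. e k < e v} b = csum I b"
proof -
  have "clus {k\<in>I. e k < e v} b = clus I b"
  proof (intro equalityI subsetI)
    fix k assume k: "k \<in> clus {k\<in>I. e k < e v} b"
    then have "\<not> (bottom I c \<and> e b < e c \<and> e c \<le> e k)" if "c \<in> I" for c
      using that by (auto simp: clus_def bottom_below)
    then show "k \<in> clus I b" using k by (auto simp: clus_def)
  next
    fix k assume k: "k \<in> clus I b"
    have "v \<in> I" using assms(1) by (simp add: bottom_def)
    then have "e k < e v" using k assms by (auto simp: clus_def not_le[symmetric])
    with k show "k \<in> clus {k\<in>I. e k < e v} b" by (auto simp: clus_def bottom_below)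
  qed
  then show ?thesis by (simp add: csum_def)
qed

lemma top_below:
  assumes "bottom I v"
  shows "top {k\<in>I. e k < e v} b \<longleftrightarrow> bottom I b \<and> e b < e v \<and> csum I b \<noteq> 0 \<and>
    (\<forall>c\<in>I. bottom I c \<and> e b < e c \<and> e c < e v \<longrightarrow> csum I c = 0)"
  unfolding top_def bottom_below using csum_below[OF assms] by auto

lemma top_sum:
  assumes "finite I" "top I b" "\<And>k. k \<in> I \<Longrightarrow> \<bar>m k\<bar> < 2 ^ p" "card I \<le> K" "G = int (p + q + K)"
  shows "\<exists>r. (\<Sum>k\<in>I. val k) = real_of_int (csum I b) * 2 powi e b + r \<and>
    r = (\<Sum>k | k \<in> I \<and> e k < e b. val k) \<and> \<bar>r\<bar> * 2 ^ q < 2 powi e b"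
proof -
  have "I = {k. k \<in> I \<and> e b \<le> e k} \<union> {k. k \<in> I \<and> e k < e b}" by auto
  then have "(\<Sum>k\<in>I. val k) = (\<Sum>k | k \<in> I \<and> e b \<le> e k. val k) + (\<Sum>k | k \<in> I \<and> e k < e b. val k)"
    using assms(1) by (subst sum.union_disjoint[symmetric]) auto
  moreover have "(\<Sum>k | k \<in> I \<and> e b \<le> e k. val k) = real_of_int (csum I b) * 2 powi e b"
    using assms(2) by (intro tail_sum assms(1)) (auto simp: top_def)
  ultimately show ?thesis using rest_small[OF assms(1) _ assms(3-5)] assms(2) by (auto simp: top_def)
qed

lemma top_sgn:
  assumes "finite I" "top I b" "\<And>k. k \<in> I \<Longrightarrow> \<bar>m k\<bar> < 2 ^ p" "card I \<le> K" "G = int (p + q + K)"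
  shows "sgn (\<Sum>k\<in>I. val k) = real_of_int (sgn (csum I b))"
proof -
  obtain r where r: "(\<Sum>k\<in>I. val k) = real_of_int (csum I b) * 2 powi e b + r" "\<bar>r\<bar> * 2 ^ q < 2 powi e b"
    using top_sum[OF assms] by blast
  have "\<bar>r\<bar> * 1 \<le> \<bar>r\<bar> * 2 ^ q" by (intro mult_left_mono) auto
  with r(2) have r': "\<bar>r\<bar> < 2 powi e b" by simp
  define u :: real where "u = 2 powi e b"
  have u: "0 < u" by (simp add: u_def)
  have "csum I b \<noteq> 0" using assms(2) by (simp add: top_def)
  then consider "1 \<le> csum I b" | "csum I b \<le> - 1" by linarith
  then show ?thesis
  proof cases
    case 1
    then have "1 * u \<le> real_of_int (csum I b) * u" using u by (intro mult_right_mono) auto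
    with r r' have "0 < (\<Sum>k\<in>I. val k)" unfolding u_def by linarith
    with 1 show ?thesis by simp
  next
    case 2
    then have "real_of_int (csum I b) * u \<le> - 1 * u" using u by (intro mult_right_mono) auto
    with r r' have "(\<Sum>k\<in>I. val k) < 0" unfolding u_def by linarith
    with 2 show ?thesis by simp
  qed
qed

end

section \<open>Floating-point arithmetic by threshold formulas\<close>

text \<open>A formula that is correct only where \<open>c\<close> holds becomes correct on all of
  \<open>D\<close> by conjunction with \<open>c\<close>. As \<open>thr\<close> identifies functions
  that agree on the domain, the induction first finds a formula over \<open>D\<close> that agrees
  with \<open>f\<close> where \<open>c\<close> holds.\<close>

lemma thr_restrict_conj:
  assumes "thr D X s mj d c" "thr {a\<in>D. c a} X s mj d f" "2 \<le> s"
  shows "thr D X s mj (d + 2) (\<lambda>a. c a \<and> f a)"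
proof -
  have "\<exists>g. thr D X s mj d g \<and> (\<forall>a\<in>D. c a \<longrightarrow> f a = g a)"
    using assms(2)
  proof induction
    case (thr_And fs d)
    then obtain h where h: "\<And>f. f \<in> set fs \<Longrightarrow> thr D X s mj d (h f) \<and> (\<forall>a\<in>D. c a \<longrightarrow> f a = h f a)" by metis
    then have "thr D X s mj (Suc d) (\<lambda>a. \<forall>g\<in>set (map h fs). g a)"
      using thr_And by (intro thr.thr_And) auto
    then show ?case using h by (intro exI[of _ "\<lambda>a. \<forall>g\<in>set (map h fs). g a"]) auto
  next
    case (thr_Or fs d)
    then obtain h where h: "\<And>f. f \<in> set fs \<Longrightarrow> thr D X s mj d (h f) \<and> (\<forall>a\<in>D. c a \<longrightarrow> f a = h f a)" by metis
    then have "thr D X s mj (Suc d) (\<lambda>a. \<exists>g\<in>set (map h fs). g a)"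
      using thr_Or by (intro thr.thr_Or) auto
    then show ?case using h by (intro exI[of _ "\<lambda>a. \<exists>g\<in>set (map h fs). g a"]) auto
  next
    case (thr_Maj fs d)
    then obtain h where h: "\<And>f. f \<in> set fs \<Longrightarrow> thr D X s mj d (h f) \<and> (\<forall>a\<in>D. c a \<longrightarrow> f a = h f a)" by metis
    then have "thr D X s mj (Suc d) (\<lambda>a. length (map h fs) < 2 * length (filter (\<lambda>f. f a) (map h fs)))"
      using thr_Maj by (intro thr.thr_Maj) auto
    moreover have "length (filter (\<lambda>f. f a) fs) = length (filter (\<lambda>f. f a) (map h fs))" if "a \<in> D" "c a" for a
    proof -
      have "filter (\<lambda>f. f a) fs = filter (\<lambda>f. h f a) fs" using h that by (intro filter_cong) auto
      then show ?thesis by (simp add: filter_map comp_def)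
    qed
    ultimately show ?case
      by (intro exI[of _ "\<lambda>a. length (map h fs) < 2 * length (filter (\<lambda>f. f a) (map h fs))"]) auto
  next
    case (thr_cong d f g)
    then obtain h where "thr D X s mj d h" "\<forall>a\<in>D. c a \<longrightarrow> f a = h a" by blast
    with thr_cong(2) show ?case by (intro exI[of _ h]) auto
  qed (blast intro: thr.intros)+
  then obtain g where g: "thr D X s mj d g" "\<And>a. a \<in> D \<Longrightarrow> c a \<Longrightarrow> f a = g a" by blast
  have "thr D X s mj (Suc (max d d)) (\<lambda>a. c a \<and> f a)"
    by (rule thr_cong[OF thr_conj[OF assms(1) g(1) assms(3)]]) (use g(2) in auto)
  then show ?thesis by (rule thr_mono) simp
qed

section \<open>Floating-point numbers given by formulas; rounding\<close>

locale tcp = tc D X z for D :: "'a set" and X and z +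
  fixes p :: nat
  assumes p1: "1 \<le> p" and pz: "p \<le> z"
begin

definition tf :: "nat \<Rightarrow> ('a \<Rightarrow> fp) \<Rightarrow> bool" where
  "tf d F \<longleftrightarrow> (\<forall>a\<in>D. F a \<in> fp_set p) \<and>
     (\<forall>i. T d (\<lambda>a. bit (fst (F a)) i)) \<and> (\<forall>i. T d (\<lambda>a. bit (snd (F a)) i))"

lemma tf_mono: "tf d F \<Longrightarrow> d \<le> d' \<Longrightarrow> tf d' F"
  unfolding tf_def by (auto intro: T_mono)

lemma tf_cong: "tf d F \<Longrightarrow> (\<And>a. a \<in> D \<Longrightarrow> F a = G a) \<Longrightarrow> tf d G"
  unfolding tf_def
  by (intro conjI allI; (elim conjE)?)
    (auto intro: thr_cong[of _ _ _ _ _ "\<lambda>a. bit (fst (F a)) _"] thr_cong[of _ _ _ _ _ "\<lambda>a. bit (snd (F a)) _"])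

lemma tf_const: "c \<in> fp_set p \<Longrightarrow> tf d (\<lambda>_. c)"
  unfolding tf_def by (auto intro: thr_const)

lemma fp_set_abs:
  assumes "a \<in> fp_set p"
  shows "\<bar>fst a\<bar> < 2 ^ p" "\<bar>snd a\<bar> < 2 ^ (p + 1)"
proof -
  obtain m e where a: "a = (m, e)" by (cases a)
  have "(0::int) < 2 ^ (p - 1)" "(0::int) < 2 ^ p" "(2::int) ^ (p + 1) = 2 * 2 ^ p" by simp_all
  moreover have "(- (2 ^ p) < m \<and> m \<le> - (2 ^ (p - 1))) \<or> m = 0 \<or> (2 ^ (p - 1) \<le> m \<and> m < 2 ^ p)"
    "- (2 ^ p) \<le> e" "e < 2 ^ p"
    using assms unfolding a fp_set_def by auto
  ultimately show "\<bar>fst a\<bar> < 2 ^ p" "\<bar>snd a\<bar> < 2 ^ (p + 1)"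
    unfolding a fst_conv snd_conv by linarith+
qed

lemma tf_ti:
  assumes "tf d F"
  shows "ti d p (\<lambda>a. fst (F a))" "ti d (p + 1) (\<lambda>a. snd (F a))"
  using assms fp_set_abs unfolding tf_def ti_def by auto

lemma tfI:
  assumes "\<And>a. a \<in> D \<Longrightarrow> F a \<in> fp_set p" "ti d v (\<lambda>a. fst (F a))" "ti d w (\<lambda>a. snd (F a))"
  shows "tf d F"
  using assms unfolding tf_def ti_def by auto

lemma ti_if_same:
  assumes "T d c" "ti d w F" "ti d w G"
  shows "ti (d + 3) w (\<lambda>a. if c a then F a else G a)"
  using ti_if[OF assms] by simp

lemma p_Z: "p \<le> Z 1" using pz by (simp add: Z_def)

lemma pow_abs_less: "i < j \<Longrightarrow> \<bar>2 ^ i\<bar> < (2::int) ^ j" "i < j \<Longrightarrow> \<bar>- (2 ^ i)\<bar> < (2::int) ^ j"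
  by simp_all

lemma pow_p_bounds: "\<bar>2 ^ p - 1\<bar> < (2::int) ^ (p + 2)" "\<bar>- (2 ^ p) - 1\<bar> < (2::int) ^ (p + 2)"
  "\<bar>2 ^ (p - 1)\<bar> < (2::int) ^ (p + 2)" "\<bar>2 ^ p\<bar> < (2::int) ^ (p + 2)" "\<bar>- (2 ^ p)\<bar> < (2::int) ^ (p + 2)"
proof -
  have "(1::int) \<le> 2 ^ p" "(2::int) ^ (p + 2) = 4 * 2 ^ p" by simp_all
  then show "\<bar>2 ^ p - 1\<bar> < (2::int) ^ (p + 2)" "\<bar>- (2 ^ p) - 1\<bar> < (2::int) ^ (p + 2)"
    by linarith+
qed (rule pow_abs_less; simp)+

lemma Z7_le: "w \<le> Z 6 \<Longrightarrow> p + w + 10 \<le> Z 7"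
proof -
  assume "w \<le> Z 6"
  moreover have "1 \<le> Z 5" by (rule Z_mono[OF Z_const]) simp_all
  then have "z \<le> Z 6" "16 \<le> Z 6" using z16 by (auto simp: Z_def eval_nat_numeral intro: order_trans)
  moreover have "16 * Z 6 \<le> Z 7" using mult_right_mono[OF z16, of "z ^ 6"] power_Suc[of z 6] by (simp add: Z_def)
  ultimately show ?thesis using pz by linarith
qed

lemma tf_guard:
  assumes N: "ti d (p + 1) N" and t: "ti d w t" and st: "T d st" and w: "w \<le> Z 6"
    and bnd: "\<And>a. a \<in> D \<Longrightarrow> 0 \<le> N a"
    and val: "\<And>a. a \<in> D \<Longrightarrow> round_guard p (N a) (t a) (st a) \<in> fp_set p"
  shows "tf (d + 90) (\<lambda>a. round_guard p (N a) (t a) (st a))"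
proof -
  define v where "v = p + w + 4"
  have v7: "v \<le> Z 7" "v + 2 \<le> Z 7" "Suc v \<le> Z 7" using Z7_le[OF w] by (auto simp: v_def)
  have ov: "1 \<le> v" "p + 1 \<le> v" "p + 2 \<le> v" "p + 3 \<le> v" "Suc (max w 1) \<le> v" "p + 1 \<le> Z 7" "1 \<le> Z 7" "w \<le> Z 7" "p + 2 \<le> Z 7"
    using Z7_le[OF w] by (auto simp: v_def)
  have c: "ti e' v (\<lambda>_. k)" if "\<bar>k\<bar> < 2 ^ (p + 2)" for k e'
    using that by (intro ti_mono[OF ti_const[OF that, of e'] order_refl]) (simp add: v_def)
  define up where "up = (\<lambda>a. odd (N a) \<and> (st a \<or> (odd (N a div 2) \<and> 2 \<le> p)))"
  define m where "m = (\<lambda>a. N a div 2)"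
  define m' where "m' = (\<lambda>a. m a + of_bool (up a))"
  define e where "e = (\<lambda>a. t a + 1)"
  have Nb: "T d (\<lambda>a. bit (N a) i)" for i using N by (simp add: ti_def)
  have up: "T (d + 3) up"
  proof (rule thr_cong)
    show "T (d + 3) (\<lambda>a. bit (N a) 0 \<and> (st a \<or> (bit (N a) 1 \<and> 2 \<le> p)))"
      by (rule T_mono) (rule T_conj T_disj Nb st thr_const[of _ _ _ _ 0] | simp)+
  qed (simp add: up_def bit_iff_odd)
  have tim: "ti d (p + 1) m"
    unfolding ti_def
  proof (intro conjI ballI allI)
    fix a assume "a \<in> D"
    then have "\<bar>N a\<bar> < 2 ^ (p + 1)" "0 \<le> N a" using N bnd by (auto simp: ti_def)
    then show "\<bar>m a\<bar> < 2 ^ (p + 1)" by (simp add: m_def)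
  next
    show "T d (\<lambda>a. bit (m a) i)" for i using Nb[of "Suc i"] by (simp add: m_def bit_Suc)
  qed
  have "ti (max d (d + 3 + 16) + 16) (Suc (max (p + 1) 1)) m'"
    unfolding m'_def using tim up ov by (intro ti_add ti_of_bool) auto
  then have tm': "ti (d + 50) v m'" by (rule ti_mono) (use ov in auto)
  have "ti (max d 0 + 16) (Suc (max w 1)) e"
    unfolding e_def using t ov by (intro ti_add ti_const) auto
  then have te: "ti (d + 50) v e" by (rule ti_mono) (use ov in auto)
  have cN: "T (d + 68) (\<lambda>a. N a = 2 ^ p)"
    using T_eq[OF N ti_const[OF pow_p_bounds(4), of 0]] ov by (auto intro: T_mono)
  have cmp: "T (d + 66) (\<lambda>a. e a < k)" "T (d + 67) (\<lambda>a. k \<le> e a)" "T (d + 68) (\<lambda>a. e a = k)" "T (d + 68) (\<lambda>a. m' a = k)"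
    if "\<bar>k\<bar> < 2 ^ (p + 2)" for k
    using T_less[OF te c[OF that, of 0] v7(1) v7(1)] T_le[OF c[OF that, of 0] te v7(1) v7(1)]
      T_eq[OF te c[OF that, of 0] v7(1) v7(1)] T_eq[OF tm' c[OF that, of 0] v7(1) v7(1)] by (simp_all add: add.commute)
  define c1 c2 c3 c4 c5 where "c1 = (\<lambda>a. e a < - (2 ^ p) - 1)" and "c2 = (\<lambda>a. e a = - (2 ^ p) - 1)"
    and "c3 = (\<lambda>a. N a = 2 ^ p \<and> \<not> st a)" and "c4 = (\<lambda>a. 2 ^ p \<le> e a \<or> (e a = 2 ^ p - 1 \<and> m' a = 2 ^ p))"
    and "c5 = (\<lambda>a. m' a = 2 ^ p)"
  have cs: "T (d + 70) c1" "T (d + 70) c2" "T (d + 70) c3" "T (d + 70) c4" "T (d + 70) c5"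
    unfolding c1_def c2_def c3_def c4_def c5_def
    by (rule T_mono, (rule T_conj T_disj thr_Not cmp st cN pow_p_bounds | simp)+)+
  have e1: "ti (d + 70) (v + 2) (\<lambda>a. e a + 1)" "ti (d + 70) (v + 2) e" "ti (d + 70) (v + 2) m'"
    using ti_mono[OF ti_add[OF te ti_const[of 1 1 0] v7(1)], of "d + 70" "v + 2"]
      ti_mono[OF te, of "d + 70" "v + 2"] ti_mono[OF tm', of "d + 70" "v + 2"] ov by auto
  have cc: "ti e' (v + 2) (\<lambda>_. k)" if "\<bar>k\<bar> < 2 ^ (p + 2)" for k e'
    using c[OF that] by (rule ti_mono) auto
  have k0: "\<bar>0\<bar> < (2::int) ^ (p + 2)" by simp
  have eq: "round_guard p (N a) (t a) (st a) = (if c1 a then (0, 0)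
     else if c2 a then (if c3 a then (0, 0) else (2 ^ (p - 1), - (2 ^ p)))
     else if c4 a then (2 ^ p - 1, 2 ^ p - 1)
     else if c5 a then (2 ^ (p - 1), e a + 1) else (m' a, e a))" for a
    unfolding round_guard_def Let_def c1_def c2_def c3_def c4_def c5_def e_def m'_def m_def up_def by simp
  have cm: "T d' f" if "T (d + 70) f" "d + 70 \<le> d'" for d' f using that by (rule T_mono)
  have nest: "ti (d + 90) (v + 2) (\<lambda>a. if c1 a then 0 else if c2 a then (if c3 a then 0 else k1)
      else if c4 a then k2 else if c5 a then F a else G a)"
    if "ti (d + 70) (v + 2) F" "ti (d + 70) (v + 2) G" "\<bar>k1\<bar> < 2 ^ (p + 2)" "\<bar>k2\<bar> < 2 ^ (p + 2)" for F G k1 k2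
  proof -
    have a: "ti (d + 70 + 3) (v + 2) (\<lambda>a. if c5 a then F a else G a)" by (rule ti_if_same[OF cs(5) that(1,2)])
    have b: "ti (d + 73 + 3) (v + 2) (\<lambda>a. if c4 a then k2 else if c5 a then F a else G a)"
      using a by (intro ti_if_same cc that(4) cm[OF cs(4)]) (auto intro: ti_mono)
    have b': "ti (d + 73 + 3) (v + 2) (\<lambda>a. if c3 a then 0 else k1)"
      by (intro ti_if_same cc that(3) k0 cm[OF cs(3)]) simp
    have c: "ti (d + 76 + 3) (v + 2) (\<lambda>a. if c2 a then (if c3 a then 0 else k1) else if c4 a then k2 else if c5 a then F a else G a)"
      using b b' by (intro ti_if_same cm[OF cs(2)]) (auto intro: ti_mono)
    have d: "ti (d + 79 + 3) (v + 2) (\<lambda>a. if c1 a then 0 else if c2 a then (if c3 a then 0 else k1) else if c4 a then k2 else if c5 a then F a else G a)"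
      using c by (intro ti_if_same cc k0 cm[OF cs(1)]) (auto intro: ti_mono)
    then show ?thesis by (rule ti_mono) auto
  qed
  show ?thesis
  proof (rule tfI)
    show "ti (d + 90) (v + 2) (\<lambda>a. fst (round_guard p (N a) (t a) (st a)))"
      unfolding eq if_distrib[of fst] fst_conv by (intro nest cc e1 pow_p_bounds)
    show "ti (d + 90) (v + 2) (\<lambda>a. snd (round_guard p (N a) (t a) (st a)))"
      unfolding eq if_distrib[of snd] snd_conv by (intro nest e1 pow_p_bounds)
  qed (rule val)
qed

lemma mod_pow_bits: "x mod 2 ^ k \<noteq> 0 \<longleftrightarrow> (\<exists>i<k. bit x i)" for x :: int
  unfolding take_bit_eq_mod[symmetric] by (auto simp: bit_eq_iff[of "take_bit k x"] bit_take_bit_iff)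

lemma bit_length_nat:
  assumes "2 ^ p \<le> (M::int)" "M < 2 ^ W"
  shows "\<exists>L. p \<le> L \<and> L < W \<and> 2 ^ L \<le> M \<and> M < 2 ^ (L + 1)"
proof -
  define L where "L = (GREATEST L. (2::int) ^ L \<le> M)"
  have b: "L < W" if "(2::int) ^ L \<le> M" for L
    by (rule power_less_imp_less_exp[of "2::int"], simp) (use assms(2) that in linarith)
  have L: "(2::int) ^ L \<le> M" unfolding L_def
    by (rule GreatestI_nat[of _ p W]) (use assms(1) b in \<open>auto intro: less_imp_le\<close>)
  have g: "L' \<le> L" if "(2::int) ^ L' \<le> M" for L' unfolding L_def
    by (rule Greatest_le_nat[of _ _ W]) (use that b in \<open>auto intro: less_imp_le\<close>)
  have "M < 2 ^ (L + 1)" using g[of "L + 1"] by (cases "2 ^ (L + 1) \<le> M") (simp_all only: not_le, simp)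
  then show ?thesis using L g[OF assms(1)] b by blast
qed

lemma bit_length_iff:
  assumes "0 \<le> (M::int)" "M < 2 ^ W" "L < W"
  shows "bit M L \<and> (\<forall>i<W. L < i \<longrightarrow> \<not> bit M i) \<longleftrightarrow> 2 ^ L \<le> M \<and> M < 2 ^ (L + 1)"
proof
  assume *: "bit M L \<and> (\<forall>i<W. L < i \<longrightarrow> \<not> bit M i)"
  have "bit M i = bit (take_bit (L + 1) M) i" for i
    using * bit_eq_sign[of M W i] assms by (cases "i < W") (auto simp: bit_take_bit_iff)
  then have "M = take_bit (L + 1) M" by (rule bit_eqI)
  then have u: "M < 2 ^ (L + 1)" by (metis take_bit_int_less_exp)
  moreover have "2 ^ L \<le> M"
    using * assms bit_eq_sign[of M L L] by (cases "M < 2 ^ L") auto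
  ultimately show "2 ^ L \<le> M \<and> M < 2 ^ (L + 1)" by simp
next
  assume *: "2 ^ L \<le> M \<and> M < 2 ^ (L + 1)"
  then have "\<not> bit M i" if "L < i" for i
    using bit_eq_sign[of M "L + 1" i] assms(1) that by auto
  moreover have "M div 2 ^ L = 1" using * by (intro int_div_pos_eq[of _ _ _ "M - 2 ^ L"]) auto
  then have "bit M L" by (simp add: bit_iff_odd)
  ultimately show "bit M L \<and> (\<forall>i<W. L < i \<longrightarrow> \<not> bit M i)" by auto
qed

text \<open>The common last step of all operations: a truncated magnitude, a sticky flag and a sign
  determine the rounding. The bound \<open>2 ^ p \<le> M a\<close> supplies the guard bit, so that
  magnitudes are only ever shifted to the right.\<close>

lemma tf_round:
  assumes M: "ti d W M" and t: "ti d w t" and st: "T d st" and sg: "T d sg" and W: "W \<le> Z 5" and w: "w \<le> Z 5"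
    and spec: "\<And>a. a \<in> D \<Longrightarrow> (M a = 0 \<and> x a = 0) \<or>
      (2 ^ p \<le> M a \<and> real_of_int (M a) * 2 powi t a \<le> \<bar>x a\<bar> \<and> \<bar>x a\<bar> < real_of_int (M a + 1) * 2 powi t a \<and>
       (st a \<longleftrightarrow> \<bar>x a\<bar> \<noteq> real_of_int (M a) * 2 powi t a) \<and> (sg a \<longleftrightarrow> x a < 0))"
  shows "tf (d + 200) (\<lambda>a. fp_round p (x a))"
proof -
  have W40: "W \<le> Z 40" using W by (rule Z_mono) simp
  have Mb: "T d (\<lambda>a. bit (M a) i)" for i using M by (simp add: ti_def)
  define L where "L a = (SOME L. p \<le> L \<and> L < W \<and> 2 ^ L \<le> M a \<and> M a < 2 ^ (L + 1))" for a
  have M0: "0 \<le> M a" "M a < 2 ^ W" if "a \<in> D" for a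
  proof -
    have "(0::int) \<le> 2 ^ p" by simp
    then show "0 \<le> M a" using spec[OF that] by linarith
    show "M a < 2 ^ W" using M that by (auto simp: ti_def)
  qed
  have L: "p \<le> L a" "L a < W" "2 ^ L a \<le> M a" "M a < 2 ^ (L a + 1)" if "a \<in> D" "M a \<noteq> 0" for a
    using someI_ex[OF bit_length_nat[of "M a" W]] spec[OF that(1)] that M0[OF that(1)] unfolding L_def by auto
  \<comment> \<open>\<open>k\<close> is the position of the leading bit. Formulas try all positions,
    of which exactly one fits when \<open>M a\<close> is nonzero.\<close>
  define cond where "cond k a \<longleftrightarrow> p \<le> k \<and> bit (M a) k \<and> (\<forall>i<W. k < i \<longrightarrow> \<not> bit (M a) i)" for k a
  have cond: "cond k a \<longleftrightarrow> M a \<noteq> 0 \<and> k = L a" if "k < W" "a \<in> D" for k a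
  proof
    assume "cond k a"
    then have k: "p \<le> k" "2 ^ k \<le> M a" "M a < 2 ^ (k + 1)"
      using bit_length_iff[OF M0[OF that(2)] that(1)] by (auto simp: cond_def)
    have "(0::int) < 2 ^ k" by simp
    with k have nz: "M a \<noteq> 0" by linarith
    note l = L[OF that(2) nz]
    have "(2::int) ^ k < 2 ^ (L a + 1)" "(2::int) ^ L a < 2 ^ (k + 1)" using k l by linarith+
    then have "k < L a + 1" "L a < k + 1" by (simp_all only: power_strict_increasing_iff[of "2::int"] one_less_numeral_iff semiring_norm)
    then show "M a \<noteq> 0 \<and> k = L a" using nz by simp
  next
    assume "M a \<noteq> 0 \<and> k = L a"
    then show "cond k a" using L[OF that(2)] bit_length_iff[OF M0[OF that(2)] that(1)] by (auto simp: cond_def)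
  qed
  have Tc: "T (d + 3) (cond k)" for k
    unfolding cond_def by (rule T_mono) (rule thr_and_const T_conj thr_all_less thr_implies_const thr_Not Mb W40 | simp)+
  \<comment> \<open>The value 0 is a default: for \<open>M a = 0\<close> there is no leading bit and
    \<open>L a\<close> is arbitrary.\<close>
  define N where "N a = (if M a = 0 then 0 else M a div 2 ^ (L a - p))" for a
  define t' where "t' a = t a + (if M a = 0 then 0 else int (L a - p))" for a
  define st' where "st' a \<longleftrightarrow> st a \<or> (M a \<noteq> 0 \<and> M a mod 2 ^ (L a - p) \<noteq> 0)" for a
  have tN: "ti (d + 5) (p + 1) N"
    unfolding ti_def
  proof (intro conjI ballI allI)
    fix a assume a: "a \<in> D"
    show "\<bar>N a\<bar> < 2 ^ (p + 1)"
    proof (cases "M a = 0")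
      case False
      note l = L[OF a False]
      have "M a div 2 ^ (L a - p) * 2 ^ (L a - p) \<le> M a"
      proof -
        have "0 \<le> M a mod 2 ^ (L a - p)" by simp
        then show ?thesis using div_mult_mod_eq[of "M a" "2 ^ (L a - p)"] by linarith
      qed
      also have "M a < 2 ^ (p + 1) * 2 ^ (L a - p)" proof -
        have "(p + 1) + (L a - p) = L a + 1" using l by simp
        then show ?thesis using l(4) by (simp only: power_add[symmetric])
      qed
      finally have "M a div 2 ^ (L a - p) < 2 ^ (p + 1)" by simp
      moreover have "0 \<le> M a div 2 ^ (L a - p)" using M0[OF a] by (simp add: pos_imp_zdiv_nonneg_iff)
      ultimately show ?thesis using False by (simp add: N_def)
    qed (simp add: N_def)
  next
    fix i
    have "T (d + 5) (\<lambda>a. \<exists>k<W. cond k a \<and> bit (M a) (i + (k - p)))"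
      by (rule T_mono) (rule thr_ex_less T_conj Tc Mb W40 | simp)+
    then show "T (d + 5) (\<lambda>a. bit (N a) i)"
    proof (rule thr_cong)
      fix a assume a: "a \<in> D"
      have "bit (M a div 2 ^ k) i = bit (M a) (i + k)" for k
        by (simp add: bit_iff_odd power_add zdiv_zmult2_eq[symmetric] mult.commute)
      then show "(\<exists>k<W. cond k a \<and> bit (M a) (i + (k - p))) = bit (N a) i"
        using a L(2)[OF a] cond[OF _ a] by (auto simp: N_def)
    qed
  qed
  have Ts: "T (d + 6) st'"
  proof (rule thr_cong)
    show "T (d + 6) (\<lambda>a. st a \<or> (\<exists>k<W. cond k a \<and> (\<exists>i<k - p. k < W \<and> bit (M a) i)))"
    proof (rule T_mono)
      have "k - p \<le> Z 40" if "k < W" for k using W40 that by simp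
      then show "T (Suc (max d (Suc (Suc (max (d + 3) (Suc d)))))) (\<lambda>a. st a \<or> (\<exists>k<W. cond k a \<and> (\<exists>i<k - p. k < W \<and> bit (M a) i)))"
        by (intro T_disj thr_ex_less T_conj Tc thr_and_const Mb W40 st) auto
    qed simp
    fix a assume a: "a \<in> D"
    then show "(st a \<or> (\<exists>k<W. cond k a \<and> (\<exists>i<k - p. k < W \<and> bit (M a) i))) = st' a"
      unfolding st'_def mod_pow_bits using L(2)[OF a] cond[OF _ a] by auto
  qed
  have tt: "ti (d + 19) (Suc (max w W)) t'"
  proof -
    have "tl (max d (d + 3)) (Suc w + W * 1) (\<lambda>a. t a + (\<Sum>k<W. int (k - p) * of_bool (cond k a)))"
      using t by (intro tl_add ti_tl tl_sum tl_scale tl_of_bool Tc) auto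
    then have "tl (d + 3) (Suc w + W) t'"
    proof (rule tl_mono[THEN tl_cong])
      fix a assume a: "a \<in> D"
      have "(\<Sum>k<W. int (k - p) * of_bool (cond k a)) = (\<Sum>k<W. if k = L a then (if M a = 0 then 0 else int (k - p)) else 0)"
        using cond[OF _ a] by (intro sum.cong) auto
      also have "\<dots> = (if M a = 0 then 0 else int (L a - p))"
        using L(2)[OF a] by (simp add: sum.delta)
      finally show "t a + (\<Sum>k<W. int (k - p) * of_bool (cond k a)) = t' a" by (simp add: t'_def)
    qed auto
    then have "ti (d + 3 + 16) (Suc (max w W)) t'"
    proof (rule tl_ti)
      show "Suc w + W \<le> Z 9" using Z_add[OF Z_Suc[OF w] W] by (rule_tac Z_mono) auto
      show "Suc (max w W) \<le> Z 9" using Z_Suc[of "max w W" 5] w W by (auto intro: Z_mono)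
      fix a assume a: "a \<in> D"
      have "L a < 2 ^ W" if "M a \<noteq> 0" using L(2)[OF a that] less_exp[of W] by linarith
      then have "int (L a - p) < 2 ^ W" if "M a \<noteq> 0"
        using that by (metis diff_le_self of_nat_less_iff of_nat_numeral of_nat_power order.strict_trans1)
      then have "\<bar>if M a = 0 then 0 else int (L a - p)\<bar> < 2 ^ W" by auto
      moreover have "\<bar>t a\<bar> < 2 ^ w" using t a by (auto simp: ti_def)
      ultimately show "\<bar>t' a\<bar> < 2 ^ Suc (max w W)" unfolding t'_def by (intro abs_less_pow_add)
    qed
    then show ?thesis by (simp add: add.commute)
  qed
  define Q where "Q a = (if M a = 0 then (0, 0) else round_guard p (N a) (t' a) (st' a))" for a
  have Q: "fp_round p \<bar>x a\<bar> = Q a" if a: "a \<in> D" for a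
  proof (cases "M a = 0")
    case True
    then show ?thesis using spec[OF a] by (auto simp: Q_def fp_round_zero)
  next
    case False
    show ?thesis
      using fp_round_bits[OF p1 L(1,3,4)[OF a False], of "t a" "\<bar>x a\<bar>" "st a"] spec[OF a] False
      by (simp add: Q_def N_def t'_def st'_def)
  qed
  have D': "{a\<in>D. M a \<noteq> 0} \<subseteq> D" by auto
  have Tz: "T (d + 2) (\<lambda>a. M a = 0)"
  proof (rule thr_cong)
    show "T (d + 2) (\<lambda>a. \<forall>i<W. \<not> bit (M a) i)"
      by (rule T_mono) (rule thr_all_less thr_Not Mb W40 | simp)+
    show "(\<forall>i<W. \<not> bit (M a) i) = (M a = 0)" if "a \<in> D" for a
      using mod_pow_bits[of "M a" W] M0[OF that] by auto
  qed
  have w6: "Suc (max w W) \<le> Z 6" using Z_Suc[of "max w W" 5] w W by (auto intro: Z_mono)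
  \<comment> \<open>Membership of the result in \<open>fp_set p\<close> is inferred from its being a
    rounding, which is known only where \<open>M a \<noteq> 0\<close>. So \<open>tf_guard\<close> is
    applied on this subdomain, and \<open>thr_restrict_conj\<close> extends the bits to
    \<open>D\<close>.\<close>
  interpret R: tcp "{a\<in>D. M a \<noteq> 0}" X z p
    by unfold_locales (rule p1, rule pz)
  have sub: "R.ti d w F" if "ti d w F" for d w F
    unfolding R.ti_def
  proof (intro conjI allI ballI)
    show "thr {a\<in>D. M a \<noteq> 0} X (Z 40) True d (\<lambda>a. bit (F a) i)" for i
      by (rule thr_subdomain[OF _ D']) (use that in \<open>simp add: ti_def\<close>)
  qed (use that in \<open>simp add: ti_def\<close>)
  have "R.tf (d + 19 + 90) (\<lambda>a. round_guard p (N a) (t' a) (st' a))"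
  proof (rule R.tf_guard[OF sub sub _ w6])
    show "ti (d + 19) (p + 1) N" by (rule ti_mono[OF tN]) auto
    show "thr {a \<in> D. M a \<noteq> 0} X (R.Z 40) True (d + 19) st'"
      by (rule thr_subdomain[OF T_mono[OF Ts]]) auto
    show "0 \<le> N a" if "a \<in> {a\<in>D. M a \<noteq> 0}" for a
      using that M0 by (auto simp: N_def pos_imp_zdiv_nonneg_iff)
    show "round_guard p (N a) (t' a) (st' a) \<in> fp_set p" if "a \<in> {a\<in>D. M a \<noteq> 0}" for a
      using that Q[of a] fp_round_in[of p "\<bar>x a\<bar>"] by (auto simp: Q_def)
  qed (rule tt)
  then have G: "thr {a\<in>D. M a \<noteq> 0} X (Z 40) True (d + 109) (\<lambda>a. bit (fst (round_guard p (N a) (t' a) (st' a))) i)"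
    "thr {a\<in>D. M a \<noteq> 0} X (Z 40) True (d + 109) (\<lambda>a. bit (snd (round_guard p (N a) (t' a) (st' a))) i)" for i
    by (auto simp: R.tf_def add.assoc)
  have ext: "T (d + 111) (\<lambda>a. M a \<noteq> 0 \<and> f a)" if "thr {a\<in>D. M a \<noteq> 0} X (Z 40) True (d + 109) f" for f
    using thr_restrict_conj[OF T_mono[OF thr_Not[OF Tz]] that two_le_s] by (simp add: add.commute)
  have bits: "T (d + 111) (\<lambda>a. bit (fst (Q a)) i)" "T (d + 111) (\<lambda>a. bit (snd (Q a)) i)" for i
    by (rule thr_cong[OF ext[OF G(1)[of i]]], simp add: Q_def) (rule thr_cong[OF ext[OF G(2)[of i]]], simp add: Q_def)
  have "tf (d + 111) Q"
    using bits Q fp_round_in by (auto simp: tf_def) metis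
  note tQ = tf_ti[OF this]
  have u: "ti (d + 111 + 16) p (\<lambda>a. - fst (Q a))"
    by (rule ti_uminus[OF tQ(1)]) (rule Z_mono[OF p_Z], simp)
  have "ti (max d (max (d + 127) (d + 111)) + 3) (max p p) (\<lambda>a. if sg a then - fst (Q a) else fst (Q a))"
    using u tQ(1) by (intro ti_if sg) (simp_all add: add.assoc)
  then have f: "ti (d + 200) p (\<lambda>a. if sg a then - fst (Q a) else fst (Q a))" by (rule ti_mono) auto
  have "tf (d + 200) (\<lambda>a. (if sg a then - fst (Q a) else fst (Q a), snd (Q a)))"
  proof (rule tfI)
    fix a assume a: "a \<in> D"
    have "Q a \<in> fp_set p" using Q[OF a] fp_round_in by metis
    then have "fp_uminus (Q a) \<in> fp_set p" by simp
    with \<open>Q a \<in> fp_set p\<close> show "(if sg a then - fst (Q a) else fst (Q a), snd (Q a)) \<in> fp_set p"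
      by (auto simp: fp_uminus_def)
  qed (use f ti_mono[OF tQ(2), of "d + 200"] in auto)
  then show ?thesis
  proof (rule tf_cong)
    fix a assume a: "a \<in> D"
    show "(if sg a then - fst (Q a) else fst (Q a), snd (Q a)) = fp_round p (x a)"
    proof (cases "M a = 0")
      case True
      then show ?thesis using Q[OF a] spec[OF a] by (auto simp: Q_def fp_round_zero)
    next
      case False
      then have sx: "sg a \<longleftrightarrow> x a < 0" using spec[OF a] by auto
      show ?thesis
      proof (cases "x a < 0")
        case True
        then have "fp_round p (x a) = fp_uminus (fp_round p \<bar>x a\<bar>)" using fp_round_uminus[of p "- x a"] by simp
        then show ?thesis using True sx Q[OF a] by (simp add: fp_uminus_def)
      qed (use sx Q[OF a] in simp)
    qed
  qed
qed

end

section \<open>Products and iterated sums\<close>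

context tcp
begin

lemma Z_bounds: "2 * p + z + 1 \<le> Z 2" "z \<le> Z 1" "1 \<le> Z 1" "4 * z * z + z + z + 20 \<le> Z 3" "z * z \<le> Z 2"
proof -
  have 16: "16 * z \<le> z * z" "16 * (z * z) \<le> z * (z * z)" using z16 by (intro mult_right_mono; simp)+
  have e: "Z 1 = z" "Z 2 = z * z" "Z 3 = z * (z * z)" by (simp_all add: Z_def power2_eq_square power3_eq_cube)
  show "2 * p + z + 1 \<le> Z 2" "z \<le> Z 1" "1 \<le> Z 1" "4 * z * z + z + z + 20 \<le> Z 3" "z * z \<le> Z 2"
    using 16 pz z16 unfolding e by linarith+
qed

lemma tf_mult:
  assumes F: "tf d F" and G: "tf d G"
  shows "tf (d + 300) (\<lambda>a. fp_mult p (F a) (G a))"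
proof -
  have p3: "p \<le> Z 3" "p + 1 \<le> Z 3" "p + p \<le> Z 3" "p + 1 \<le> Z 7" "p + p \<le> Z 7" "Suc (max (p + 1) (p + 1)) \<le> Z 7" "p + p \<le> Z 8"
  proof -
    have "2 * p + 2 \<le> Z 3" using Z_bounds(1) Z_bounds(4) pz z16 by linarith
    moreover have "Z 3 \<le> Z 7" "Z 3 \<le> Z 8" by (rule Z_mono[OF order_refl]; simp)+
    ultimately show "p \<le> Z 3" "p + 1 \<le> Z 3" "p + p \<le> Z 3" "p + 1 \<le> Z 7" "p + p \<le> Z 7" "Suc (max (p + 1) (p + 1)) \<le> Z 7" "p + p \<le> Z 8" by auto
  qed
  define m e where "m a = fst (F a) * fst (G a)" and "e a = snd (F a) + snd (G a)" for a
  note f = tf_ti[OF F] and g = tf_ti[OF G]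
  have tm: "ti (d + 17) (p + p) m" using ti_mult[OF f(1) g(1) p3(1,1)] by (simp add: m_def[abs_def])
  have te: "ti (d + 16) (Suc (p + 1)) e"
    using ti_add[OF f(2) g(2) p3(4,4)] by (simp add: e_def[abs_def])
  have ta: "ti (d + 17 + 19) (p + p) (\<lambda>a. \<bar>m a\<bar>)" by (rule ti_abs[OF tm p3(7)])
  have k: "ti 0 (p + 1) (\<lambda>_. 2 ^ p)" "ti 0 (p + 1) (\<lambda>_. int p)"
  proof -
    have "int p < 2 ^ (p + 1)"
      unfolding of_nat_less_numeral_power_cancel_iff using less_exp[of "p + 1"] by linarith
    then show "ti 0 (p + 1) (\<lambda>_. 2 ^ p)" "ti 0 (p + 1) (\<lambda>_. int p)"
      by (intro ti_const; simp)+
  qed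
  \<comment> \<open>The factor \<open>2 ^ p\<close>, balanced by the exponent, lifts every nonzero
    magnitude to at least \<open>2 ^ p\<close>. The product is exact, so the sticky flag will be
    \<open>False\<close>.\<close>
  have tM: "ti (d + 60) (p + p + (p + 1)) (\<lambda>a. \<bar>m a\<bar> * 2 ^ p)"
    by (rule ti_mono[OF ti_mult[OF ta k(1) p3(3,2)]]) auto
  have tt: "ti (d + 60) (Suc (max (Suc (p + 1)) (p + 1))) (\<lambda>a. e a - int p)"
    by (rule ti_mono[OF ti_diff[OF te k(2)]]) (use p3 in auto)
  have "tf (d + 60 + 200) (\<lambda>a. fp_round p (fp_val (F a) * fp_val (G a)))"
  proof (rule tf_round[OF tM tt thr_const[of _ _ _ _ _ False] T_mono[OF T_neg[OF tm]]])
    have "Z 3 \<le> Z 4" by (rule Z_mono[OF order_refl]) simp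
    moreover have "p + p + (p + 1) \<le> Z 5"
      using Z_add[OF p3(3) p3(2)] by (rule Z_mono) simp
    ultimately show "p + p + (p + 1) \<le> Z 5" by simp
    have "Suc (max (Suc (p + 1)) (p + 1)) \<le> 2 * p + z + 1" using z16 by simp
    also note Z_bounds(1)
    finally show "Suc (max (Suc (p + 1)) (p + 1)) \<le> Z 5" by (rule Z_mono) simp
    fix a assume "a \<in> D"
    define u :: real where "u = 2 powi (e a - int p)"
    have u: "0 < u" by (simp add: u_def)
    have "2 powi e a = 2 ^ p * u" by (simp add: u_def power_int_diff)
    then have x: "fp_val (F a) * fp_val (G a) = real_of_int (m a) * (2 ^ p * u)"
      by (simp add: fp_val_def m_def e_def power_int_add)
    have ax: "\<bar>fp_val (F a) * fp_val (G a)\<bar> = real_of_int (\<bar>m a\<bar> * 2 ^ p) * u"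
      unfolding x using u by (simp add: abs_mult)
    have "1 * 2 ^ p \<le> \<bar>m a\<bar> * 2 ^ p" if "m a \<noteq> 0" using that by (intro mult_right_mono) auto
    moreover have "real_of_int (\<bar>m a\<bar> * 2 ^ p) * u < real_of_int (\<bar>m a\<bar> * 2 ^ p + 1) * u"
      using u by (intro mult_strict_right_mono) auto
    moreover have "m a < 0 \<longleftrightarrow> fp_val (F a) * fp_val (G a) < 0"
      unfolding x using u by (simp add: mult_less_0_iff)
    ultimately show "(\<bar>m a\<bar> * 2 ^ p = 0 \<and> fp_val (F a) * fp_val (G a) = 0) \<or>
      (2 ^ p \<le> \<bar>m a\<bar> * 2 ^ p \<and> real_of_int (\<bar>m a\<bar> * 2 ^ p) * 2 powi (e a - int p) \<le> \<bar>fp_val (F a) * fp_val (G a)\<bar> \<and>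
       \<bar>fp_val (F a) * fp_val (G a)\<bar> < real_of_int (\<bar>m a\<bar> * 2 ^ p + 1) * 2 powi (e a - int p) \<and>
       (False \<longleftrightarrow> \<bar>fp_val (F a) * fp_val (G a)\<bar> \<noteq> real_of_int (\<bar>m a\<bar> * 2 ^ p) * 2 powi (e a - int p)) \<and>
       (m a < 0 \<longleftrightarrow> fp_val (F a) * fp_val (G a) < 0))"
      unfolding u_def[symmetric] ax by (cases "m a = 0") (auto simp: x)
  qed auto
  then show ?thesis unfolding fp_mult_def by (rule tf_mono) simp
qed

end

text \<open>The tail \<open>r\<close> is smaller than one unit \<open>v\<close>, so only its sign
  matters: a tail of the opposite sign borrows one unit, and any nonzero tail sets the sticky flag.
  With \<open>Suc p\<close> additional bits, not just \<open>p\<close>, the magnitude is still at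
  least \<open>2 ^ p\<close> after the borrow.\<close>

lemma sticky_sum:
  fixes X :: int and u r :: real
  assumes X: "X \<noteq> 0" and u: "0 < u" and r: "\<bar>r\<bar> * 2 ^ Suc p < u"
  defines "M \<equiv> \<bar>X\<bar> * 2 ^ Suc p - of_bool ((r < 0 \<and> 0 < X) \<or> (0 < r \<and> X < 0))"
    and "S \<equiv> real_of_int X * u + r" and "v \<equiv> u / 2 ^ Suc p"
  shows "2 ^ p \<le> M" "real_of_int M * v \<le> \<bar>S\<bar>" "\<bar>S\<bar> < real_of_int (M + 1) * v"
    "r \<noteq> 0 \<longleftrightarrow> \<bar>S\<bar> \<noteq> real_of_int M * v" "X < 0 \<longleftrightarrow> S < 0"
proof -
  have v: "0 < v" "u = 2 ^ Suc p * v" using u by (simp_all add: v_def)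
  have "\<bar>r\<bar> * 2 ^ Suc p < v * 2 ^ Suc p" using r v by (simp add: mult.commute)
  then have rv: "\<bar>r\<bar> < v" by simp
  have "1 * v \<le> 2 ^ Suc p * v" using v by (intro mult_right_mono one_le_power) auto
  then have vu: "v \<le> u" using v by simp
  have "1 * u \<le> real_of_int \<bar>X\<bar> * u" using X u by (intro mult_right_mono) auto
  then have Xu: "u \<le> real_of_int \<bar>X\<bar> * u" by simp
  have "1 * 2 ^ Suc p \<le> \<bar>X\<bar> * 2 ^ Suc p" using X by (intro mult_right_mono) auto
  moreover have "(1::int) \<le> 2 ^ p" by simp
  moreover have "of_bool ((r < 0 \<and> 0 < X) \<or> (0 < r \<and> X < 0)) \<le> (1::int)" by simp
  ultimately show "2 ^ p \<le> M" unfolding M_def power_Suc by linarith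
  have Sv: "\<bar>S\<bar> = real_of_int \<bar>X\<bar> * u + (if X < 0 then - r else r)" "X < 0 \<longleftrightarrow> S < 0"
  proof -
    define y where "y = real_of_int \<bar>X\<bar> * u"
    have "real_of_int X * u = (if X < 0 then - y else y)" by (simp add: y_def)
    then show "\<bar>S\<bar> = real_of_int \<bar>X\<bar> * u + (if X < 0 then - r else r)" "X < 0 \<longleftrightarrow> S < 0"
      using Xu rv vu v(1) unfolding S_def y_def[symmetric] by (simp_all split: if_splits)
  qed
  have Mv: "real_of_int M * v = real_of_int \<bar>X\<bar> * u - of_bool ((r < 0 \<and> 0 < X) \<or> (0 < r \<and> X < 0)) * v"
    by (simp add: M_def v(2) algebra_simps)
  have Mv1: "real_of_int (M + 1) * v = real_of_int M * v + v" by (simp add: algebra_simps)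
  show "real_of_int M * v \<le> \<bar>S\<bar>" "\<bar>S\<bar> < real_of_int (M + 1) * v" "r \<noteq> 0 \<longleftrightarrow> \<bar>S\<bar> \<noteq> real_of_int M * v" "X < 0 \<longleftrightarrow> S < 0"
    unfolding Mv1 Mv Sv(1) using Sv(2) rv X by (auto simp: abs_if split: if_splits)
qed

text \<open>\<open>sec b\<close> says that \<open>b\<close> is the bottom of the highest nonzero
  cluster below \<open>v\<close>; the sign of that cluster is the sign of the whole tail.\<close>

lemma (in clusters) rest_sgn:
  assumes "finite I" "bottom I v" "\<And>k. k \<in> I \<Longrightarrow> \<bar>m k\<bar> < 2 ^ p" "card I \<le> K" "G = int (p + q + K)"
  defines "sec \<equiv> \<lambda>b. bottom I b \<and> e b < e v \<and> csum I b \<noteq> 0 \<and> (\<forall>c\<in>I. bottom I c \<and> e b < e c \<and> e c < e v \<longrightarrow> csum I c = 0)"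
  defines "r \<equiv> \<Sum>k | k \<in> I \<and> e k < e v. val k"
  shows "0 < r \<longleftrightarrow> (\<exists>b\<in>I. sec b \<and> 0 < csum I b)" "r < 0 \<longleftrightarrow> (\<exists>b\<in>I. sec b \<and> csum I b < 0)"
proof -
  let ?J = "{k\<in>I. e k < e v}"
  have fin: "finite ?J" and J: "\<And>k. k \<in> ?J \<Longrightarrow> \<bar>m k\<bar> < 2 ^ p" "card ?J \<le> K"
    using assms(1,3,4) card_mono[of I ?J] by auto
  have top: "top ?J b \<longleftrightarrow> sec b" for b unfolding sec_def by (rule top_below[OF assms(2)])
  have sg: "sgn r = real_of_int (sgn (csum I b))" if "sec b" for b
  proof -
    have "sgn (\<Sum>k\<in>?J. val k) = real_of_int (sgn (csum ?J b))"
      using top_sgn[OF fin _ J assms(5)] that top by blast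
    then show ?thesis using csum_below[OF assms(2), of b] that by (simp add: sec_def r_def)
  qed
  have ex: "\<exists>b\<in>I. sec b" if "r \<noteq> 0"
  proof -
    obtain c where c: "c \<in> ?J" "bottom ?J c" "csum ?J c \<noteq> 0"
    proof (rule ccontr)
      assume "\<not> thesis"
      then have "sum val ?J = 0" using that by (intro sum_zero[OF fin]) blast
      then show False using \<open>r \<noteq> 0\<close> by (simp add: r_def)
    qed
    from ex_top[OF fin c] show ?thesis using top by auto
  qed
  show "0 < r \<longleftrightarrow> (\<exists>b\<in>I. sec b \<and> 0 < csum I b)" "r < 0 \<longleftrightarrow> (\<exists>b\<in>I. sec b \<and> csum I b < 0)"
    using ex sg by (fastforce simp: sgn_if split: if_splits)+
qed

context tcp
begin

lemma tf_sum:
  assumes F: "\<And>k. k < K \<Longrightarrow> tf d (F k)" and K: "K \<le> z"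
  shows "tf (d + 500) (\<lambda>a. fp_round p (\<Sum>k<K. fp_val (F k a)))"
proof -
  \<comment> \<open>The gap for \<open>q = p + 1\<close>, the number of places that
    \<open>sticky_sum\<close> asks for. By \<open>clus_span\<close>, every exponent offset inside a
    cluster is less than \<open>\<Delta>\<close>.\<close>
  define g where "g = p + (p + 1) + K"
  define \<Delta> where "\<Delta> = Suc (g * K)"
  define m e where "m k a = fst (F k a)" and "e k a = snd (F k a)" for k a
  have K40: "K \<le> Z 40" by (rule Z_mono[of K 1]) (use K Z_bounds in auto)
  have gz: "g \<le> 4 * z" using pz K z16 by (simp add: g_def)
  have "g * K \<le> 4 * z * z" using gz K by (rule mult_le_mono)
  then have \<Delta>3: "\<Delta> + 1 \<le> Z 3" using Z_bounds(4) by (simp add: \<Delta>_def)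
  have w7: "p + 1 \<le> Z 7" "Suc (p + 1) \<le> Z 7" "Suc (max (p + 1) (p + 1)) \<le> Z 7" "Suc (max (p + 1) g) \<le> Z 7" "g \<le> Z 7" "\<Delta> \<le> Z 7"
    "Suc (max (p + 1) (p + 2)) \<le> Z 7" "p + 2 \<le> Z 7"
  proof -
    have "Z 3 \<le> Z 7" by (rule Z_mono[OF order_refl]) simp
    moreover have "4 * z \<le> 4 * z * z" using z16 by simp
    then have "4 * z + 4 \<le> Z 3" using Z_bounds(4) by linarith
    ultimately show "p + 1 \<le> Z 7" "Suc (p + 1) \<le> Z 7" "Suc (max (p + 1) (p + 1)) \<le> Z 7" "Suc (max (p + 1) g) \<le> Z 7" "g \<le> Z 7" "\<Delta> \<le> Z 7"
      "Suc (max (p + 1) (p + 2)) \<le> Z 7" "p + 2 \<le> Z 7"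
      using gz pz z16 \<Delta>3 by auto
  qed
  have tm: "ti d p (m k)" and te: "ti d (p + 1) (e k)" if "k < K" for k
    using tf_ti[OF F[OF that]] by (auto simp: m_def[abs_def] e_def[abs_def])
  have cl: "clusters (int g)" by unfold_locales simp
  define bot where "bot b a = clusters.bottom (\<lambda>k. e k a) (int g) {..<K} b" for b a
  define incl where "incl b k a \<longleftrightarrow> k \<in> clusters.clus (\<lambda>k. e k a) (int g) {..<K} b" for b k a
  \<comment> \<open>The shift by a variable offset is a sum over all
    \<open>\<delta> < \<Delta>\<close> with the test for this offset as a factor. In this way the
    cluster sum stays a linear form.\<close>
  define X where "X b a = (\<Sum>k<K. \<Sum>\<delta><\<Delta>. 2 ^ \<delta> * (of_bool (incl b k a \<and> e k a - e b a = int \<delta>) * m k a))" for b a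
  have lt: "T (d + 16) (\<lambda>a. e j a < e k a)" if "j < K" "k < K" for j k
    using T_less[OF te[OF that(1)] te[OF that(2)] w7(1,1)] by simp
  have le: "T (d + 17) (\<lambda>a. e j a \<le> e k a)" if "j < K" "k < K" for j k
    using T_le[OF te[OF that(1)] te[OF that(2)] w7(1,1)] by simp
  have near: "T (d + 33) (\<lambda>a. e b a - int g \<le> e j a)" if "b < K" "j < K" for b j
  proof -
    have "ti 0 g (\<lambda>_. int g)" using less_exp[of g] by (intro ti_const) (simp add: of_nat_less_numeral_power_cancel_iff)
    from T_le[OF ti_diff[OF te[OF that(1)] this w7(1,5)] te[OF that(2)] w7(4,1)]
    show ?thesis by (simp add: add.commute)
  qed
  have Tbot: "T (d + 36) (bot b)" if "b < K" for b
  proof (rule thr_cong)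
    show "T (d + 36) (\<lambda>a. \<forall>j<K. \<not> (e b a - int g \<le> e j a \<and> e j a < e b a))"
      by (rule T_mono) (rule thr_all_less thr_Not T_conj near lt K40 that | assumption | simp)+
  qed (use that in \<open>auto simp: bot_def clusters.bottom_def[OF cl]\<close>)
  have Tincl: "T (d + 41) (incl b k)" if "b < K" "k < K" for b k
  proof (rule thr_cong)
    show "T (d + 41) (\<lambda>a. e b a \<le> e k a \<and> \<not> (\<exists>c<K. bot c a \<and> e b a < e c a \<and> e c a \<le> e k a))"
      by (rule T_mono) (rule thr_ex_less thr_Not T_conj le lt Tbot K40 that | assumption | simp)+
  qed (use that in \<open>auto simp: incl_def clusters.clus_def[OF cl] bot_def\<close>)
  have Teq: "T (d + 34) (\<lambda>a. e k a - e b a = int \<delta>)" if "k < K" "b < K" "\<delta> < \<Delta>" for k b \<delta>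
  proof -
    have "ti 0 \<Delta> (\<lambda>_. int \<delta>)" using less_trans[OF that(3) less_exp] by (intro ti_const) (simp add: of_nat_less_numeral_power_cancel_iff)
    from T_eq[OF ti_diff[OF te[OF that(1)] te[OF that(2)] w7(1,1)] this w7(3,6)]
    show ?thesis by (simp add: add.commute)
  qed
  \<comment> \<open>There are \<open>K * \<Delta>\<close> terms, each at most
    \<open>2 ^ (\<Delta> + p)\<close> in magnitude, and
    \<open>K * \<Delta> < 2 ^ (K + \<Delta>)\<close>.\<close>
  define w where "w = K + 2 * \<Delta> + p"
  have w5: "w + 4 \<le> Z 4" "w + 1 \<le> Z 7" "w + 1 \<le> Z 8"
  proof -
    have "w + 4 \<le> 16 * Z 3" using K pz \<Delta>3 Z_bounds(4) by (simp add: w_def)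
    also have "\<dots> \<le> Z 4" using mult_right_mono[OF z16, of "z ^ 3"] power_Suc[of z 3] by (simp add: Z_def)
    finally show w: "w + 4 \<le> Z 4" .
    have "w + 1 \<le> Z 4" using w by simp
    then show "w + 1 \<le> Z 7" "w + 1 \<le> Z 8" by (auto intro: Z_mono)
  qed
  have tX: "ti (d + 60) w (X b)" if b: "b < K" for b
  proof -
    have 1: "tl (d + 43) (1 * Suc p) (\<lambda>a. of_bool (incl b k a \<and> e k a - e b a = int \<delta>) * m k a)" if "k < K" "\<delta> < \<Delta>" for k \<delta>
    proof (rule tl_mono[OF tl_mult[OF tl_of_bool ti_tl[OF tm[OF that(1)]]]])
      show "T (d + 42) (\<lambda>a. incl b k a \<and> e k a - e b a = int \<delta>)"
        by (rule T_mono) (rule T_conj Tincl Teq that b | simp)+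
    qed auto
    have "tl (d + 43) (K * (\<Delta> * (1 * Suc p))) (X b)"
      unfolding X_def by (intro tl_sum tl_scale 1)
    then have "ti (d + 43 + 16) w (X b)"
    proof (rule tl_ti)
      have "K * (\<Delta> * (1 * Suc p)) \<le> Z (1 + (3 + (1 + 2)))"
        by (intro Z_mult) (use K \<Delta>3 Z_bounds pz z16 in auto)
      then show "K * (\<Delta> * (1 * Suc p)) \<le> Z 9" by (rule Z_mono) simp
      show "w \<le> Z 9" using w5(2) by (rule_tac Z_mono[of w 7]) auto
      fix a assume a: "a \<in> D"
      have "\<bar>X b a\<bar> \<le> (\<Sum>k<K. \<Sum>\<delta><\<Delta>. 2 ^ \<Delta> * 2 ^ p)"
        unfolding X_def
      proof (intro order_trans[OF sum_abs] sum_mono)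
        fix k \<delta> assume k: "k \<in> {..<K}" and \<delta>: "\<delta> \<in> {..<\<Delta>}"
        have "\<bar>m k a\<bar> < 2 ^ p" using tm[of k] k a by (auto simp: ti_def)
        moreover have "(2::int) ^ \<delta> \<le> 2 ^ \<Delta>" using \<delta> by (intro power_increasing) auto
        ultimately show "\<bar>2 ^ \<delta> * (of_bool (incl b k a \<and> e k a - e b a = int \<delta>) * m k a)\<bar> \<le> 2 ^ \<Delta> * 2 ^ p"
          unfolding abs_mult by (intro mult_mono) (auto simp: of_bool_def)
      qed
      also have "\<dots> = int (K * \<Delta>) * (2 ^ \<Delta> * 2 ^ p)" by simp
      also have "\<dots> < 2 ^ (K + \<Delta>) * (2 ^ \<Delta> * 2 ^ p)"
      proof (rule mult_strict_right_mono)
        have "K * \<Delta> < 2 ^ K * 2 ^ \<Delta>" using less_exp[of K] less_exp[of \<Delta>] by (intro mult_strict_mono) (auto simp: \<Delta>_def)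
        then have "int (K * \<Delta>) < int (2 ^ K * 2 ^ \<Delta>)" by (simp only: of_nat_less_iff)
        then show "int (K * \<Delta>) < 2 ^ (K + \<Delta>)" by (simp add: power_add)
      qed simp
      also have "\<dots> = 2 ^ w" unfolding w_def mult_2 power_add by (simp add: mult_ac)
      finally show "\<bar>X b a\<bar> < 2 ^ w" .
    qed
    then show ?thesis by (rule ti_mono) auto
  qed
  have m_bnd: "\<bar>m k a\<bar> < 2 ^ p" if "k < K" "a \<in> D" for k a using tm[OF that(1)] that(2) by (auto simp: ti_def)
  have Xcsum: "X b a = clusters.csum (\<lambda>k. e k a) (\<lambda>k. m k a) (int g) {..<K} b" if "bot b a" for b a
  proof -
    interpret clusters "\<lambda>k. e k a" "\<lambda>k. m k a" "int g" by (rule cl)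
    have "(\<Sum>\<delta><\<Delta>. 2 ^ \<delta> * (of_bool (incl b k a \<and> e k a - e b a = int \<delta>) * m k a)) =
        of_bool (incl b k a) * (m k a * 2 ^ nat (e k a - e b a))" for k
    proof (cases "incl b k a")
      case True
      then have "e k a - e b a \<le> int g * int K" using clus_span[of "{..<K}" b k] that by (simp add: bot_def incl_def)
      moreover have "e b a \<le> e k a" using True by (auto simp: incl_def clus_def)
      ultimately have n: "nat (e k a - e b a) < \<Delta>" by (simp add: \<Delta>_def nat_less_iff)
      have "(\<Sum>\<delta><\<Delta>. 2 ^ \<delta> * (of_bool (incl b k a \<and> e k a - e b a = int \<delta>) * m k a)) =
          (\<Sum>\<delta><\<Delta>. if \<delta> = nat (e k a - e b a) then 2 ^ \<delta> * m k a else 0)"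
        using True \<open>e b a \<le> e k a\<close> by (intro sum.cong) auto
      then show ?thesis using n True by (simp add: sum.delta)
    qed simp
    then have "X b a = (\<Sum>k<K. of_bool (incl b k a) * (m k a * 2 ^ nat (e k a - e b a)))"
      unfolding X_def by (intro sum.cong) auto
    also have "\<dots> = (\<Sum>k\<in>{k\<in>{..<K}. incl b k a}. m k a * 2 ^ nat (e k a - e b a))"
      by (intro sum.mono_neutral_cong_right) auto
    also have "{k\<in>{..<K}. incl b k a} = clus {..<K} b" by (auto simp: incl_def clus_def)
    finally show ?thesis by (simp add: csum_def)
  qed
  have Xneg: "T (d + 60) (\<lambda>a. X b a < 0)" if "b < K" for b by (rule T_neg[OF tX[OF that]])
  have Xpos: "T (d + 76) (\<lambda>a. 0 < X b a)" if "b < K" for b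
    using T_neg[OF ti_uminus[OF tX[OF that]]] w5 by (simp add: add.commute)
  have Xnz: "T (d + 77) (\<lambda>a. X b a \<noteq> 0)" if "b < K" for b
    by (rule thr_cong[OF T_mono[OF T_disj[OF Xneg[OF that] Xpos[OF that]]]]) auto
  define tp where "tp v a \<longleftrightarrow> bot v a \<and> X v a \<noteq> 0 \<and> (\<forall>c<K. bot c a \<and> e v a < e c a \<longrightarrow> \<not> X c a \<noteq> 0)" for v a
  define sec where "sec v b a \<longleftrightarrow> bot b a \<and> e b a < e v a \<and> X b a \<noteq> 0 \<and>
      (\<forall>c<K. bot c a \<and> e b a < e c a \<and> e c a < e v a \<longrightarrow> \<not> X c a \<noteq> 0)" for v b a
  \<comment> \<open>Bottoms with equal exponents share a cluster, so several indices can satisfy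
    \<open>tp\<close>; the least one is selected.\<close>
  define fst_tp where "fst_tp v a \<longleftrightarrow> tp v a \<and> (\<forall>u<K. u < v \<longrightarrow> \<not> tp u a)" for v a
  have Ttp: "T (d + 83) (tp v)" if "v < K" for v
  proof (rule thr_cong)
    show "T (d + 83) (\<lambda>a. bot v a \<and> X v a \<noteq> 0 \<and> (\<forall>c<K. \<not> (bot c a \<and> e v a < e c a \<and> X c a \<noteq> 0)))"
      by (rule T_mono) (rule thr_all_less thr_Not T_conj lt Tbot Xnz K40 that | assumption | simp)+
  qed (auto simp: tp_def)
  have Tsec: "T (d + 85) (sec v b)" if "v < K" "b < K" for v b
  proof (rule thr_cong)
    show "T (d + 85) (\<lambda>a. bot b a \<and> e b a < e v a \<and> X b a \<noteq> 0 \<and>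
       (\<forall>c<K. \<not> (bot c a \<and> e b a < e c a \<and> e c a < e v a \<and> X c a \<noteq> 0)))"
      by (rule T_mono) (rule thr_all_less thr_Not T_conj lt Tbot Xnz K40 that | assumption | simp)+
  qed (auto simp: sec_def)
  have Tf: "T (d + 86) (fst_tp v)" if "v < K" for v
    unfolding fst_tp_def by (rule T_mono) (rule thr_all_less thr_implies_const thr_Not T_conj Ttp K40 that | assumption | simp)+
  define V where "V a = (LEAST v. tp v a)" for a
  define ne where "ne a \<longleftrightarrow> (\<exists>v<K. tp v a)" for a
  have tpK: "v < K" if "tp v a" for v a using that by (auto simp: tp_def bot_def clusters.bottom_def[OF cl])
  have V: "tp (V a) a" "V a < K" if "ne a" for a
    using that LeastI_ex[of "\<lambda>v. tp v a"] tpK by (auto simp: ne_def V_def)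
  have fst_tp: "fst_tp v a \<longleftrightarrow> ne a \<and> v = V a" for v a
  proof
    assume f: "fst_tp v a"
    then have t: "tp v a" by (simp add: fst_tp_def)
    then have n: "ne a" using tpK by (auto simp: ne_def)
    moreover have "V a \<le> v" unfolding V_def using t by (rule Least_le)
    ultimately show "ne a \<and> v = V a" using f V[OF n] by (auto simp: fst_tp_def le_less)
  next
    assume v: "ne a \<and> v = V a"
    have "\<not> tp u a" if "u < V a" for u
      using that unfolding V_def by (rule not_less_Least)
    then show "fst_tp v a" using V(1)[of a] v unfolding fst_tp_def by blast
  qed
  have sel: "T (d + 88) (\<lambda>a. ne a \<and> f (V a) a)" if "\<And>v. v < K \<Longrightarrow> T (d + 86) (f v)" for f
  proof (rule thr_cong)
    show "T (d + 88) (\<lambda>a. \<exists>v<K. fst_tp v a \<and> f v a)"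
      by (rule T_mono) (rule thr_ex_less T_conj Tf that K40 | assumption | simp)+
  qed (use V in \<open>auto simp: fst_tp\<close>)
  \<comment> \<open>If all clusters vanish, the default 0 yields \<open>M a = 0\<close>, the case
    that \<open>tf_round\<close> reserves for the sum 0.\<close>
  define X0 e0 where "X0 a = (if ne a then X (V a) a else 0)" and "e0 a = (if ne a then e (V a) a else 0)" for a
  have seli: "ti (d + 88) w' (\<lambda>a. if ne a then F (V a) a else 0)" if "\<And>v. v < K \<Longrightarrow> ti (d + 60) w' (F v)" for F w'
    unfolding ti_def
  proof (intro conjI ballI allI)
    fix a assume "a \<in> D"
    then show "\<bar>if ne a then F (V a) a else 0\<bar> < 2 ^ w'" using that V by (auto simp: ti_def)
  next
    fix i
    have "T (d + 88) (\<lambda>a. ne a \<and> bit (F (V a) a) i)"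
      by (rule sel[of "\<lambda>v a. bit (F v a) i"], rule T_mono[where d = "d + 60"]) (use that in \<open>auto simp: ti_def\<close>)
    then show "T (d + 88) (\<lambda>a. bit (if ne a then F (V a) a else 0) i)" by (rule thr_cong) auto
  qed
  have tX0: "ti (d + 88) w X0" unfolding X0_def by (rule seli) (rule tX)
  have te0: "ti (d + 88) (p + 1) e0" unfolding e0_def by (rule seli) (rule ti_mono[OF te], auto)
  define rp rn where "rp a \<longleftrightarrow> ne a \<and> (\<exists>b<K. sec (V a) b a \<and> 0 < X b a)"
    and "rn a \<longleftrightarrow> ne a \<and> (\<exists>b<K. sec (V a) b a \<and> X b a < 0)" for a
  have T_sel': "T (d + 91) (\<lambda>a. ne a \<and> (\<exists>b<K. sec (V a) b a \<and> h b a))" if "\<And>b. b < K \<Longrightarrow> T (d + 76) (h b)" for h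
  proof (rule thr_cong)
    show "T (d + 91) (\<lambda>a. \<exists>v<K. fst_tp v a \<and> (\<exists>b<K. sec v b a \<and> h b a))"
      by (rule T_mono) (rule thr_ex_less T_conj Tf Tsec that K40 | assumption | simp)+
  qed (use V in \<open>auto simp: fst_tp\<close>)
  have Trp: "T (d + 91) rp" "T (d + 91) rn"
    unfolding rp_def rn_def by (rule T_sel', rule Xpos, simp) (rule T_sel', rule T_mono[OF Xneg], auto)
  have X0n: "T (d + 88) (\<lambda>a. X0 a < 0)" "T (d + 104) (\<lambda>a. 0 < X0 a)"
    using T_neg[OF tX0] T_neg[OF ti_uminus[OF tX0]] w5 by (simp_all add: add.commute)
  \<comment> \<open>The borrow in \<open>sticky_sum\<close>: tail and top cluster have opposite
    signs.\<close>
  define br where "br a \<longleftrightarrow> (rn a \<and> 0 < X0 a) \<or> (rp a \<and> X0 a < 0)" for a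
  have Tbr: "T (d + 106) br"
    unfolding br_def by (rule T_mono) (rule T_disj T_conj Trp X0n | simp)+
  have Tst: "T (d + 150) (\<lambda>a. rp a \<or> rn a)" by (rule T_mono) (rule T_disj Trp | simp)+
  define M where "M a = \<bar>X0 a\<bar> * 2 ^ Suc p - of_bool (br a)" for a
  have k: "ti 0 (Suc (Suc p)) (\<lambda>_. 2 ^ Suc p)" "ti 0 (p + 2) (\<lambda>_. int (Suc p))"
  proof -
    have "int (Suc p) < 2 ^ (p + 2)"
      unfolding of_nat_less_numeral_power_cancel_iff using less_exp[of "p + 2"] by linarith
    then show "ti 0 (Suc (Suc p)) (\<lambda>_. 2 ^ Suc p)" "ti 0 (p + 2) (\<lambda>_. int (Suc p))"
      by (intro ti_const; simp)+
  qed
  have wZ: "w \<le> Z 8" "w \<le> Z 7" using w5 by auto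
  have tM0: "tl (d + 107) (Suc w) (\<lambda>a. 2 ^ Suc p * \<bar>X0 a\<bar>)"
    using tl_scale[OF ti_tl[OF ti_abs[OF tX0 wZ(1)]]] by (rule tl_mono) auto
  have "tl (max (d + 107) (d + 106)) (Suc w + 1) (\<lambda>a. 2 ^ Suc p * \<bar>X0 a\<bar> - of_bool (br a))"
    by (intro tl_diff tM0 tl_of_bool Tbr)
  then have "tl (d + 107) (Suc w + 1) M" by (rule tl_mono[THEN tl_cong]) (auto simp: M_def)
  then have tM: "ti (d + 107 + 16) (w + p + 2) M"
  proof (rule tl_ti)
    have z4: "w + p + 2 \<le> Z 5" using Z_add[OF w5(1) p_Z] by (auto intro: order_trans)
    show "Suc w + 1 \<le> Z 9" using w5(1) by (rule_tac Z_mono[of _ 4]) auto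
    show "w + p + 2 \<le> Z 9" using z4 by (rule Z_mono) simp
    fix a assume a: "a \<in> D"
    have "\<bar>X0 a\<bar> < 2 ^ w" using tX0 a by (auto simp: ti_def)
    then have "\<bar>X0 a\<bar> * 2 ^ Suc p < 2 ^ w * 2 ^ Suc p" by (intro mult_strict_right_mono) auto
    moreover have "0 \<le> \<bar>X0 a\<bar> * 2 ^ Suc p" by simp
    moreover have "(1::int) \<le> 2 ^ (w + Suc p)" by (rule one_le_power) simp
    then have "(2::int) ^ (w + p + 2) = 2 * (2 ^ w * 2 ^ Suc p)" "(1::int) \<le> 2 ^ w * 2 ^ Suc p"
      by (simp_all add: power_add)
    ultimately show "\<bar>M a\<bar> < 2 ^ (w + p + 2)" unfolding M_def by (simp only: of_bool_def abs_less_iff split: if_splits) linarith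
  qed
  have tt: "ti (d + 104) (Suc (max (p + 1) (p + 2))) (\<lambda>a. e0 a - int (Suc p))"
    by (rule ti_mono[OF ti_diff[OF te0 k(2)]]) (use w7 in auto)
  have "tf (d + 150 + 200) (\<lambda>a. fp_round p (\<Sum>k<K. fp_val (F k a)))"
  proof (rule tf_round[OF ti_mono[OF tM] ti_mono[OF tt] Tst T_mono[OF X0n(1)]])
    show "w + p + 2 \<le> Z 5" using Z_add[OF w5(1) p_Z] by (auto intro: order_trans)
    show "Suc (max (p + 1) (p + 2)) \<le> Z 5" by (rule Z_mono[of _ 2]) (use Z_bounds(1) z16 in auto)
    fix a assume a: "a \<in> D"
    interpret clusters "\<lambda>k. e k a" "\<lambda>k. m k a" "int g" by (rule cl)
    have sum: "(\<Sum>k<K. fp_val (F k a)) = (\<Sum>k<K. val k)"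
      unfolding val_def fp_val_def by (simp add: m_def e_def)
    have tp: "tp v a \<longleftrightarrow> top {..<K} v" for v
      using Xcsum unfolding tp_def top_def bot_def by auto
    let ?S = "\<Sum>k<K. fp_val (F k a)"
    have args: "finite {..<K}" "\<And>k. k \<in> {..<K} \<Longrightarrow> \<bar>m k a\<bar> < 2 ^ p" "card {..<K} \<le> K" "int g = int (p + Suc p + K)"
      using m_bnd[OF _ a] by (auto simp: g_def)
    show "(M a = 0 \<and> ?S = 0) \<or>
      (2 ^ p \<le> M a \<and> real_of_int (M a) * 2 powi (e0 a - int (Suc p)) \<le> \<bar>?S\<bar> \<and>
       \<bar>?S\<bar> < real_of_int (M a + 1) * 2 powi (e0 a - int (Suc p)) \<and>
       (rp a \<or> rn a \<longleftrightarrow> \<bar>?S\<bar> \<noteq> real_of_int (M a) * 2 powi (e0 a - int (Suc p))) \<and> (X0 a < 0 \<longleftrightarrow> ?S < 0))"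
    proof (cases "ne a")
      case False
      then have "\<not> (\<exists>v\<in>{..<K}. top {..<K} v)" by (auto simp: ne_def tp)
      then have "?S = 0" unfolding sum using sum_zero[OF args(1)] ex_top[OF args(1)] by blast
      moreover have "M a = 0" using False by (simp add: M_def X0_def br_def rp_def rn_def)
      ultimately show ?thesis by simp
    next
      case True
      let ?v = "V a"
      have v: "top {..<K} ?v" using V[OF True] tp by simp
      then have bv: "bottom {..<K} ?v" by (simp add: top_def)
      obtain r where r: "?S = real_of_int (csum {..<K} ?v) * 2 powi e ?v a + r"
        "r = (\<Sum>k | k \<in> {..<K} \<and> e k a < e ?v a. val k)" "\<bar>r\<bar> * 2 ^ Suc p < 2 powi e ?v a"
        using top_sum[OF args(1) v args(2-4)] unfolding sum by blast
      have X0: "X0 a = csum {..<K} ?v" "e0 a = e ?v a" "X0 a \<noteq> 0"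
        using True v Xcsum[of ?v a] bv by (auto simp: X0_def e0_def bot_def top_def)
      have sec: "sec ?v b a \<longleftrightarrow> bottom {..<K} b \<and> e b a < e ?v a \<and> csum {..<K} b \<noteq> 0 \<and>
        (\<forall>c\<in>{..<K}. bottom {..<K} c \<and> e b a < e c a \<and> e c a < e ?v a \<longrightarrow> csum {..<K} c = 0)" for b
        using Xcsum unfolding sec_def bot_def by auto
      have rr: "0 < r \<longleftrightarrow> rp a" "r < 0 \<longleftrightarrow> rn a"
      proof -
        have "b < K \<and> sec ?v b a \<and> h (X b a) \<longleftrightarrow> b \<in> {..<K} \<and> (bottom {..<K} b \<and> e b a < e ?v a \<and> csum {..<K} b \<noteq> 0 \<and>
          (\<forall>c\<in>{..<K}. bottom {..<K} c \<and> e b a < e c a \<and> e c a < e ?v a \<longrightarrow> csum {..<K} c = 0)) \<and> h (csum {..<K} b)" for h b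
        proof (cases "bottom {..<K} b")
          case True
          then have "X b a = csum {..<K} b" using Xcsum[of b a] by (simp add: bot_def)
          then show ?thesis unfolding sec by (simp only: lessThan_iff)
        next
          case False
          then show ?thesis unfolding sec by simp
        qed
        then have exh: "(\<exists>b<K. sec ?v b a \<and> h (X b a)) \<longleftrightarrow> (\<exists>b\<in>{..<K}. (bottom {..<K} b \<and> e b a < e ?v a \<and> csum {..<K} b \<noteq> 0 \<and>
          (\<forall>c\<in>{..<K}. bottom {..<K} c \<and> e b a < e c a \<and> e c a < e ?v a \<longrightarrow> csum {..<K} c = 0)) \<and> h (csum {..<K} b))" for h
          unfolding Bex_def by (simp only:)
        show "0 < r \<longleftrightarrow> rp a" "r < 0 \<longleftrightarrow> rn a"
          using rest_sgn[OF args(1) bv args(2-4)] exh[of "\<lambda>x. 0 < x"] exh[of "\<lambda>x. x < 0"] True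
          unfolding r(2) rp_def rn_def by (simp_all only: simp_thms)
      qed
      have br: "br a \<longleftrightarrow> (r < 0 \<and> 0 < X0 a) \<or> (0 < r \<and> X0 a < 0)" by (simp add: br_def rr)
      have st: "rp a \<or> rn a \<longleftrightarrow> r \<noteq> 0" using rr by auto
      have pw: "2 powi (e0 a - int (Suc p)) = 2 powi e ?v a / (2::real) ^ Suc p"
        by (simp add: X0(2) power_int_diff power_int_add del: of_nat_Suc)
      have S: "?S = real_of_int (X0 a) * 2 powi e ?v a + r" using r(1) X0 by simp
      show ?thesis
        unfolding pw M_def br st S
        using sticky_sum[OF X0(3) _ r(3)] by simp
    qed
  qed auto
  then show ?thesis by (rule tf_mono) simp
qed

end

section \<open>Division\<close>

text \<open>
  The least common multiple of \<open>1, \<dots>, n\<close> is a multiple of the inverses of the entries of Leibniz'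
  harmonic triangle, each of which is the difference of two entries of the adjacent column.
\<close>

lemma leibniz_triangle_dvd:
  fixes M :: nat
  assumes "\<And>k. 1 \<le> k \<Longrightarrow> k \<le> n \<Longrightarrow> k dvd M" "Suc m \<le> n"
  shows "Suc m * (n choose Suc m) dvd M"
  using assms
proof (induction m arbitrary: n)
  case 0
  then show ?case by simp
next
  case (Suc m)
  obtain n' where n: "n = Suc n'" using Suc.prems by (cases n) auto
  define a b c where "a = Suc m * (n' choose Suc m)" and "b = Suc m * (n choose Suc m)"
    and "c = Suc (Suc m) * (n choose Suc (Suc m))"
  have "a dvd M" unfolding a_def using Suc.prems n by (intro Suc.IH) auto
  moreover have "b dvd M" unfolding b_def using Suc.prems by (intro Suc.IH) auto
  ultimately obtain x y where xy: "M = a * x" "M = b * y" unfolding dvd_def by blast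
  have ab: "0 < a" "0 < b" using Suc.prems n by (auto simp: a_def b_def)
  have bn: "b = Suc n' * (n' choose m)" unfolding b_def n by (rule Suc_times_binomial)
  have cn: "c = Suc n' * (n' choose Suc m)" unfolding c_def n by (rule Suc_times_binomial)
  have beq: "b = a + Suc m * (n' choose m)" by (simp add: a_def b_def n algebra_simps)
  have "c * b = c * a + c * (Suc m * (n' choose m))" by (subst beq) (rule distrib_left)
  also have "c * (Suc m * (n' choose m)) = a * b" unfolding bn cn a_def by (simp only: mult_ac)
  finally have "c * b = c * a + a * b" .
  \<comment> \<open>The rule \<open>1 / a - 1 / b = 1 / c\<close> of the triangle, cleared of
    denominators.\<close>
  then have id: "int c * int b - int c * int a = int a * int b"
    by (simp flip: of_nat_mult of_nat_add)
  have "int a * int b * (int c * (int x - int y)) = int c * int b * int (a * x) - int c * int a * int (b * y)"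
    by (simp add: algebra_simps)
  also have "\<dots> = int a * int b * int M"
    unfolding xy[symmetric] id[symmetric] by (simp add: algebra_simps)
  finally have "int M = int c * (int x - int y)" using ab by simp
  then have "int c dvd int M" by simp
  then show ?case by (simp only: c_def of_nat_dvd_iff)
qed

primrec lcm_upto :: "nat \<Rightarrow> nat" where
  "lcm_upto 0 = 1"
| "lcm_upto (Suc n) = lcm (lcm_upto n) (Suc n)"

lemma dvd_lcm_upto: "1 \<le> k \<Longrightarrow> k \<le> n \<Longrightarrow> k dvd lcm_upto n"
  by (induction n) (auto simp: le_Suc_eq)

lemma lcm_upto_pos: "0 < lcm_upto n"
  by (induction n) (auto simp: lcm_pos_nat)

text \<open>The central entry of a row, a multiple of the central binomial coefficient, is already
  this large. Hence the remainders modulo \<open>1, ..., 2 * n\<close> distinguish all numbers below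
  \<open>2 ^ n\<close>.\<close>

lemma lcm_upto_ge:
  assumes "1 \<le> n"
  shows "2 ^ n \<le> lcm_upto (2 * n)"
proof -
  obtain m where n: "n = Suc m" using assms by (cases n) auto
  have "Suc m * (2 * n choose Suc m) dvd lcm_upto (2 * n)"
    by (rule leibniz_triangle_dvd, rule dvd_lcm_upto, assumption+) (use n in simp)
  then have "n * (2 * n choose n) dvd lcm_upto (2 * n)" by (simp only: n[symmetric])
  then have "n * (2 * n choose n) \<le> lcm_upto (2 * n)" by (rule dvd_imp_le) (rule lcm_upto_pos)
  moreover have "2 ^ n \<le> real (n * (2 * n choose n))"
  proof -
    have "4 ^ n / (2 * real n) \<le> real (2 * n choose n)" using assms by (intro central_binomial_lower_bound) auto
    then have "4 ^ n / 2 \<le> real n * real (2 * n choose n)" using assms by (simp add: field_simps)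
    moreover have "(2::real) ^ n \<le> 4 ^ n / 2"
    proof -
      have "(4::real) ^ n = 2 ^ n * 2 ^ n" by (simp flip: power_mult_distrib)
      moreover have "(2::real) ^ 1 \<le> 2 ^ n" using assms by (intro power_increasing) auto
      then have "2 ^ n * 2 \<le> 2 ^ n * (2::real) ^ n" by (intro mult_left_mono) auto
      ultimately show ?thesis by simp
    qed
    ultimately show ?thesis by simp
  qed
  then have "2 ^ n \<le> n * (2 * n choose n)"
    by (metis of_nat_le_iff of_nat_numeral of_nat_power)
  ultimately show ?thesis by (rule order_trans[rotated])
qed

text \<open>A crude bound, sufficient for the period of the remainders to have polynomially many
  bits.\<close>

lemma lcm_upto_le: "lcm_upto n \<le> 2 ^ (n * n)"
proof (induction n)
  case (Suc n)
  have "lcm_upto (Suc n) \<le> lcm_upto n * Suc n"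
    by (simp del: mult_Suc_right add: lcm_nat_def)
  also have "\<dots> \<le> 2 ^ (n * n) * 2 ^ (n + n + 1)"
  proof (rule mult_le_mono[OF Suc])
    have "Suc n \<le> 2 ^ n" by (simp add: Suc_leI less_exp)
    also have "(2::nat) ^ n \<le> 2 ^ (n + n + 1)" by (intro power_increasing) auto
    finally show "Suc n \<le> 2 ^ (n + n + 1)" .
  qed
  also have "\<dots> = 2 ^ (Suc n * Suc n)" by (simp flip: power_add add: algebra_simps)
  finally show ?case .
qed simp

text \<open>Chinese remaindering with moduli that need not be coprime.\<close>

lemma remainder_coeffs:
  "\<exists>c. \<forall>y::int. int (lcm_upto n) dvd y - (\<Sum>k<n. c k * (y mod int (Suc k)))"
proof (induction n)
  case (Suc n)
  then obtain c where c: "\<And>y. int (lcm_upto n) dvd y - (\<Sum>k<n. c k * (y mod int (Suc k)))" by blast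
  define L m g where "L = int (lcm_upto n)" and "m = int (Suc n)" and "g = gcd L m"
  have g: "0 < g" unfolding g_def m_def by simp
  obtain l' m' where lm: "L = g * l'" "m = g * m'" unfolding g_def by (meson gcd_dvd1 gcd_dvd2 dvdE)
  obtain u v where "u * L + v * m = g" unfolding g_def using bezout_int by blast
  then have "g * (u * l' + v * m') = g * 1" unfolding lm by (simp add: algebra_simps)
  then have one: "u * l' + v * m' = 1" using g by (simp only: mult_cancel_left) auto
  have lcm: "int (lcm_upto (Suc n)) = L * m'"
  proof -
    have "g = int (gcd (lcm_upto n) (Suc n))" unfolding g_def L_def m_def by (rule gcd_int_int_eq)
    then have "g * int (lcm_upto (Suc n)) = int (gcd (lcm_upto n) (Suc n) * lcm (lcm_upto n) (Suc n))"
      by (simp only: of_nat_mult lcm_upto.simps)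
    also have "\<dots> = L * m" unfolding L_def m_def of_nat_mult[symmetric] of_nat_eq_iff
      by (rule prod_gcd_lcm_nat[symmetric])
    also have "L * m = g * (L * m')" by (subst lm(2)) (rule mult.left_commute)
    finally show ?thesis using g mult_cancel_left[of g "int (lcm_upto (Suc n))" "L * m'"] by linarith
  qed
  \<comment> \<open>The Bezout weights \<open>u * l'\<close> and \<open>v * m'\<close> add up to 1.
    The error therefore splits into \<open>v * m' * (y - A)\<close> and
    \<open>u * l' * (y - y mod m)\<close>, both multiples of \<open>L * m'\<close>.\<close>
  define c' where "c' k = (if k = n then u * l' else v * m' * c k)" for k
  have "int (lcm_upto (Suc n)) dvd y - (\<Sum>k<Suc n. c' k * (y mod int (Suc k)))" for y
  proof -
    define A where "A = (\<Sum>k<n. c k * (y mod int (Suc k)))"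
    have "(\<Sum>k<Suc n. c' k * (y mod int (Suc k))) = v * m' * A + u * l' * (y mod m)"
      by (simp add: c'_def A_def sum_distrib_left mult.assoc m_def)
    then have "y - (\<Sum>k<Suc n. c' k * (y mod int (Suc k))) = (u * l' + v * m') * y - (v * m' * A + u * l' * (y mod m))"
      by (simp add: one)
    also have "\<dots> = v * (m' * (y - A)) + u * (l' * (y - y mod m))" by (simp add: algebra_simps)
    finally have eq: "y - (\<Sum>k<Suc n. c' k * (y mod int (Suc k))) = v * (m' * (y - A)) + u * (l' * (y - y mod m))" .
    have "L * m' dvd m' * (y - A)" using c[of y] by (simp add: mult.commute[of L] A_def L_def mult_dvd_mono)
    moreover have "m dvd y - y mod m" by (simp add: minus_mod_eq_mult_div)
    then have "l' * m dvd l' * (y - y mod m)" by (rule mult_dvd_mono[OF dvd_refl])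
    then have "L * m' dvd l' * (y - y mod m)" unfolding lm by (simp add: mult_ac)
    ultimately show ?thesis unfolding eq lcm by (rule dvd_add[OF dvd_mult dvd_mult])
  qed
  then show ?case by blast
qed simp

section \<open>Chinese remaindering by formulas\<close>

context tcp
begin

text \<open>With the powers of two replaced by their remainders modulo \<open>k\<close>, the
  weighted sum of the bits is polynomially small and \<open>thr_count\<close> applies.\<close>

lemma T_mod_eq:
  assumes b: "ti d w b" "\<And>a. a \<in> D \<Longrightarrow> 0 \<le> b a" and k: "0 < k" "k \<le> Z 3" and w: "w \<le> Z 3"
  shows "T (d + 5) (\<lambda>a. b a mod int k = int r)"
proof (rule thr_cong)
  let ?cs = "map (\<lambda>i. (2 ^ i mod k, \<lambda>a. bit (b a) i)) [0..<w]"
  show "T (d + 5) (\<lambda>a. (\<lambda>v. v mod k = r) (\<Sum>(c, f)\<leftarrow>?cs. c * of_bool (f a)))"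
  proof (rule thr_count[where W = "Z 6"])
    have "sum_list (map fst ?cs) = (\<Sum>i\<leftarrow>[0..<w]. 2 ^ i mod k)" by (simp add: comp_def)
    also have "\<dots> \<le> (\<Sum>i\<leftarrow>[0..<w]. k)" using k(1) by (intro sum_list_mono) (simp add: less_imp_le)
    also have "\<dots> = w * k" by (simp add: sum_list_triv)
    also have "\<dots> \<le> Z (3 + 3)" using w k by (intro Z_mult)
    finally show "sum_list (map fst ?cs) \<le> Z 6" by simp
    show "2 * Z 6 + 2 \<le> Z 40" by (rule Z_mono[OF Z_add[OF Z_mult[OF Z_const order_refl] Z_const]]) auto
  qed (use b in \<open>auto simp: ti_def\<close>)
  fix a assume a: "a \<in> D"
  have "b a = (\<Sum>i<w. 2 ^ i * of_bool (bit (b a) i))"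
  proof -
    have "\<bar>b a\<bar> < 2 ^ w" using b(1) a by (simp add: ti_def)
    from int_bits[OF this] bit_eq_sign[OF this order_refl] b(2)[OF a] show ?thesis by simp
  qed
  also have "\<dots> = int (\<Sum>i<w. 2 ^ i * of_bool (bit (b a) i))" by simp
  finally have bs: "b a = int (\<Sum>i<w. 2 ^ i * of_bool (bit (b a) i))" .
  have "(\<Sum>(c, f)\<leftarrow>?cs. c * of_bool (f a)) = (\<Sum>i<w. (2 ^ i mod k) * of_bool (bit (b a) i))"
    by (simp add: comp_def sum_list_distinct_conv_sum_set atLeast0LessThan)
  also have "\<dots> mod k = (\<Sum>i<w. 2 ^ i * of_bool (bit (b a) i)) mod k"
    by (subst (1 2) mod_sum_eq[symmetric]) (simp add: mod_simps)
  finally show "((\<lambda>v. v mod k = r) (\<Sum>(c, f)\<leftarrow>?cs. c * of_bool (f a))) = (b a mod int k = int r)"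
    by (subst bs) (simp only: of_nat_mod[symmetric] of_nat_eq_iff)
qed

text \<open>The tables \<open>h k\<close> are arbitrary, so \<open>Y\<close> can be any function of
  \<open>b\<close> that respects congruences, such as a polynomial of high degree. The tables are
  constants of the formula.\<close>

lemma ti_from_remainders:
  assumes b: "ti d w b" "\<And>a. a \<in> D \<Longrightarrow> 0 \<le> b a" "w \<le> Z 3"
    and N: "N \<le> Z 3"
    and Y: "\<And>a. a \<in> D \<Longrightarrow> 0 \<le> Y a" "\<And>a. a \<in> D \<Longrightarrow> Y a < int (lcm_upto N)"
      "\<And>a k. a \<in> D \<Longrightarrow> k < N \<Longrightarrow> Y a mod int (Suc k) = h k (b a mod int (Suc k))"
  shows "ti (d + 30) (N * N) Y"
proof -
  define L where "L = int (lcm_upto N)"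
  have L: "0 < L" "L \<le> 2 ^ (N * N)"
    using lcm_upto_pos[of N] lcm_upto_le[of N] by (auto simp: L_def)
  obtain c0 where c0: "\<And>y::int. L dvd y - (\<Sum>k<N. c0 k * (y mod int (Suc k)))"
    using remainder_coeffs[of N] unfolding L_def by blast
  \<comment> \<open>Reducing the coefficients modulo \<open>L\<close> keeps the combination of
    remainders between 0 and \<open>N * N * L\<close>.\<close>
  define c where "c k = c0 k mod L" for k
  have c: "0 \<le> c k" "c k < L" for k using L by (auto simp: c_def)
  define S where "S a = (\<Sum>k<N. \<Sum>r<N. (c k * (h k (int r) mod int (Suc k))) * of_bool (b a mod int (Suc k) = int r))" for a
  have tS: "tl (d + 5) (N * (N * 1)) S"
    unfolding S_def by (intro tl_sum tl_scale tl_of_bool T_mod_eq[OF b(1,2) _ _ b(3)]) (use N in auto)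
  have S: "S a = (\<Sum>k<N. c k * (Y a mod int (Suc k)))" if a: "a \<in> D" for a
    unfolding S_def
  proof (rule sum.cong)
    fix k assume k: "k \<in> {..<N}"
    define r0 where "r0 = nat (b a mod int (Suc k))"
    have r0: "b a mod int (Suc k) = int r0" by (simp add: r0_def)
    moreover have "b a mod int (Suc k) < int (Suc k)" by simp
    ultimately have "int r0 < int (Suc k)" by (simp only:)
    then have r0N: "r0 < N" using k by simp
    have hY: "h k (int r0) mod int (Suc k) = Y a mod int (Suc k)"
      using Y(3)[OF a, of k] k unfolding r0 by (metis lessThan_iff mod_mod_trivial)
    have "(\<Sum>r<N. c k * (h k (int r) mod int (Suc k)) * of_bool (b a mod int (Suc k) = int r)) =
        (\<Sum>r<N. if r = r0 then c k * (h k (int r) mod int (Suc k)) else 0)"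
      unfolding r0 by (intro sum.cong) auto
    also have "\<dots> = c k * (Y a mod int (Suc k))" using r0N hY by (simp add: sum.delta)
    finally show "(\<Sum>r<N. c k * (h k (int r) mod int (Suc k)) * of_bool (b a mod int (Suc k) = int r)) = c k * (Y a mod int (Suc k))" .
  qed simp
  have Sb: "0 \<le> S a" "S a \<le> int (N * N) * L" if a: "a \<in> D" for a
  proof -
    show "0 \<le> S a" unfolding S[OF a] using c by (intro sum_nonneg mult_nonneg_nonneg) auto
    have "S a \<le> (\<Sum>k<N. L * int N)"
      unfolding S[OF a]
    proof (rule sum_mono)
      fix k assume k: "k \<in> {..<N}"
      have "Y a mod int (Suc k) < int (Suc k)" by simp
      moreover have "int (Suc k) \<le> int N" using k by simp
      ultimately have "Y a mod int (Suc k) \<le> int N" by linarith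
      moreover have "0 \<le> Y a mod int (Suc k)" by simp
      ultimately show "c k * (Y a mod int (Suc k)) \<le> L * int N"
        using c[of k] L(1) by (intro mult_mono) auto
    qed
    then show "S a \<le> int (N * N) * L" by (simp add: algebra_simps)
  qed
  have SY: "Y a = S a mod L" if a: "a \<in> D" for a
  proof -
    have "L dvd c0 k * x - c k * x" for k x
      by (simp add: c_def left_diff_distrib[symmetric] minus_mod_eq_mult_div)
    then have "L dvd (\<Sum>k<N. c0 k * (Y a mod int (Suc k)) - c k * (Y a mod int (Suc k)))"
      by (intro dvd_sum)
    from dvd_add[OF c0[of "Y a"] this] have "L dvd Y a - S a"
      unfolding S[OF a] sum_subtractf by simp
    then have "Y a mod L = S a mod L" by (simp add: mod_eq_dvd_iff)
    then show ?thesis using Y(1,2)[OF a] by (simp add: L_def)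
  qed
  define wS where "wS = 4 * (N * N) + 2"
  have N2: "N * N \<le> Z 6" "wS \<le> Z 8" "wS \<le> Z 9"
  proof -
    show 6: "N * N \<le> Z 6" using Z_mult[OF N N] by simp
    show "wS \<le> Z 8" unfolding wS_def by (rule Z_mono[OF Z_add[OF Z_mult[OF Z_const 6] Z_const]]) auto
    then show "wS \<le> Z 9" by (rule Z_mono) simp
  qed
  have tj: "ti (d + 21) wS (\<lambda>a. S a - int j * L)" if "j \<le> N * N + 1" for j
  proof -
    have "tl (max (d + 5) (d + 5)) (N * (N * 1) + 1) (\<lambda>a. S a - int j * L)"
      by (intro tl_diff tS tl_const)
    then have "tl (d + 5) (N * (N * 1) + 1) (\<lambda>a. S a - int j * L)" by simp
    then have "ti (d + 5 + 16) wS (\<lambda>a. S a - int j * L)"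
    proof (rule tl_ti)
      show "N * (N * 1) + 1 \<le> Z 9" using N2 by (auto simp: wS_def)
      fix a assume a: "a \<in> D"
      have "int j * L \<le> int (N * N + 1) * L" using that L(1) by (intro mult_right_mono) linarith+
      moreover have "0 \<le> int j * L" using L(1) by simp
      moreover have "int (N * N) * L \<le> int (N * N + 1) * L" using L(1) by (intro mult_right_mono) linarith+
      ultimately have "\<bar>S a - int j * L\<bar> \<le> int (N * N + 1) * L"
        using Sb[OF a] by linarith
      also have "\<dots> \<le> 2 ^ (N * N + 1) * 2 ^ (N * N)"
      proof (rule mult_mono)
        have "N * N + 1 < 2 ^ (N * N + 1)" by (rule less_exp)
        then show "int (N * N + 1) \<le> 2 ^ (N * N + 1)"
          by (metis of_nat_le_iff of_nat_numeral of_nat_power less_imp_le)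
      qed (use L in auto)
      also have "\<dots> < 2 ^ wS" unfolding power_add[symmetric] wS_def by (rule power_strict_increasing) auto
      finally show "\<bar>S a - int j * L\<bar> < 2 ^ wS" .
    qed (use N2 in auto)
    then show ?thesis by (simp add: add.commute)
  qed
  have N40: "N * N + 1 \<le> Z 40" using N2(3) by (auto simp: wS_def intro: Z_mono[of _ 9])
  show ?thesis
    unfolding ti_def
  proof (intro conjI ballI allI)
    fix a assume a: "a \<in> D"
    show "\<bar>Y a\<bar> < 2 ^ (N * N)" using Y(1,2)[OF a] L(2) unfolding L_def by linarith
  next
    fix i
    show "T (d + 30) (\<lambda>a. bit (Y a) i)"
    proof (rule thr_cong)
      \<comment> \<open>\<open>Y a\<close> is the remainder of \<open>S a\<close> modulo
        \<open>L\<close>. The quotient is at most \<open>N * N\<close>, so all multiples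
        \<open>j * L\<close>, which are constants, are tried.\<close>
      show "T (d + 30) (\<lambda>a. \<exists>j<N * N + 1. \<not> S a - int j * L < 0 \<and> S a - int (j + 1) * L < 0 \<and> bit (S a - int j * L) i)"
      proof (rule T_mono)
        have b: "T (d + 21) (\<lambda>a. bit (S a - int j * L) i)" if "j < N * N + 1" for j
          using tj[of j] that by (simp add: ti_def)
        show "T (Suc (Suc (max (Suc (d + 21)) (Suc (max (d + 21) (d + 21))))))
          (\<lambda>a. \<exists>j<N * N + 1. \<not> S a - int j * L < 0 \<and> S a - int (j + 1) * L < 0 \<and> bit (S a - int j * L) i)"
          by (intro thr_ex_less T_conj thr_Not T_neg[OF tj] b N40) auto
      qed simp
      fix a assume a: "a \<in> D"
      define q where "q = nat (S a div L)"
      have q: "int q = S a div L" using Sb(1)[OF a] L(1) by (simp add: q_def pos_imp_zdiv_nonneg_iff)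
      have "S a div L \<le> (int (N * N) * L) div L" using Sb(2)[OF a] L(1) by (intro zdiv_mono1)
      then have "int q \<le> int (N * N)" using q L(1) by simp
      then have qN: "q < N * N + 1" by linarith
      have jq: "(\<not> S a - int j * L < 0 \<and> S a - int (j + 1) * L < 0) \<longleftrightarrow> j = q" for j
      proof -
        have "0 \<le> S a mod L" "S a mod L < L" "int q * L + S a mod L = S a" "(int q + 1) * L = int q * L + L"
          using L(1) by (simp_all add: q algebra_simps)
        then have qL: "int q * L \<le> S a" "S a < (int q + 1) * L" by linarith+
        show ?thesis
        proof
          assume "\<not> S a - int j * L < 0 \<and> S a - int (j + 1) * L < 0"
          with qL have "int j * L < (int q + 1) * L" "int q * L < int (j + 1) * L" by linarith+
          then have "int j < int q + 1" "int q < int (j + 1)"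
            by (simp_all only: mult_less_cancel_right_pos[OF L(1)])
          then show "j = q" by simp
        qed (use qL in \<open>simp add: add.commute\<close>)
      qed
      have Yq: "S a - int q * L = Y a" unfolding q SY[OF a] by (simp add: minus_div_mult_eq_mod)
      show "(\<exists>j<N * N + 1. \<not> S a - int j * L < 0 \<and> S a - int (j + 1) * L < 0 \<and> bit (S a - int j * L) i) = bit (Y a) i"
      proof
        assume "\<exists>j<N * N + 1. \<not> S a - int j * L < 0 \<and> S a - int (j + 1) * L < 0 \<and> bit (S a - int j * L) i"
        then obtain j where "\<not> S a - int j * L < 0 \<and> S a - int (j + 1) * L < 0" "bit (S a - int j * L) i" by blast
        then show "bit (Y a) i" unfolding jq using Yq by simp
      next
        assume "bit (Y a) i"
        then show "\<exists>j<N * N + 1. \<not> S a - int j * L < 0 \<and> S a - int (j + 1) * L < 0 \<and> bit (S a - int j * L) i"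
          using qN jq[of q] Yq by (intro exI[of _ q]) simp
      qed
    qed
  qed
qed

end

text \<open>
  With \<open>x = 2 ^ p\<close> and \<open>y = x - m\<close> the geometric sum of powers of \<open>x\<close> and \<open>y\<close> is almost a quotient
  of a power of two by \<open>m\<close>, and its remainders are determined by those of \<open>y\<close>.
\<close>

definition recip_sum :: "nat \<Rightarrow> int \<Rightarrow> int" where
  "recip_sum p y = (\<Sum>q<Suc (2 * p). (2 ^ p) ^ q * y ^ (2 * p - q))"

text \<open>By the geometric sum, \<open>m * S\<close> falls short of
  \<open>2 ^ (p * Suc (2 * p))\<close> by \<open>y ^ Suc (2 * p)\<close>. Since
  \<open>y \<le> 2 ^ (p - 1)\<close>, this number of factors makes the defect at most
  \<open>E\<close>. So \<open>S div E\<close> is the integer part of \<open>2 ^ (2 * p) / m\<close>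
  or one less.\<close>

lemma recip_sum_props:
  fixes m :: int
  assumes p: "1 \<le> p" and m: "2 ^ (p - 1) \<le> m" "m < 2 ^ p"
  defines "S \<equiv> recip_sum p (2 ^ p - m)" and "E \<equiv> 2 ^ (p * Suc (2 * p) - 2 * p)"
  shows "0 \<le> S" "S < 2 ^ (p * Suc (2 * p))"
    "(S div E) * m \<le> 2 ^ (2 * p)" "2 ^ (2 * p) < (S div E + 2) * m" "S div E \<le> 2 ^ (2 * p)"
proof -
  define y where "y = 2 ^ p - m"
  define I where "I = Suc (2 * p)"
  have pp: "(2::int) ^ p = 2 * 2 ^ (p - 1)" using p by (cases p) auto
  have y: "1 \<le> y" "y \<le> 2 ^ (p - 1)" using m pp by (auto simp: y_def)
  have m1: "1 \<le> m" using m(1) by (smt (verit) zero_less_power)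
  show S0: "0 \<le> S" unfolding S_def recip_sum_def using y by (intro sum_nonneg) (auto simp: y_def)
  have mS: "m * S = 2 ^ (p * I) - y ^ I"
    using diff_power_eq_sum[of "2 ^ p :: int" "2 * p" y]
    by (simp add: S_def recip_sum_def y_def I_def power_mult[symmetric] del: power_Suc mult_Suc_right sum.lessThan_Suc)
  have "1 ^ I \<le> y ^ I" using y by (intro power_mono) auto
  moreover have "1 * S \<le> m * S" using m1 S0 by (intro mult_right_mono) auto
  ultimately show "S < 2 ^ (p * Suc (2 * p))" using mS by (simp add: I_def)
  have E: "0 < E" by (simp add: E_def)
  have "2 * p * 1 \<le> p * I" using p by (simp add: I_def)
  then have PE: "(2::int) ^ (p * I) = 2 ^ (2 * p) * E"
    unfolding E_def I_def[symmetric] by (simp flip: power_add)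
  have yE: "y ^ I \<le> E"
  proof -
    have "y ^ I \<le> (2 ^ (p - 1)) ^ I" using y by (intro power_mono) auto
    also have "\<dots> = 2 ^ ((p - 1) * I)" by (rule power_mult[symmetric])
    also have "\<dots> \<le> E" unfolding E_def I_def[symmetric]
    proof (rule power_increasing)
      show "(p - 1) * I \<le> p * I - 2 * p" using p by (cases p) (auto simp: I_def)
    qed simp
    finally show ?thesis .
  qed
  define Q where "Q = S div E"
  have Q: "Q * E \<le> S" "S < (Q + 1) * E"
  proof -
    have "0 \<le> S mod E" "S mod E < E" "Q * E + S mod E = S" "(Q + 1) * E = Q * E + E"
      using E by (simp_all add: Q_def algebra_simps)
    then show "Q * E \<le> S" "S < (Q + 1) * E" by linarith+
  qed
  have "Q * E * m \<le> S * m" using Q(1) m1 by (intro mult_right_mono) auto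
  also have "\<dots> \<le> 2 ^ (2 * p) * E" using mS PE y by (simp add: mult.commute)
  finally have "(Q * m) * E \<le> 2 ^ (2 * p) * E" by (simp add: mult_ac)
  then show Qm: "(S div E) * m \<le> 2 ^ (2 * p)" using E by (simp add: Q_def)
  have "(2 ^ (2 * p) - 1) * E \<le> m * S" using mS PE yE by (simp add: algebra_simps)
  also have "m * S < m * ((Q + 1) * E)" using Q(2) m1 by (intro mult_strict_left_mono) auto
  finally have "(2 ^ (2 * p) - 1) * E < (m * (Q + 1)) * E" by (simp add: mult_ac)
  then have "2 ^ (2 * p) - 1 < m * (Q + 1)" using E mult_less_cancel_right_pos[OF E] by blast
  moreover have "(Q + 2) * m = m * (Q + 1) + m" by (simp add: algebra_simps)
  ultimately show "2 ^ (2 * p) < (S div E + 2) * m" using m1 by (simp add: Q_def)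
  have "0 \<le> Q" using S0 E by (simp add: Q_def pos_imp_zdiv_nonneg_iff)
  then have "Q * 1 \<le> Q * m" using m1 by (intro mult_left_mono) auto
  with Qm show "S div E \<le> 2 ^ (2 * p)" by (simp add: Q_def)
qed

section \<open>Reciprocals\<close>

context tcp
begin

lemma tf_recip:
  assumes F: "tf d F" and nz: "\<And>a. a \<in> D \<Longrightarrow> fp_val (F a) \<noteq> 0"
  shows "tf (d + 500) (\<lambda>a. fp_round p (1 / fp_val (F a)))"
proof -
  define m e where "m a = fst (F a)" and "e a = snd (F a)" for a
  have tm: "ti d p m" and te: "ti d (p + 1) e"
    using tf_ti[OF F] by (auto simp: m_def[abs_def] e_def[abs_def])
  define K where "K = p * Suc (2 * p)"
  define y where "y a = 2 ^ p - \<bar>m a\<bar>" for a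
  define S where "S a = recip_sum p (y a)" for a
  define E where "E = K - 2 * p"
  define Q0 where "Q0 a = S a div 2 ^ E" for a
  have zs: "p \<le> Z 3" "p + 1 \<le> Z 3" "p + 1 \<le> Z 7" "Suc (max (p + 1) p) \<le> Z 3" "2 * K \<le> Z 3" "p \<le> Z 7" "p \<le> Z 8" "2 * p + 1 \<le> Z 7"
    "Suc (max (2 * p + 1) 1) \<le> Z 3" "1 \<le> Z 7" "Suc (max (2 * p + 1) 1) + p \<le> Z 7" "p + (2 * p + 1) \<le> Z 7" "Suc (2 * p + 1) \<le> Z 7" "2 * p + 2 \<le> Z 3" "Suc (max (2 * p + 1) 1) + p \<le> Z 5"
    "2 * p + 2 + p \<le> Z 5" "2 * p + 2 + p \<le> Z 7"
  proof -
    have K: "2 * K = 4 * p * p + 2 * p" by (simp add: K_def algebra_simps)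
    have "4 * p * p \<le> 4 * z * z" using pz by (intro mult_le_mono) auto
    then have "2 * K + 20 \<le> Z 3" using Z_bounds(4) pz unfolding K by linarith
    moreover have "p * 4 \<le> p * (4 * p)" using p1 by (intro mult_left_mono) auto
    then have "4 * p \<le> 2 * K" unfolding K by simp
    moreover have "Z 3 \<le> Z 7" "Z 3 \<le> Z 8" "Z 3 \<le> Z 5" by (rule Z_mono[OF order_refl]; simp)+
    ultimately show "p \<le> Z 3" "p + 1 \<le> Z 3" "p + 1 \<le> Z 7" "Suc (max (p + 1) p) \<le> Z 3" "2 * K \<le> Z 3" "p \<le> Z 7" "p \<le> Z 8" "2 * p + 1 \<le> Z 7"
    "Suc (max (2 * p + 1) 1) \<le> Z 3" "1 \<le> Z 7" "Suc (max (2 * p + 1) 1) + p \<le> Z 7" "p + (2 * p + 1) \<le> Z 7" "Suc (2 * p + 1) \<le> Z 7" "2 * p + 2 \<le> Z 3" "Suc (max (2 * p + 1) 1) + p \<le> Z 5"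
      "2 * p + 2 + p \<le> Z 5" "2 * p + 2 + p \<le> Z 7"
      by auto
  qed
  have mb: "2 ^ (p - 1) \<le> \<bar>m a\<bar>" "\<bar>m a\<bar> < 2 ^ p" "m a \<noteq> 0" if a: "a \<in> D" for a
  proof -
    show m0: "m a \<noteq> 0" using nz[OF a] by (auto simp: m_def fp_val_def)
    have "(m a, e a) \<in> fp_set p" using F a by (simp add: tf_def m_def e_def)
    from fp_set_bounds[OF this] m0 show "2 ^ (p - 1) \<le> \<bar>m a\<bar>" "\<bar>m a\<bar> < 2 ^ p" by (auto simp: abs_if)
  qed
  note rs = recip_sum_props[OF p1 mb(1,2), folded y_def S_def K_def E_def, folded Q0_def]
  have ta: "ti (d + 19) p (\<lambda>a. \<bar>m a\<bar>)" by (rule ti_abs[OF tm zs(7)])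
  have ty: "ti (d + 35) (Suc (max (p + 1) p)) y"
    using ti_diff[OF ti_const[of "2 ^ p" "p + 1" 0] ta zs(3,6)] by (simp add: y_def[abs_def] add.commute)
  \<comment> \<open>\<open>2 * K\<close> moduli suffice, because \<open>S a < 2 ^ K\<close>. The
    table for a modulus evaluates \<open>recip_sum\<close> at the remainder.\<close>
  have "ti (d + 35 + 30) (2 * K * (2 * K)) S"
  proof (rule ti_from_remainders[OF ty _ zs(4,5)])
    fix a assume a: "a \<in> D"
    show "0 \<le> y a" using mb(2)[OF a] by (simp add: y_def)
    show "0 \<le> S a" by (rule rs(1)[OF a a])
    have "S a < 2 ^ K" by (rule rs(2)[OF a a])
    also have "(2::int) ^ K \<le> int (lcm_upto (2 * K))"
    proof -
      have "1 \<le> K" using p1 by (simp add: K_def)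
      from lcm_upto_ge[OF this] show ?thesis by (metis of_nat_le_iff of_nat_numeral of_nat_power)
    qed
    finally show "S a < int (lcm_upto (2 * K))" .
    show "S a mod int (Suc k) = recip_sum p (y a mod int (Suc k)) mod int (Suc k)" for k
      unfolding S_def recip_sum_def
      by (subst (1 2) mod_sum_eq[symmetric], rule arg_cong[where f = "\<lambda>x. x mod _"], rule sum.cong)
        (simp_all only: mod_mult_right_eq power_mod refl, metis mod_mult_right_eq power_mod)
  qed
  then have Sb: "T (d + 65) (\<lambda>a. bit (S a) i)" for i by (simp add: ti_def add.assoc)
  have tQ0: "ti (d + 65) (2 * p + 1) Q0"
    unfolding ti_def
  proof (intro conjI ballI allI)
    fix a assume a: "a \<in> D"
    have "0 \<le> Q0 a" unfolding Q0_def using rs(1)[OF a a] by (simp add: pos_imp_zdiv_nonneg_iff)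
    with rs(5)[OF a a] show "\<bar>Q0 a\<bar> < 2 ^ (2 * p + 1)" by (simp add: order.strict_trans1)
  next
    fix i
    have "bit (Q0 a) i = bit (S a) (i + E)" for a
      by (simp add: Q0_def bit_iff_odd power_add zdiv_zmult2_eq[symmetric] mult.commute)
    then show "T (d + 65) (\<lambda>a. bit (Q0 a) i)" using Sb by simp
  qed
  have tQ1: "ti (d + 81) (Suc (max (2 * p + 1) 1)) (\<lambda>a. Q0 a + 1)"
    using ti_add[OF tQ0 ti_const[of 1 1 0] zs(8,10)] by (simp add: add.commute)
  have tP1: "ti (d + 98) (Suc (max (2 * p + 1) 1) + p) (\<lambda>a. (Q0 a + 1) * \<bar>m a\<bar>)"
    using ti_mult[OF tQ1 ta zs(9,1)] by (simp add: add.commute)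
  have k: "ti 0 (2 * p + 1) (\<lambda>_. 2 ^ (2 * p))" "ti 0 (2 * p + 1) (\<lambda>_. int (2 * p))"
  proof -
    have "int (2 * p) < 2 ^ (2 * p + 1)"
      unfolding of_nat_less_numeral_power_cancel_iff using less_exp[of "2 * p + 1"] by linarith
    then show "ti 0 (2 * p + 1) (\<lambda>_. 2 ^ (2 * p))" "ti 0 (2 * p + 1) (\<lambda>_. int (2 * p))"
      by (intro ti_const; simp)+
  qed
  \<comment> \<open>Detects that the approximate quotient is one too small.\<close>
  define up where "up a \<longleftrightarrow> (Q0 a + 1) * \<bar>m a\<bar> \<le> 2 ^ (2 * p)" for a
  have Tup: "T (d + 115) up"
    using T_le[OF tP1 k(1) zs(11,8)] by (simp add: up_def[abs_def] add.commute)
  define Q where "Q a = (if up a then Q0 a + 1 else Q0 a)" for a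
  have tQ: "ti (d + 118) (2 * p + 2) Q"
    unfolding Q_def by (rule ti_mono[OF ti_if[OF Tup tQ1 tQ0]]) auto
  have tQm: "ti (d + 135) (2 * p + 2 + p) (\<lambda>a. Q a * \<bar>m a\<bar>)"
    using ti_mult[OF tQ ta zs(14,1)] by (simp add: add.commute)
  \<comment> \<open>A nonzero remainder of the division is the sticky flag. The scale
    \<open>2 ^ (2 * p)\<close> ensures that \<open>Q a\<close> is at least \<open>2 ^ p\<close>, as
    \<open>tf_round\<close> demands.\<close>
  have Tst: "T (d + 154) (\<lambda>a. Q a * \<bar>m a\<bar> \<noteq> 2 ^ (2 * p))"
    using thr_Not[OF T_eq[OF tQm k(1) zs(17,8)]] by (simp add: add.commute)
  define t where "t a = - e a - int (2 * p)" for a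
  have tt: "ti (d + 32) (Suc (max (p + 1) (2 * p + 1))) t"
  proof -
    have "p + 1 \<le> Z 8" using zs(3) by (rule Z_mono) simp
    from ti_diff[OF ti_uminus[OF te this] k(2) zs(3,8)] show ?thesis
      by (simp add: t_def[abs_def] add.commute)
  qed
  have "tf (d + 154 + 200) (\<lambda>a. fp_round p (1 / fp_val (F a)))"
  proof (rule tf_round[OF ti_mono[OF tQ] ti_mono[OF tt] Tst T_mono[OF T_neg[OF tm]]])
    show "2 * p + 2 \<le> Z 5" using zs by auto
    show "Suc (max (p + 1) (2 * p + 1)) \<le> Z 5" using zs by auto
    fix a assume a: "a \<in> D"
    have Qm: "Q a * \<bar>m a\<bar> \<le> 2 ^ (2 * p)" "2 ^ (2 * p) < (Q a + 1) * \<bar>m a\<bar>"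
      using rs(3,4)[OF a a] by (auto simp: Q_def up_def add.assoc)
    define r where "r = real_of_int \<bar>m a\<bar>"
    have r: "0 < r" using mb(3)[OF a] by (simp add: r_def)
    define u :: real where "u = 2 powi t a"
    have u: "0 < u" by (simp add: u_def)
    have x: "1 / fp_val (F a) = (if m a < 0 then - 1 else 1) * (2 ^ (2 * p) / r * u)"
    proof -
      have "2 powi e a * u * 2 ^ (2 * p) = 1"
        unfolding u_def t_def by (simp add: power_int_diff power_int_minus flip: power_int_of_nat power_int_mult)
      then have "u * 2 ^ (2 * p) = 1 / 2 powi e a" by (simp add: field_simps)
      moreover have "real_of_int (m a) = (if m a < 0 then - r else r)" by (simp add: r_def)
      ultimately show ?thesis using r by (simp add: fp_val_def m_def[symmetric] e_def[symmetric] field_simps)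
    qed
    have ax: "\<bar>1 / fp_val (F a)\<bar> = 2 ^ (2 * p) / r * u" unfolding x using r u by (simp add: abs_mult)
    have c: "real_of_int (Q a) * r \<le> 2 ^ (2 * p)" "2 ^ (2 * p) < real_of_int (Q a + 1) * r"
      "real_of_int (Q a) * r = 2 ^ (2 * p) \<longleftrightarrow> Q a * \<bar>m a\<bar> = 2 ^ (2 * p)"
      using iffD2[OF of_int_le_iff[where ?'a = real] Qm(1)] iffD2[OF of_int_less_iff[where ?'a = real] Qm(2)]
        of_int_eq_iff[where ?'a = real, of "Q a * \<bar>m a\<bar>" "2 ^ (2 * p)"]
      by (simp_all only: r_def of_int_mult of_int_power of_int_numeral)
    have "2 ^ p < Q a + 1"
    proof (rule ccontr)
      assume "\<not> 2 ^ p < Q a + 1"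
      then have "(Q a + 1) * \<bar>m a\<bar> \<le> 2 ^ p * 2 ^ p" using mb(2)[OF a] by (intro mult_mono) auto
      with Qm(2) show False by (simp add: power_add[symmetric] mult_2)
    qed
    then have Qp: "2 ^ p \<le> Q a" by simp
    have "real_of_int (Q a) \<le> 2 ^ (2 * p) / r" "2 ^ (2 * p) / r < real_of_int (Q a + 1)"
      "2 ^ (2 * p) / r = real_of_int (Q a) \<longleftrightarrow> Q a * \<bar>m a\<bar> = 2 ^ (2 * p)"
    proof -
      have "2 ^ (2 * p) / r = real_of_int (Q a) \<longleftrightarrow> real_of_int (Q a) * r = 2 ^ (2 * p)"
        using r by (auto simp: field_simps)
      then show "2 ^ (2 * p) / r = real_of_int (Q a) \<longleftrightarrow> Q a * \<bar>m a\<bar> = 2 ^ (2 * p)" using c(3) by simp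
    qed (use c(1,2) r in \<open>simp_all only: pos_le_divide_eq pos_divide_less_eq\<close>)
    then have "real_of_int (Q a) * u \<le> 2 ^ (2 * p) / r * u" "2 ^ (2 * p) / r * u < real_of_int (Q a + 1) * u"
      "2 ^ (2 * p) / r * u = real_of_int (Q a) * u \<longleftrightarrow> Q a * \<bar>m a\<bar> = 2 ^ (2 * p)"
      using u by (simp_all only: mult_right_mono mult_strict_right_mono mult_cancel_right less_imp_le) auto
    moreover have "m a < 0 \<longleftrightarrow> 1 / fp_val (F a) < 0"
    proof -
      have "0 < 2 ^ (2 * p) / r * u" using u r by simp
      then show ?thesis unfolding x by simp
    qed
    ultimately show "(Q a = 0 \<and> 1 / fp_val (F a) = 0) \<or>
      (2 ^ p \<le> Q a \<and> real_of_int (Q a) * 2 powi t a \<le> \<bar>1 / fp_val (F a)\<bar> \<and>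
       \<bar>1 / fp_val (F a)\<bar> < real_of_int (Q a + 1) * 2 powi t a \<and>
       (Q a * \<bar>m a\<bar> \<noteq> 2 ^ (2 * p) \<longleftrightarrow> \<bar>1 / fp_val (F a)\<bar> \<noteq> real_of_int (Q a) * 2 powi t a) \<and>
       (m a < 0 \<longleftrightarrow> 1 / fp_val (F a) < 0))"
      unfolding ax u_def[symmetric] using Qp by blast
  qed auto
  then show ?thesis by (rule tf_mono) simp
qed

end

section \<open>Networks\<close>

lemma fp_bits_length [simp]: "length (fp_bits p a) = 2 * p + 2"
  by (simp add: fp_bits_def)

lemma fp_bits_nth:
  "i < p + 1 \<Longrightarrow> fp_bits p a ! i = bit (fst a) i"
  "i < p + 1 \<Longrightarrow> fp_bits p a ! (p + 1 + i) = bit (snd a) i"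
  by (simp_all add: fp_bits_def nth_append del: upt_Suc)

lemma length_concat_equal: "(\<And>xs. xs \<in> set xss \<Longrightarrow> length xs = L) \<Longrightarrow> length (concat xss) = length xss * L"
  by (induction xss) auto

lemma nth_concat_equal:
  assumes "\<And>xs. xs \<in> set xss \<Longrightarrow> length xs = L" "i < length xss" "j < L"
  shows "concat xss ! (i * L + j) = xss ! i ! j"
  using assms
proof (induction xss arbitrary: i)
  case (Cons xs xss)
  then have "length xs = L" by simp
  with Cons show ?case by (cases i) (auto simp: nth_append)
qed simp

lemma fp_mat_bits_length:
  assumes "A \<in> carrier_mat r c"
  shows "length (fp_mat_bits p A) = r * (c * (2 * p + 2))"
proof -
  have "length (concat (map (\<lambda>j. fp_bits p (A $$ (i, j))) [0..<c])) = c * (2 * p + 2)" for i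
    by (subst length_concat_equal[where L = "2 * p + 2"]) auto
  then show ?thesis using assms unfolding fp_mat_bits_def
    by (subst length_concat_equal[where L = "c * (2 * p + 2)"]) auto
qed

lemma fp_mat_bits_nth:
  assumes A: "A \<in> carrier_mat r c" and ij: "i < r" "j < c" "b < 2 * p + 2"
  shows "fp_mat_bits p A ! (i * (c * (2 * p + 2)) + (j * (2 * p + 2) + b)) = fp_bits p (A $$ (i, j)) ! b"
proof -
  let ?row = "\<lambda>i. concat (map (\<lambda>j. fp_bits p (A $$ (i, j))) [0..<c])"
  have len: "length (?row i) = c * (2 * p + 2)" for i
    by (subst length_concat_equal[where L = "2 * p + 2"]) auto
  have "j * (2 * p + 2) + b < j * (2 * p + 2) + (2 * p + 2)" using ij by simp
  also have "\<dots> = (j + 1) * (2 * p + 2)" by (simp add: algebra_simps)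
  also have "\<dots> \<le> c * (2 * p + 2)" using ij by (intro mult_right_mono) auto
  finally have lt: "j * (2 * p + 2) + b < c * (2 * p + 2)" .
  have "fp_mat_bits p A ! (i * (c * (2 * p + 2)) + (j * (2 * p + 2) + b)) = ?row i ! (j * (2 * p + 2) + b)"
    using A unfolding fp_mat_bits_def
    by (subst nth_concat_equal[OF _ _ lt]) (use ij len in auto)
  also have "\<dots> = fp_bits p (A $$ (i, j)) ! b"
    by (subst nth_concat_equal[OF _ _ ij(3)]) (use ij in auto)
  finally show ?thesis .
qed

lemma mat_index_decompose:
  fixes k :: nat
  assumes "k < r * (c * L)"
  shows "\<exists>i j b. i < r \<and> j < c \<and> b < L \<and> k = i * (c * L) + (j * L + b)"
proof -
  have L: "0 < c * L" "0 < L" using assms by (auto intro: ccontr)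
  have "k div (c * L) < r" using assms by (simp add: less_mult_imp_div_less)
  moreover have "k mod (c * L) div L < c" using L by (simp add: less_mult_imp_div_less)
  moreover have "k mod (c * L) mod L < L" using L by simp
  moreover have "k = k div (c * L) * (c * L) + (k mod (c * L) div L * L + k mod (c * L) mod L)"
    by (simp only: div_mult_mod_eq)
  ultimately show ?thesis by blast
qed

text \<open>The dividend on the diagonal of \<open>hop_D_inv\<close> is the rounded 1; as its value
  is exactly 1, the quotient is a reciprocal.\<close>

lemma fp_round_one: "1 \<le> p \<Longrightarrow> fp_val (fp_round p 1) = 1"
proof -
  assume p: "1 \<le> p"
  have "int p < 2 ^ p" unfolding of_nat_less_numeral_power_cancel_iff by (rule less_exp)
  then have "int p - 1 < 2 ^ p" by linarith
  then have a: "(2 ^ (p - 1), 1 - int p) \<in> fp_set p" using p by (cases p) (auto simp: fp_set_def)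
  have v: "fp_val (2 ^ (p - 1), 1 - int p) = 1"
    using p by (cases p) (simp_all add: fp_val_def power_int_diff power_int_add power_int_minus)
  have "\<bar>fp_val (fp_round p 1) - 1\<bar> \<le> \<bar>fp_val (2 ^ (p - 1), 1 - int p) - 1\<bar>"
    using fp_round_props[of p 1] a by (auto simp: fp_nearest_def)
  then show ?thesis using v by simp
qed

definition computes_bits ::
  "nat \<Rightarrow> nat \<Rightarrow> 'b set \<Rightarrow> ('b \<Rightarrow> bool list) \<Rightarrow> nat \<Rightarrow> ('c \<Rightarrow> bool list) \<Rightarrow> nat \<Rightarrow> ('b \<Rightarrow> 'c) \<Rightarrow> bool" where
  "computes_bits s c D inp l out l' f \<longleftrightarrow>
     (\<forall>i<l'. thr D ((\<lambda>j a. inp a ! j) ` {..<l}) s True c (\<lambda>a. out (f a) ! i))"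

context tcp
begin

text \<open>The encoding shows \<open>p + 1\<close> bits of each component; all higher bits repeat
  the sign bit at position \<open>p\<close>.\<close>

lemma tf_bitsI:
  assumes F: "\<And>a. a \<in> D \<Longrightarrow> F a \<in> fp_set p"
    and b: "\<And>i. i < 2 * p + 2 \<Longrightarrow> T d (\<lambda>a. fp_bits p (F a) ! i)"
  shows "tf d F"
  unfolding tf_def
proof (intro conjI allI ballI)
  fix i
  have 1: "T d (\<lambda>a. bit (fst (F a)) i)" "T d (\<lambda>a. bit (snd (F a)) i)" if "i < p + 1" for i
    using b[of i] b[of "p + 1 + i"] fp_bits_nth[OF that] that by simp_all
  have sgn: "bit (fst (F a)) i = bit (fst (F a)) p \<and> bit (snd (F a)) i = bit (snd (F a)) p" if "a \<in> D" "p \<le> i" for a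
  proof -
    have "bit x i = bit x p" if x: "- (2 ^ p) \<le> x" "x < 2 ^ p" for x :: int
    proof (cases "x = - (2 ^ p)")
      case True
      have "bit (- (2 ^ p) :: int) k" if "p \<le> k" for k
        using that by (simp add: bit_minus_iff bit_mask_iff flip: mask_eq_exp_minus_1)
      then show ?thesis using True \<open>p \<le> i\<close> by simp
    next
      case False
      then have "\<bar>x\<bar> < 2 ^ p" using x by auto
      from bit_eq_sign[OF this \<open>p \<le> i\<close>] bit_eq_sign[OF this order_refl] show ?thesis by simp
    qed
    moreover have "\<bar>fst (F a)\<bar> < 2 ^ p" using fp_set_abs(1)[OF F[OF that(1)]] .
    moreover have "- (2 ^ p) \<le> snd (F a)" "snd (F a) < 2 ^ p"
      using F[OF that(1)] by (auto simp: fp_set_def split: prod.splits)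
    ultimately show ?thesis by (auto simp: abs_less_iff)
  qed
  show "T d (\<lambda>a. bit (fst (F a)) i)"
  proof (cases "i < p + 1")
    case False
    show ?thesis by (rule thr_cong[OF 1(1)[of p]]) (use False sgn in auto)
  qed (rule 1)
  show "T d (\<lambda>a. bit (snd (F a)) i)"
  proof (cases "i < p + 1")
    case False
    show ?thesis by (rule thr_cong[OF 1(2)[of p]]) (use False sgn in auto)
  qed (rule 1)
qed (rule F)

lemma tf_bits: "tf d F \<Longrightarrow> i < 2 * p + 2 \<Longrightarrow> T d (\<lambda>a. fp_bits p (F a) ! i)"
proof -
  assume F: "tf d F" and i: "i < 2 * p + 2"
  show ?thesis
  proof (cases "i < p + 1")
    case True
    then show ?thesis using F by (simp add: fp_bits_nth(1)[OF True] tf_def)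
  next
    case False
    then have "i - (p + 1) < p + 1" "p + 1 + (i - (p + 1)) = i" using i by auto
    with fp_bits_nth(2)[of "i - (p + 1)" p] F show ?thesis by (simp add: tf_def)
  qed
qed

section \<open>Matrices and Hopfield layers\<close>

definition tm :: "nat \<Rightarrow> nat \<Rightarrow> nat \<Rightarrow> ('a \<Rightarrow> fp mat) \<Rightarrow> bool" where
  "tm d r c F \<longleftrightarrow> (\<forall>a\<in>D. F a \<in> carrier_mat r c) \<and> (\<forall>i<r. \<forall>j<c. tf d (\<lambda>a. F a $$ (i, j)))"

lemma tm_carrier: "tm d r c F \<Longrightarrow> a \<in> D \<Longrightarrow> F a \<in> carrier_mat r c"
  by (simp add: tm_def)

lemma tm_entry: "tm d r c F \<Longrightarrow> i < r \<Longrightarrow> j < c \<Longrightarrow> tf d (\<lambda>a. F a $$ (i, j))"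
  by (simp add: tm_def)

lemma tm_mono: "tm d r c F \<Longrightarrow> d \<le> d' \<Longrightarrow> tm d' r c F"
  unfolding tm_def by (auto intro: tf_mono)

lemma tm_cong: "tm d r c F \<Longrightarrow> (\<And>a. a \<in> D \<Longrightarrow> F a = G a) \<Longrightarrow> tm d r c G"
  unfolding tm_def
proof (elim conjE, intro conjI allI impI ballI)
  fix i j
  assume "\<forall>i<r. \<forall>j<c. tf d (\<lambda>a. F a $$ (i, j))" "i < r" "j < c" and eq: "\<And>a. a \<in> D \<Longrightarrow> F a = G a"
  then have "tf d (\<lambda>a. F a $$ (i, j))" by blast
  then show "tf d (\<lambda>a. G a $$ (i, j))" by (rule tf_cong) (simp add: eq)
qed auto

lemma mats_entry: "A \<in> fp_mats p r c \<Longrightarrow> i < r \<Longrightarrow> j < c \<Longrightarrow> A $$ (i, j) \<in> fp_set p"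
  unfolding fp_mats_def using elements_matI[of A r c i j] by blast

lemma tm_mats: "tm d r c F \<Longrightarrow> a \<in> D \<Longrightarrow> F a \<in> fp_mats p r c"
  unfolding tm_def fp_mats_def tf_def by (auto simp: elements_mat_def)

lemma tm_const: "A \<in> fp_mats p r c \<Longrightarrow> tm d r c (\<lambda>_. A)"
  unfolding tm_def using mats_entry by (auto simp: fp_mats_def intro: tf_const)

lemma tm_mult:
  assumes F: "tm d r k F" and G: "tm d k c G" and k: "k \<le> z"
  shows "tm (d + 800) r c (\<lambda>a. fp_mat_mult p (F a) (G a))"
  unfolding tm_def
proof (intro conjI ballI allI impI)
  show "fp_mat_mult p (F a) (G a) \<in> carrier_mat r c" if "a \<in> D" for a
  proof -
    have "dim_row (F a) = r" "dim_col (G a) = c"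
      using tm_carrier[OF F that] tm_carrier[OF G that] by auto
    then show ?thesis by (simp add: fp_mat_mult_def)
  qed
  fix i j assume ij: "i < r" "j < c"
  have "tf (d + 300 + 500) (\<lambda>a. fp_round p (\<Sum>l<k. fp_val (fp_mult p (F a $$ (i, l)) (G a $$ (l, j)))))"
    by (intro tf_sum tf_mult k) (use ij in \<open>auto intro: tm_entry[OF F] tm_entry[OF G]\<close>)
  then have "tf (d + 800) (\<lambda>a. fp_round p (\<Sum>l<k. fp_val (fp_mult p (F a $$ (i, l)) (G a $$ (l, j)))))"
    by (simp add: add.commute)
  then show "tf (d + 800) (\<lambda>a. fp_mat_mult p (F a) (G a) $$ (i, j))"
  proof (rule tf_cong)
    fix a assume a: "a \<in> D"
    have FG: "F a \<in> carrier_mat r k" "G a \<in> carrier_mat k c"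
      using tm_carrier[OF F a] tm_carrier[OF G a] by auto
    then show "fp_round p (\<Sum>l<k. fp_val (fp_mult p (F a $$ (i, l)) (G a $$ (l, j)))) = fp_mat_mult p (F a) (G a) $$ (i, j)"
      using ij by (simp add: fp_mat_mult_def fp_sum_def comp_def sum_list_distinct_conv_sum_set atLeast0LessThan)
  qed
qed

lemma tm_smult:
  assumes b: "b \<in> fp_set p" and F: "tm d r c F"
  shows "tm (d + 300) r c (\<lambda>a. fp_smult p b (F a))"
  unfolding tm_def
proof (intro conjI ballI allI impI)
  show "fp_smult p b (F a) \<in> carrier_mat r c" if "a \<in> D" for a
    using F that by (auto simp: tm_def fp_smult_def)
  fix i j assume ij: "i < r" "j < c"
  have "tf (d + 300) (\<lambda>a. fp_mult p b (F a $$ (i, j)))"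
    using F ij b by (intro tf_mult tf_const) (auto simp: tm_def)
  then show "tf (d + 300) (\<lambda>a. fp_smult p b (F a) $$ (i, j))"
    by (rule tf_cong) (use F ij in \<open>auto simp: tm_def fp_smult_def\<close>)
qed

lemma tf_apply:
  assumes F: "tf d F" and ex: "\<And>x. x \<in> fp_set p \<Longrightarrow> ex x \<in> fp_set p"
    and c: "computes_bits (Z 40) c (fp_set p) (fp_bits p) (2 * p + 2) (fp_bits p) (2 * p + 2) ex"
  shows "tf (d + c) (\<lambda>a. ex (F a))"
proof (rule tf_bitsI)
  have FD: "F a \<in> fp_set p" if "a \<in> D" for a using F that by (simp add: tf_def)
  show "ex (F a) \<in> fp_set p" if "a \<in> D" for a using FD[OF that] by (rule ex)
  fix i assume "i < 2 * p + 2"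
  with c have "thr (fp_set p) ((\<lambda>j a. fp_bits p a ! j) ` {..<2 * p + 2}) (Z 40) True c (\<lambda>a. fp_bits p (ex a) ! i)"
    by (simp add: computes_bits_def)
  then show "T (d + c) (\<lambda>a. fp_bits p (ex (F a)) ! i)"
    by (rule thr_comp) (use FD tf_bits[OF F] in auto)
qed

lemma tm_bitsI:
  assumes F: "\<And>a. a \<in> D \<Longrightarrow> F a \<in> fp_mats p r q"
    and c: "\<And>k. k < r * (q * (2 * p + 2)) \<Longrightarrow> T d (\<lambda>a. fp_mat_bits p (F a) ! k)"
  shows "tm d r q F"
  unfolding tm_def
proof (intro conjI ballI allI impI)
  show "F a \<in> carrier_mat r q" if "a \<in> D" for a using F[OF that] by (simp add: fp_mats_def)
  fix i j assume ij: "i < r" "j < q"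
  show "tf d (\<lambda>a. F a $$ (i, j))"
  proof (rule tf_bitsI)
    show "F a $$ (i, j) \<in> fp_set p" if "a \<in> D" for a using mats_entry[OF F[OF that] ij] .
    fix b assume b: "b < 2 * p + 2"
    let ?k = "i * (q * (2 * p + 2)) + (j * (2 * p + 2) + b)"
    have "j * (2 * p + 2) + b < (j + 1) * (2 * p + 2)" using b by (simp add: algebra_simps)
    also have "\<dots> \<le> q * (2 * p + 2)" using ij by (intro mult_right_mono) auto
    finally have "?k < (i + 1) * (q * (2 * p + 2))" by (simp add: algebra_simps)
    also have "\<dots> \<le> r * (q * (2 * p + 2))" using ij by (intro mult_right_mono) auto
    finally have "T d (\<lambda>a. fp_mat_bits p (F a) ! ?k)" by (rule c)
    then show "T d (\<lambda>a. fp_bits p (F a $$ (i, j)) ! b)"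
    proof (rule thr_cong)
      show "fp_mat_bits p (F a) ! ?k = fp_bits p (F a $$ (i, j)) ! b" if "a \<in> D" for a
        by (rule fp_mat_bits_nth[OF _ ij b]) (use F[OF that] in \<open>simp add: fp_mats_def\<close>)
    qed
  qed
qed

lemma tm_bits:
  assumes F: "tm d r q F" and l: "l < r * (q * (2 * p + 2))"
  shows "T d (\<lambda>a. fp_mat_bits p (F a) ! l)"
proof -
  obtain i j b where ijb: "i < r" "j < q" "b < 2 * p + 2" "l = i * (q * (2 * p + 2)) + (j * (2 * p + 2) + b)"
    using mat_index_decompose[OF l] by blast
  have "T d (\<lambda>a. fp_bits p (F a $$ (i, j)) ! b)"
    using ijb by (intro tf_bits tm_entry[OF F])
  then show ?thesis
    by (rule thr_cong) (simp only: ijb(4) fp_mat_bits_nth[OF tm_carrier[OF F] ijb(1-3)])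
qed

lemma tm_apply:
  assumes F: "tm d r q F" and f: "\<And>A. A \<in> fp_mats p r q \<Longrightarrow> f A \<in> fp_mats p r q"
    and c: "computes_bits (Z 40) c (fp_mats p r q) (fp_mat_bits p) (r * (q * (2 * p + 2))) (fp_mat_bits p) (r * (q * (2 * p + 2))) f"
  shows "tm (d + c) r q (\<lambda>a. f (F a))"
proof (rule tm_bitsI)
  have FD: "F a \<in> fp_mats p r q" if "a \<in> D" for a using tm_mats[OF F that] .
  then show "f (F a) \<in> fp_mats p r q" if "a \<in> D" for a using f that by blast
  fix k assume "k < r * (q * (2 * p + 2))"
  with c have "thr (fp_mats p r q) ((\<lambda>j a. fp_mat_bits p a ! j) ` {..<r * (q * (2 * p + 2))}) (Z 40) True c (\<lambda>a. fp_mat_bits p (f a) ! k)"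
    unfolding computes_bits_def by blast
  then show "T (d + c) (\<lambda>a. fp_mat_bits p (f (F a)) ! k)"
    by (rule thr_comp) (use FD tm_bits[OF F] in auto)
qed

lemma transpose_mats: "A \<in> fp_mats p r c \<Longrightarrow> transpose_mat A \<in> fp_mats p c r"
  unfolding fp_mats_def by (auto simp: elements_mat_def)

context
  fixes ex :: "nat \<Rightarrow> fp \<Rightarrow> fp" and c0 n q :: nat and H :: hop_params and R :: "'a \<Rightarrow> fp mat"
  assumes ex: "\<And>x. x \<in> fp_set p \<Longrightarrow> ex p x \<in> fp_set p"
    and exc: "computes_bits (Z 40) c0 (fp_set p) (fp_bits p) (2 * p + 2) (fp_bits p) (2 * p + 2) (ex p)"
    and nz: "n \<le> z" and qz: "q \<le> z" and H: "hop_params_wf p n q H"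
begin

lemma tm_hop_A:
  assumes R: "tm d n q R"
  shows "tm (d + 2700 + c0) n n (\<lambda>a. hop_A p ex H (R a))"
proof -
  note h = H[unfolded hop_params_wf_def]
  let ?P = "\<lambda>a. fp_smult p (beta H) (fp_mat_mult p (fp_mat_mult p (fp_mat_mult p (R a) (WQ H))
          (transpose_mat (WK H))) (transpose_mat (stored H)))"
  have P: "tm (d + 800 + 800 + 800 + 300) n n ?P"
    by (rule tm_smult[OF _ tm_mult[OF tm_mult[OF tm_mult[OF R tm_const qz] tm_const[OF transpose_mats] qz]
        tm_const[OF transpose_mats] qz]]) (use h in auto)
  have "tm (d + 2700 + c0) n n (\<lambda>a. map_mat (ex p) (?P a))"
    unfolding tm_def
  proof (intro conjI ballI allI impI)
    show "map_mat (ex p) (?P a) \<in> carrier_mat n n" if "a \<in> D" for a using P that by (simp add: tm_def)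
    fix i j assume ij: "i < n" "j < n"
    have "tf (d + 2700 + c0) (\<lambda>a. ex p (?P a $$ (i, j)))"
      by (rule tf_apply[OF _ ex exc]) (use P ij in \<open>auto simp: tm_def add.assoc\<close>)
    then show "tf (d + 2700 + c0) (\<lambda>a. map_mat (ex p) (?P a) $$ (i, j))"
      by (rule tf_cong) (use P ij in \<open>auto simp: tm_def\<close>)
  qed
  then show ?thesis by (simp add: hop_A_def)
qed

lemma tm_hop_D:
  assumes R: "tm d n q R"
  shows "tm (d + 3800 + c0) n 1 (\<lambda>a. hop_D p ex H (R a))"
proof -
  note h = H[unfolded hop_params_wf_def] and A = tm_hop_A[OF R]
  have one: "mat n 1 (\<lambda>_. fp_round p 1) \<in> fp_mats p n 1"
    by (auto simp: fp_mats_def elements_mat_def fp_round_in)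
  have "tm (d + 2700 + c0 + 800 + 300) n 1 (\<lambda>a. fp_smult p (beta H) (fp_mat_mult p (hop_A p ex H (R a)) (mat n 1 (\<lambda>_. fp_round p 1))))"
    by (rule tm_smult[OF _ tm_mult[OF A tm_const[OF one] nz]]) (use h in auto)
  then have "tm (d + 3800 + c0) n 1 (\<lambda>a. fp_smult p (beta H) (fp_mat_mult p (hop_A p ex H (R a)) (mat n 1 (\<lambda>_. fp_round p 1))))"
    by (rule tm_mono) simp
  then show ?thesis
    by (rule tm_cong) (use A in \<open>auto simp: hop_D_def Let_def tm_def\<close>)
qed

text \<open>The condition \<open>nonzero\<close> concerns the domain only, which is exactly where
  \<open>no_zero_division\<close> provides it.\<close>

lemma tm_hop:
  assumes R: "tm d n q R"
    and nonzero: "\<And>a i. a \<in> D \<Longrightarrow> i < n \<Longrightarrow> fp_val (hop_D p ex H (R a) $$ (i, 0)) \<noteq> 0"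
  shows "tm (d + 7000 + c0) n q (\<lambda>a. hop p ex H (R a))"
proof -
  note h = H[unfolded hop_params_wf_def] and A = tm_hop_A[OF R] and Dm = tm_hop_D[OF R]
  have I: "tm (d + 4300 + c0) n n (\<lambda>a. hop_D_inv p ex H (R a))"
    unfolding tm_def
  proof (intro conjI ballI allI impI)
    show "hop_D_inv p ex H (R a) \<in> carrier_mat n n" if "a \<in> D" for a using R that by (auto simp: hop_D_inv_def tm_def)
    fix i j assume ij: "i < n" "j < n"
    show "tf (d + 4300 + c0) (\<lambda>a. hop_D_inv p ex H (R a) $$ (i, j))"
    proof (cases "i = j")
      case True
      have "tf (d + 3800 + c0 + 500) (\<lambda>a. fp_round p (1 / fp_val (hop_D p ex H (R a) $$ (i, 0))))"
        by (rule tf_recip) (use Dm nonzero ij in \<open>auto simp: tm_def\<close>)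
      then have "tf (d + 4300 + c0) (\<lambda>a. fp_round p (1 / fp_val (hop_D p ex H (R a) $$ (i, 0))))"
        by (rule tf_mono) simp
      then show ?thesis
        by (rule tf_cong) (use R ij True fp_round_one[OF p1] in \<open>auto simp: hop_D_inv_def fp_div_def tm_def\<close>)
    next
      case False
      have "tf (d + 4300 + c0) (\<lambda>a. fp_round p 0)" by (intro tf_const fp_round_in)
      then show ?thesis
        by (rule tf_cong) (use R ij False in \<open>auto simp: hop_D_inv_def tm_def\<close>)
    qed
  qed
  have "tm (d + 4300 + c0 + 800 + 800 + 800) n q (\<lambda>a. hop p ex H (R a))"
    unfolding hop_def
    by (rule tm_mult[OF tm_mult[OF tm_mult[OF I tm_mono[OF A] nz] tm_const nz] tm_const qz]) (use h in auto)
  then show ?thesis by (rule tm_mono) simp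
qed

end

end

section \<open>Polynomial bounds and circuit families\<close>

lemma poly_bounded_iff: "poly_bounded s \<longleftrightarrow> (\<exists>k. \<forall>n. s n \<le> (n + 2) ^ k)"
proof
  assume "poly_bounded s"
  then obtain k where "(\<lambda>n. real (s n)) \<in> O(\<lambda>n. real n ^ k)" by (auto simp: poly_bounded_def)
  then obtain c where "\<forall>\<^sub>F n in sequentially. norm (real (s n)) \<le> c * norm (real n ^ k)"
    by (auto elim!: landau_o.bigE)
  then obtain n0 where n0: "\<And>n. n0 \<le> n \<Longrightarrow> real (s n) \<le> c * real n ^ k"
    by (auto simp: eventually_sequentially)
  \<comment> \<open>One constant for the asymptotic factor and for the finitely many exceptions. The
    base absorbs it, because \<open>C < 2 ^ C \<le> (n + 2) ^ C\<close>.\<close>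
  define C where "C = nat \<lceil>\<bar>c\<bar>\<rceil> + (\<Sum>n<n0. s n)"
  have "s n \<le> (n + 2) ^ (k + C)" for n
  proof -
    have "s n \<le> C * (n + 2) ^ k"
    proof (cases "n < n0")
      case True
      then have "s n \<le> (\<Sum>n<n0. s n)" by (intro member_le_sum) auto
      also have "\<dots> \<le> C" by (simp add: C_def)
      also have "C \<le> C * (n + 2) ^ k" by simp
      finally show ?thesis .
    next
      case False
      have "real (s n) \<le> c * real n ^ k" using n0 False by simp
      also have "\<dots> \<le> real C * real ((n + 2) ^ k)"
      proof (intro mult_mono)
        have "c \<le> real (nat \<lceil>\<bar>c\<bar>\<rceil>)" by linarith
        also have "\<dots> \<le> real C" by (simp only: of_nat_le_iff C_def le_add1)
        finally show "c \<le> real C" .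
        show "real n ^ k \<le> real ((n + 2) ^ k)" by (simp add: power_mono)
      qed auto
      also have "\<dots> = real (C * (n + 2) ^ k)" by simp
      finally show ?thesis by (simp only: of_nat_le_iff)
    qed
    also have "C \<le> (n + 2) ^ C" using less_exp[of C] power_mono[of 2 "n + 2" C] by linarith
    then have "C * (n + 2) ^ k \<le> (n + 2) ^ C * (n + 2) ^ k" by (rule mult_right_mono) simp
    also have "\<dots> = (n + 2) ^ (k + C)" by (simp add: power_add)
    finally show ?thesis .
  qed
  then show "\<exists>k. \<forall>n. s n \<le> (n + 2) ^ k" by blast
next
  assume "\<exists>k. \<forall>n. s n \<le> (n + 2) ^ k"
  then obtain k where k: "\<And>n. s n \<le> (n + 2) ^ k" by blast
  have "(\<lambda>n. real (s n)) \<in> O(\<lambda>n. real n ^ k)"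
  proof (rule landau_o.bigI[where c = "3 ^ k"])
    show "\<forall>\<^sub>F n in sequentially. norm (real (s n)) \<le> 3 ^ k * norm (real n ^ k)"
      unfolding eventually_sequentially
    proof (intro exI allI impI)
      fix n :: nat assume "1 \<le> n"
      have "s n \<le> (n + 2) ^ k" by (rule k)
      also have "\<dots> \<le> (3 * n) ^ k" using \<open>1 \<le> n\<close> by (intro power_mono) auto
      finally have "real (s n) \<le> real ((3 * n) ^ k)" by (simp only: of_nat_le_iff)
      then show "norm (real (s n)) \<le> 3 ^ k * norm (real n ^ k)" by (simp add: power_mult_distrib)
    qed
  qed simp
  then show "poly_bounded s" by (auto simp: poly_bounded_def)
qed

lemma poly_bounded_add: "poly_bounded s \<Longrightarrow> poly_bounded t \<Longrightarrow> poly_bounded (\<lambda>n. s n + t n)"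
proof -
  assume "poly_bounded s" "poly_bounded t"
  then obtain k l where kl: "\<And>n. s n \<le> (n + 2) ^ k" "\<And>n. t n \<le> (n + 2) ^ l" by (auto simp: poly_bounded_iff)
  have "s n + t n \<le> (n + 2) ^ (k + l + 1)" for n
  proof -
    have "s n \<le> (n + 2) ^ (k + l)" "t n \<le> (n + 2) ^ (k + l)"
      using kl[of n] by (auto intro: order_trans power_increasing)
    then have "s n + t n \<le> 2 * (n + 2) ^ (k + l)" by simp
    also have "\<dots> \<le> (n + 2) * (n + 2) ^ (k + l)" by (intro mult_right_mono) auto
    finally show ?thesis by (simp only: Suc_eq_plus1[symmetric] power_Suc)
  qed
  then show ?thesis unfolding poly_bounded_iff by blast
qed

lemma poly_bounded_mono: "poly_bounded t \<Longrightarrow> (\<And>n. s n \<le> t n) \<Longrightarrow> poly_bounded s"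
  by (auto simp: poly_bounded_iff intro: order_trans)

lemma poly_bounded_const: "poly_bounded (\<lambda>_. c)"
  unfolding poly_bounded_iff
proof (intro exI allI)
  show "c \<le> (n + 2) ^ c" for n using less_exp[of c] power_mono[of 2 "n + 2" c] by linarith
qed

lemma poly_bounded_id: "poly_bounded (\<lambda>n. n)"
  unfolding poly_bounded_iff by (intro exI[of _ 1]) simp

lemma poly_bounded_power: "poly_bounded s \<Longrightarrow> poly_bounded (\<lambda>n. s n ^ k)"
proof -
  assume "poly_bounded s"
  then obtain l where l: "\<And>n. s n \<le> (n + 2) ^ l" by (auto simp: poly_bounded_iff)
  have "s n ^ k \<le> (n + 2) ^ (l * k)" for n
    using power_mono[OF l[of n], of k] by (simp add: power_mult)
  then show ?thesis by (auto simp: poly_bounded_iff)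
qed

lemma poly_bounded_comp: "poly_bounded s \<Longrightarrow> poly_bounded p \<Longrightarrow> poly_bounded (\<lambda>n. s (p n))"
proof -
  assume "poly_bounded s" "poly_bounded p"
  then obtain k where k: "\<And>n. s n \<le> (n + 2) ^ k" by (auto simp: poly_bounded_iff)
  show ?thesis
    by (rule poly_bounded_mono[OF poly_bounded_power[OF poly_bounded_add[OF \<open>poly_bounded p\<close> poly_bounded_const[of 2]], of k] k])
qed

lemma poly_bounded_sum: "(\<And>i. i < m \<Longrightarrow> poly_bounded (s i)) \<Longrightarrow> poly_bounded (\<lambda>n. \<Sum>i<m. s i n)"
  for m :: nat
  by (induction m) (auto intro: poly_bounded_add poly_bounded_const)

lemma tc0_computable_bits:
  assumes "tc0_computable D inp out f"
  shows "\<exists>c s. poly_bounded s \<and> (\<forall>n s' l l'. s n \<le> s' \<longrightarrow>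
     (\<forall>a\<in>D n. length (inp n a) = l \<and> length (out n (f n a)) = l') \<longrightarrow>
     computes_bits s' c (D n) (inp n) l (out n) l' (f n))"
proof -
  from assms obtain C c where C: "\<And>n. circuit_wf (C n)" "\<And>n. circuit_depth (C n) \<le> c" "poly_bounded (\<lambda>n. circuit_size (C n))"
    "\<And>n a. a \<in> D n \<Longrightarrow> length (inp n a) = n_in (C n) \<and> circuit_eval (C n) (inp n a) = out n (f n a)"
    unfolding tc0_computable_def by blast
  have "computes_bits s' c (D n) (inp n) l (out n) l' (f n)"
    if s': "circuit_size (C n) \<le> s'" and len: "\<forall>a\<in>D n. length (inp n a) = l \<and> length (out n (f n a)) = l'" for n s' l l'
  proof (cases "D n = {}")
    \<comment> \<open>On an empty domain the circuit says nothing about the lengths \<open>l\<close>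
      and \<open>l'\<close>, but there \<open>thr_cong\<close> makes every function a
      formula.\<close>
    case True
    have "thr {} X s' True c g" for X g
      by (rule thr_cong[OF thr_const[of "{}" X s' True c True]]) auto
    then show ?thesis unfolding True computes_bits_def by blast
  next
    case False
    then obtain a0 where a0: "a0 \<in> D n" by blast
    have l: "l = n_in (C n)" "l' = length (outs (C n))"
      using len C(4)[OF a0] a0 by (auto simp: circuit_eval_def dest!: arg_cong[of _ _ length])
    show ?thesis unfolding computes_bits_def
    proof (intro allI impI)
      fix i assume "i < l'"
      then have "thr {x. length x = n_in (C n)} ((\<lambda>i x. x ! i) ` {..<n_in (C n)}) s' True c (\<lambda>x. circuit_eval (C n) x ! i)"
        using gate_ok_size[OF s'] by (intro circuit_thr C) (auto simp: l)
      then have "thr (D n) ((\<lambda>j a. inp n a ! j) ` {..<l}) s' True (0 + c) (\<lambda>a. circuit_eval (C n) (inp n a) ! i)"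
        by (rule thr_comp) (use C(4) in \<open>auto simp: l intro!: thr_input\<close>)
      then show "thr (D n) ((\<lambda>j a. inp n a ! j) ` {..<l}) s' True c (\<lambda>a. out n (f n a) ! i)"
        by (rule thr_cong[OF thr_mono]) (use C(4) in auto)
    qed
  qed
  then show ?thesis using C(3) by blast
qed

section \<open>Networks as threshold formulas\<close>

lemma mhn_thr:
  assumes fam: "mhn_family p d N" and sol: "mhn_solves ex p d N inst yes" and exa: "fp_exp_approx ex"
  shows "\<exists>c s. poly_bounded s \<and>
    (\<forall>n. thr {x\<in>inst. length x = n} ((\<lambda>j x. x ! j) ` {..<n}) (s n) True c (\<lambda>x. x \<in> yes))"
proof -
  note fam = fam[unfolded mhn_family_def]
  from sol obtain enc where enc:
    "tc0_computable (\<lambda>n. {x \<in> inst. length x = n}) (\<lambda>n x. x) (\<lambda>n. fp_mat_bits (p n)) enc"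
    "\<And>n x. x \<in> inst \<Longrightarrow> length x = n \<Longrightarrow> enc n x \<in> fp_mats (p n) n (d n) \<and>
       no_zero_division (p n) ex (N n) (enc n x) \<and>
       (x \<in> yes \<longleftrightarrow> 0 < fp_val (mhn_eval (p n) ex (N n) (enc n x) $$ (0, 0)))"
    unfolding mhn_solves_def by blast
  have wf: "\<And>n. 0 < p n" "\<And>n. 0 < d n" "\<And>n. mhn_wf (p n) n (d n) (N n)" and pp: "poly_bounded p"
    using fam by auto
  have dp: "poly_bounded d" unfolding poly_bounded_def using fam by (intro exI[of _ 1]) simp
  obtain m where m: "\<And>n. length (layers (N n)) \<le> m" using fam by blast
  have exin: "ex q x \<in> fp_set q" if "x \<in> fp_set q" for q x
    using exa that fp_round_in unfolding fp_exp_approx_def by metis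
  have mlen: "length (fp_mat_bits q A) = r * (c * (2 * q + 2))" if "A \<in> fp_mats q r c" for A q r c
    using that by (intro fp_mat_bits_length) (simp add: fp_mats_def)
  obtain ce se where e: "poly_bounded se" "\<And>q s. se q \<le> s \<Longrightarrow>
      computes_bits s ce (fp_set q) (fp_bits q) (2 * q + 2) (fp_bits q) (2 * q + 2) (ex q)"
  proof -
    have "tc0_computable fp_set fp_bits fp_bits ex" using exa by (simp add: fp_exp_approx_def)
    moreover have "\<forall>a\<in>fp_set q. length (fp_bits q a) = 2 * q + 2 \<and> length (fp_bits q (ex q a)) = 2 * q + 2" for q by simp
    ultimately show thesis using tc0_computable_bits[of fp_set fp_bits fp_bits ex] that by meson
  qed
  have "\<forall>a\<in>{x \<in> inst. length x = n}. length a = n \<and> length (fp_mat_bits (p n) (enc n a)) = n * (d n * (2 * p n + 2))" for n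
    using enc(2) mlen by blast
  with tc0_computable_bits[OF enc(1)] obtain cn sn where n: "poly_bounded sn" "\<And>n s. sn n \<le> s \<Longrightarrow>
      computes_bits s cn {x\<in>inst. length x = n} (\<lambda>x. x) n (fp_mat_bits (p n)) (n * (d n * (2 * p n + 2))) (enc n)"
    by meson
  have preM: "pre (N n) A \<in> fp_mats (p n) n (d n)" if "A \<in> fp_mats (p n) n (d n)" for n A
    using wf(3)[of n] that unfolding mhn_wf_def by blast
  have layM: "hop_params_wf (p n) n (d n) (fst (layers (N n) ! i))"
    "A \<in> fp_mats (p n) n (d n) \<Longrightarrow> snd (layers (N n) ! i) A \<in> fp_mats (p n) n (d n)" if "i < length (layers (N n))" for n i A
  proof -
    have "layers (N n) ! i \<in> set (layers (N n))" using that by simp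
    with wf(3)[of n] show "hop_params_wf (p n) n (d n) (fst (layers (N n) ! i))"
      "A \<in> fp_mats (p n) n (d n) \<Longrightarrow> snd (layers (N n) ! i) A \<in> fp_mats (p n) n (d n)"
      unfolding mhn_wf_def by (auto simp: case_prod_unfold)
  qed
  have "tc0_computable (\<lambda>n. fp_mats (p n) n (d n)) (\<lambda>n. fp_mat_bits (p n)) (\<lambda>n. fp_mat_bits (p n)) (\<lambda>n. pre (N n))"
    using fam by blast
  moreover have "\<forall>a\<in>fp_mats (p n) n (d n). length (fp_mat_bits (p n) a) = n * (d n * (2 * p n + 2)) \<and>
      length (fp_mat_bits (p n) (pre (N n) a)) = n * (d n * (2 * p n + 2))" for n
    using preM mlen by blast
  ultimately obtain cp sp where pr: "poly_bounded sp" "\<And>n s. sp n \<le> s \<Longrightarrow>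
      computes_bits s cp (fp_mats (p n) n (d n)) (fp_mat_bits (p n)) (n * (d n * (2 * p n + 2)))
        (fp_mat_bits (p n)) (n * (d n * (2 * p n + 2))) (pre (N n))"
    using tc0_computable_bits[of "\<lambda>n. fp_mats (p n) n (d n)" "\<lambda>n. fp_mat_bits (p n)" "\<lambda>n. fp_mat_bits (p n)" "\<lambda>n. pre (N n)"]
    by meson
  have "\<exists>c s. poly_bounded s \<and> (\<forall>n s'. s n \<le> s' \<longrightarrow> i < length (layers (N n)) \<longrightarrow>
      computes_bits s' c (fp_mats (p n) n (d n)) (fp_mat_bits (p n)) (n * (d n * (2 * p n + 2)))
        (fp_mat_bits (p n)) (n * (d n * (2 * p n + 2))) (snd (layers (N n) ! i)))" for i
  proof -
    have "tc0_computable (\<lambda>n. if i < length (layers (N n)) then fp_mats (p n) n (d n) else {})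
            (\<lambda>n. fp_mat_bits (p n)) (\<lambda>n. fp_mat_bits (p n)) (\<lambda>n. snd (layers (N n) ! i))" using fam by blast
    from tc0_computable_bits[OF this] obtain c s where cs: "poly_bounded s"
      "\<And>n s' l l'. s n \<le> s' \<Longrightarrow> \<forall>a\<in>if i < length (layers (N n)) then fp_mats (p n) n (d n) else {}.
         length (fp_mat_bits (p n) a) = l \<and> length (fp_mat_bits (p n) (snd (layers (N n) ! i) a)) = l' \<Longrightarrow>
       computes_bits s' c (if i < length (layers (N n)) then fp_mats (p n) n (d n) else {}) (fp_mat_bits (p n)) l
        (fp_mat_bits (p n)) l' (snd (layers (N n) ! i))" by blast
    have "computes_bits s' c (fp_mats (p n) n (d n)) (fp_mat_bits (p n)) (n * (d n * (2 * p n + 2)))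
        (fp_mat_bits (p n)) (n * (d n * (2 * p n + 2))) (snd (layers (N n) ! i))" if "s n \<le> s'" "i < length (layers (N n))" for n s'
      using cs(2)[OF that(1), of "n * (d n * (2 * p n + 2))" "n * (d n * (2 * p n + 2))"] that(2) mlen layM(2)[OF that(2)] by simp
    with cs(1) show ?thesis by blast
  qed
  then obtain cl sl where l: "\<And>i. poly_bounded (sl i)" "\<And>i n s'. sl i n \<le> s' \<Longrightarrow> i < length (layers (N n)) \<Longrightarrow>
      computes_bits s' (cl i) (fp_mats (p n) n (d n)) (fp_mat_bits (p n)) (n * (d n * (2 * p n + 2)))
        (fp_mat_bits (p n)) (n * (d n * (2 * p n + 2))) (snd (layers (N n) ! i))" by metis
  \<comment> \<open>One bound for all dimensions, the precision and all circuit sizes, so that a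
    single instance of the locale serves the whole network.\<close>
  define z where "z n = 16 + n + p n + d n + se (p n) + sp n + sn n + (\<Sum>i<m. sl i n)" for n
  have zp: "poly_bounded z" unfolding z_def
    by (intro poly_bounded_add poly_bounded_const poly_bounded_id pp dp pr(1) n(1) poly_bounded_sum l(1) poly_bounded_comp[OF e(1) pp])
  \<comment> \<open>A depth for any one layer. The sum over \<open>i < m\<close> dominates the depth
    of each map between layers, independently of \<open>n\<close>.\<close>
  define cL where "cL = 7000 + ce + (\<Sum>i<m. cl i)"
  have main: "thr {x\<in>inst. length x = n} ((\<lambda>j x. x ! j) ` {..<n}) (z n ^ 40) True (cn + cp + m * cL + 20) (\<lambda>x. x \<in> yes)" for n
  proof (cases "n = 0")
    \<comment> \<open>A matrix without rows has no entry \<open>(0, 0)\<close>, but at length 0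
      there is only one string.\<close>
    case True
    show ?thesis by (rule thr_cong[OF thr_const[of _ _ _ _ _ "[] \<in> yes"]]) (simp add: True)
  next
    case n0: False
    let ?D = "{x\<in>inst. length x = n}" and ?X = "(\<lambda>j x. x ! j) ` {..<n} :: (bool list \<Rightarrow> bool) set"
    interpret tcp ?D ?X "z n" "p n"
      using wf(1)[of n] by unfold_locales (auto simp: z_def)
    have zZ: "z n \<le> Z 40" by (rule Z_mono[of _ 1]) (simp_all add: Z_def)
    have les: "se (p n) \<le> Z 40" "sp n \<le> Z 40" "sn n \<le> Z 40" "i < m \<Longrightarrow> sl i n \<le> Z 40" for i
      using zZ member_le_sum[of i "{..<m}" "\<lambda>i. sl i n"] by (auto simp: z_def)
    have encM: "enc n x \<in> fp_mats (p n) n (d n)" if "x \<in> ?D" for x using enc(2)[of x n] that by simp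
    have E: "tm cn n (d n) (enc n)"
      by (rule tm_bitsI[OF encM]) (use n(2)[OF les(3)] in \<open>auto simp: computes_bits_def\<close>)
    have P: "tm (cn + cp) n (d n) (\<lambda>x. pre (N n) (enc n x))"
      by (rule tm_apply[OF E preM pr(2)[OF les(2)]])
    have L: "tm (cn + cp + i * cL) n (d n) (\<lambda>x. run_layers (p n) ex (take i (layers (N n))) (pre (N n) (enc n x)))"
      if "i \<le> length (layers (N n))" for i
      using that
    proof (induction i)
      case 0
      then show ?case using P by (simp add: run_layers_def)
    next
      case (Suc i)
      let ?L = "layers (N n)"
      define F where "F x = run_layers (p n) ex (take i ?L) (pre (N n) (enc n x))" for x
      have i: "i < length ?L" "i < m" using Suc.prems m[of n] by auto
      have IH: "tm (cn + cp + i * cL) n (d n) F" using Suc by (simp add: F_def[abs_def])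
      have "tm (cn + cp + i * cL + 7000 + ce) n (d n) (\<lambda>x. hop (p n) ex (fst (?L ! i)) (F x))"
      proof (rule tm_hop[where ex = ex, OF exin e(2)[OF les(1)] _ _ layM(1)[OF i(1)] IH])
        fix x r assume x: "x \<in> ?D" and r: "r < n"
        have "dim_row (enc n x) = n" using encM[OF x] by (auto simp: fp_mats_def)
        with r have r': "r < dim_row (enc n x)" by simp
        have "no_zero_division (p n) ex (N n) (enc n x)" using enc(2)[of x n] x by simp
        from this[unfolded no_zero_division_def, rule_format, OF i(1) r']
        show "fp_val (hop_D (p n) ex (fst (?L ! i)) (F x) $$ (r, 0)) \<noteq> 0"
          unfolding F_def .
      qed (auto simp: z_def)
      from tm_apply[OF this layM(2)[OF i(1)] l(2)[OF les(4)[OF i(2)] i(1)]]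
      have "tm (cn + cp + i * cL + 7000 + ce + cl i) n (d n) (\<lambda>x. snd (?L ! i) (hop (p n) ex (fst (?L ! i)) (F x)))" .
      moreover have "cl i \<le> (\<Sum>i<m. cl i)" using i(2) by (intro member_le_sum) auto
      ultimately have "tm (cn + cp + Suc i * cL) n (d n) (\<lambda>x. snd (?L ! i) (hop (p n) ex (fst (?L ! i)) (F x)))"
        by (rule_tac tm_mono) (auto simp: cL_def)
      then show ?case
        using i(1) by (simp add: take_Suc_conv_app_nth run_layers_def F_def case_prod_unfold)
    qed
    from L[OF order_refl] have "tm (cn + cp + m * cL) n (d n) (\<lambda>x. mhn_eval (p n) ex (N n) (enc n x))"
      unfolding mhn_eval_def take_all[OF order_refl] by (rule tm_mono) (use m[of n] in simp)
    from tm_entry[OF this, of 0 0] have t: "tf (cn + cp + m * cL) (\<lambda>x. mhn_eval (p n) ex (N n) (enc n x) $$ (0, 0))"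
      using n0 wf(2)[of n] by simp
    have "p n \<le> Z 8" by (rule Z_mono[OF p_Z]) simp
    from T_neg[OF ti_uminus[OF tf_ti(1)[OF t] this]]
    have "thr ?D ?X (Z 40) True (cn + cp + m * cL + 20) (\<lambda>x. x \<in> yes)"
    proof (rule thr_mono[THEN thr_cong])
      fix x assume "x \<in> ?D"
      then have "x \<in> yes \<longleftrightarrow> 0 < fp_val (mhn_eval (p n) ex (N n) (enc n x) $$ (0, 0))" using enc(2)[of x n] by simp
      also have "\<dots> \<longleftrightarrow> 0 < fst (mhn_eval (p n) ex (N n) (enc n x) $$ (0, 0))"
        using mult_less_cancel_right_pos[of "2 powi snd (mhn_eval (p n) ex (N n) (enc n x) $$ (0, 0))" 0
            "real_of_int (fst (mhn_eval (p n) ex (N n) (enc n x) $$ (0, 0)))"]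
        by (simp add: fp_val_def)
      finally show "(- fst (mhn_eval (p n) ex (N n) (enc n x) $$ (0, 0)) < 0) = (x \<in> yes)" by simp
    qed simp
    then show ?thesis by (simp add: Z_def)
  qed
  show ?thesis using main poly_bounded_power[OF zp, of 40] by blast
qed

section \<open>Majority in logarithmic depth\<close>

text \<open>Bitwise parity and bitwise majority involve no propagation of carries, so three numbers
  are turned into two in constant depth.\<close>

lemma full_adder:
  fixes x y w :: nat
  shows "x + y + w = xor x (xor y w) + 2 * or (and x y) (and w (or x y))"
proof -
  let ?s = "xor x (xor y w)" and ?m = "or (and x y) (and w (or x y))"
  have "take_bit n x + take_bit n y + take_bit n w = take_bit n ?s + 2 * take_bit n ?m" for n
  proof (induction n)
    case (Suc n)
    have "of_bool (bit x n) + of_bool (bit y n) + of_bool (bit w n) =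
        of_bool (bit ?s n) + 2 * (of_bool (bit ?m n) :: nat)"
      by (auto simp: bit_xor_iff bit_and_iff bit_or_iff)
    then have "2 ^ n * (of_bool (bit x n) + of_bool (bit y n) + of_bool (bit w n)) =
        2 ^ n * (of_bool (bit ?s n) + 2 * (of_bool (bit ?m n) :: nat))" by (simp only:)
    with Suc show ?case unfolding take_bit_Suc_from_most distrib_left by linarith
  qed simp
  \<comment> \<open>Any length at which truncation changes none of the five numbers will do; their
    sum is such a length.\<close>
  from this[of "x + y + w + ?s + ?m"] show ?thesis
    by (simp add: take_bit_nat_eq_self less_le_trans[OF less_exp power_increasing])
qed

lemma bit_double_nat: "bit (2 * x) i \<longleftrightarrow> 0 < i \<and> bit x (i - 1)" for x :: nat
  by (cases i) (auto simp: bit_0 bit_Suc)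

context
  fixes D :: "'a set" and X :: "('a \<Rightarrow> bool) set"
begin

abbreviation F2 :: "nat \<Rightarrow> ('a \<Rightarrow> bool) \<Rightarrow> bool" where "F2 \<equiv> thr D X 2 False"

abbreviation bits2 :: "nat \<Rightarrow> ('a \<Rightarrow> nat) \<Rightarrow> bool" where
  "bits2 d A \<equiv> \<forall>i. F2 d (\<lambda>a. bit (A a) i)"

lemma three_to_two:
  assumes "bits2 d A" "bits2 d B" "bits2 d C"
  shows "\<exists>S M. bits2 (d + 6) S \<and> bits2 (d + 6) M \<and> (\<forall>a. A a + B a + C a = S a + M a)"
proof (intro exI conjI allI)
  fix i
  let ?f = "\<lambda>A i a. bit ((A :: 'a \<Rightarrow> nat) a) i"
  have "F2 (d + 6) (\<lambda>a. ?f A i a \<noteq> (?f B i a \<noteq> ?f C i a))"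
    by (rule thr_mono) (rule thr_xor assms[THEN spec] | simp)+
  then show "F2 (d + 6) (\<lambda>a. bit (xor (A a) (xor (B a) (C a))) i)"
    by (rule thr_cong) (auto simp: bit_xor_iff)
  have "F2 (d + 6) (\<lambda>a. (?f A j a \<and> ?f B j a) \<or> (?f C j a \<and> (?f A j a \<or> ?f B j a)))" for j
    by (rule thr_mono) (rule thr_conj thr_disj assms[THEN spec] | simp)+
  then have "F2 (d + 6) (\<lambda>a. 0 < i \<and> ((?f A (i - 1) a \<and> ?f B (i - 1) a) \<or> (?f C (i - 1) a \<and> (?f A (i - 1) a \<or> ?f B (i - 1) a))))"
    by (intro thr_and_const)
  then show "F2 (d + 6) (\<lambda>a. bit (2 * or (and (A a) (B a)) (and (C a) (or (A a) (B a)))) i)"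
    by (rule thr_cong) (auto simp: bit_double_nat bit_and_iff bit_or_iff)
qed (rule full_adder)

text \<open>A count is kept as an unevaluated sum of two numbers. Merging two halves turns four
  numbers into two by two steps of depth 6, whence 12 levels for each doubling.\<close>

lemma count_pair:
  assumes "\<And>f. f \<in> set fs \<Longrightarrow> F2 d f" "length fs \<le> 2 ^ k"
  shows "\<exists>A B. bits2 (d + 12 * k) A \<and> bits2 (d + 12 * k) B \<and> (\<forall>a. A a + B a = length (filter (\<lambda>f. f a) fs))"
  using assms
proof (induction k arbitrary: fs)
  case 0
  then consider "fs = []" | f where "fs = [f]" by (cases fs) auto
  then show ?case
  proof cases
    case 1
    then show ?thesis by (intro exI[of _ "\<lambda>_. 0"]) (auto intro: thr_const)
  next
    case 2
    have "F2 d (\<lambda>a. i = 0 \<and> f a)" for i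
      using 0(1)[of f] 2 by (intro thr_and_const) auto
    then have "F2 d (\<lambda>a. bit (of_bool (f a) :: nat) i)" for i
      by (rule thr_cong) (auto simp: of_bool_def bit_1_iff simp del: One_nat_def)
    then show ?thesis using 2
      by (intro exI[of _ "\<lambda>a. of_bool (f a)"] exI[of _ "\<lambda>_. 0"]) (auto intro: thr_const)
  qed
next
  case (Suc k)
  let ?l = "take (2 ^ k) fs" and ?r = "drop (2 ^ k) fs"
  obtain A B where AB: "bits2 (d + 12 * k) A" "bits2 (d + 12 * k) B" "\<And>a. A a + B a = length (filter (\<lambda>f. f a) ?l)"
  proof -
    have "F2 d f" if "f \<in> set ?l" for f using Suc.prems(1)[OF in_set_takeD[OF that]] .
    moreover have "length ?l \<le> 2 ^ k" by simp
    ultimately show thesis using Suc.IH[of ?l] that by blast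
  qed
  obtain A' B' where AB': "bits2 (d + 12 * k) A'" "bits2 (d + 12 * k) B'" "\<And>a. A' a + B' a = length (filter (\<lambda>f. f a) ?r)"
  proof -
    have "F2 d f" if "f \<in> set ?r" for f using Suc.prems(1)[OF in_set_dropD[OF that]] .
    moreover have "length ?r \<le> 2 ^ k" using Suc.prems(2) by simp
    ultimately show thesis using Suc.IH[of ?r] that by blast
  qed
  obtain S M where SM: "bits2 (d + 12 * k + 6) S" "bits2 (d + 12 * k + 6) M" "\<And>a. A a + B a + A' a = S a + M a"
    using three_to_two[OF AB(1,2) AB'(1)] by blast
  have "bits2 (d + 12 * k + 6) B'" using AB'(2) by (auto intro: thr_mono)
  from three_to_two[OF SM(1,2) this] obtain S' M' where
    SM': "bits2 (d + 12 * k + 6 + 6) S'" "bits2 (d + 12 * k + 6 + 6) M'" "\<And>a. S a + M a + B' a = S' a + M' a" by blast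
  have "S' a + M' a = length (filter (\<lambda>f. f a) fs)" for a
  proof -
    have "length (filter (\<lambda>f. f a) fs) = length (filter (\<lambda>f. f a) (?l @ ?r))" by simp
    also have "\<dots> = A a + B a + (A' a + B' a)" unfolding filter_append length_append AB(3) AB'(3) ..
    also have "\<dots> = S' a + M' a" using SM(3)[of a] SM'(3)[of a] by linarith
    finally show ?thesis by simp
  qed
  with SM'(1,2) show ?case by (intro exI[of _ S'] exI[of _ M']) (simp add: algebra_simps)
qed

text \<open>Ripple-carry addition: depth linear in \<open>i\<close> is affordable because counts
  have only logarithmically many bits.\<close>

lemma sum_bits2:
  assumes "bits2 d A" "bits2 d B"
  shows "F2 (d + 3 * i + 6) (\<lambda>a. bit (A a + B a) i)"
proof -
  define cy where "cy i a \<longleftrightarrow> (\<exists>j<i. bit (A a) j \<and> bit (B a) j \<and> (\<forall>k<i. j < k \<longrightarrow> bit (A a) k \<or> bit (B a) k))" for i a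
  have "F2 (d + 3 * i) (cy i)"
  proof (induction i)
    case 0
    have "cy 0 = (\<lambda>a. False)" by (simp add: cy_def fun_eq_iff)
    then show ?case by (simp add: thr_const)
  next
    case (Suc i)
    have "F2 (d + 3 * Suc i) (\<lambda>a. (bit (A a) i \<and> bit (B a) i) \<or> ((bit (A a) i \<or> bit (B a) i) \<and> cy i a))"
      by (rule thr_mono) (rule thr_conj thr_disj Suc assms[THEN spec] | simp)+
    then show ?case by (rule thr_cong) (auto simp: cy_def less_Suc_eq)
  qed
  then have "F2 (d + 3 * i + 6) (\<lambda>a. bit (A a) i \<noteq> (bit (B a) i \<noteq> cy i a))"
    by - (rule thr_mono, (rule thr_xor assms[THEN spec] | assumption | simp)+)
  then show ?thesis by (rule thr_cong) (simp add: bit_add_nat cy_def)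
qed

text \<open>A decision tree that branches on the highest bit first.\<close>

lemma pred_bits2:
  assumes "\<And>i. i < w \<Longrightarrow> F2 d (\<lambda>a. bit (C a) i)"
  shows "F2 (d + 3 * w) (\<lambda>a. P (take_bit w (C a :: nat)))"
  using assms
proof (induction w arbitrary: P)
  case 0
  then show ?case by (simp add: thr_const)
next
  case (Suc w)
  have IH: "F2 (d + 3 * w) (\<lambda>a. Q (take_bit w (C a)))" for Q
    using Suc by auto
  have "F2 (d + 3 * Suc w) (\<lambda>a. (bit (C a) w \<and> P (2 ^ w + take_bit w (C a))) \<or> (\<not> bit (C a) w \<and> P (take_bit w (C a))))"
    by (rule thr_mono) (rule thr_disj thr_conj thr_Not Suc.prems IH[of "\<lambda>x. P (2 ^ w + x)"] IH[of P] | simp)+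
  then show ?case by (rule thr_cong) (auto simp: take_bit_Suc_from_most)
qed

lemma pred_count2:
  assumes "\<And>f. f \<in> set fs \<Longrightarrow> F2 d f" "length fs \<le> 2 ^ k"
  shows "F2 (d + (18 * k + 20)) (\<lambda>a. P (length (filter (\<lambda>f. f a) fs)))"
proof -
  obtain A B where AB: "bits2 (d + 12 * k) A" "bits2 (d + 12 * k) B" "\<And>a. A a + B a = length (filter (\<lambda>f. f a) fs)"
    using count_pair[OF assms] by blast
  have lt: "A a + B a < 2 ^ Suc k" for a
  proof -
    have "A a + B a \<le> 2 ^ k" using le_trans[OF length_filter_le assms(2)] by (simp add: AB(3))
    also have "(2::nat) ^ k < 2 ^ Suc k" by simp
    finally show ?thesis .
  qed
  have "F2 (d + 12 * k + 3 * k + 6 + 3 * Suc k) (\<lambda>a. P (take_bit (Suc k) (A a + B a)))"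
    by (rule pred_bits2) (rule thr_mono[OF sum_bits2[OF AB(1,2)]], simp)
  then have "F2 (d + (18 * k + 20)) (\<lambda>a. P (take_bit (Suc k) (A a + B a)))"
    by (rule thr_mono) simp
  then show ?thesis using lt AB(3) by (simp add: take_bit_nat_eq_self)
qed

text \<open>Conjunction, disjunction and majority are all predicates of the number of true
  arguments, so \<open>pred_count2\<close> replaces every unbounded gate.\<close>

lemma thr_to_fanin2:
  assumes "thr D X s True d f" "s \<le> 2 ^ k"
  shows "F2 (d * (18 * k + 20)) f"
  using assms(1)
proof induction
  case (thr_Not d f)
  then show ?case by (intro thr_mono[OF thr.thr_Not[OF thr_Not.IH]]) simp
next
  case (thr_And fs d)
  have "F2 (d * (18 * k + 20) + (18 * k + 20)) (\<lambda>a. (\<lambda>c. c = length fs) (length (filter (\<lambda>f. f a) fs)))"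
    using thr_And assms(2) by (intro pred_count2) auto
  moreover have "(length (filter (\<lambda>f. f a) fs) = length fs) = (\<forall>f\<in>set fs. f a)" for a
    by (auto simp: filter_id_conv dest: length_filter_less)
  ultimately show ?case by (simp add: add.commute)
next
  case (thr_Or fs d)
  have "F2 (d * (18 * k + 20) + (18 * k + 20)) (\<lambda>a. (\<lambda>c. c \<noteq> 0) (length (filter (\<lambda>f. f a) fs)))"
    using thr_Or assms(2) by (intro pred_count2) auto
  then show ?case by (simp add: add.commute filter_empty_conv)
next
  case (thr_Maj fs d)
  have "F2 (d * (18 * k + 20) + (18 * k + 20)) (\<lambda>a. (\<lambda>c. length fs < 2 * c) (length (filter (\<lambda>f. f a) fs)))"
    using thr_Maj assms(2) by (intro pred_count2) auto
  then show ?case by (simp add: add.commute)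
qed (auto intro: thr.intros)

end

section \<open>Logarithmic depth and polynomial size\<close>

definition loglen :: "nat \<Rightarrow> nat" where "loglen n = Suc (floor_log (n + 2))"

text \<open>The shift by 2 makes both bounds hold for every \<open>n\<close>, whereas
  \<open>ln\<close> degenerates at 0 and 1.\<close>

lemma loglen_pow: "n + 2 \<le> 2 ^ loglen n" "2 ^ loglen n \<le> 2 * (n + 2)"
  using floor_log_exp2_gt[of "n + 2"] floor_log_exp2_le[of "n + 2"] by (auto simp: loglen_def)

lemma loglen_le_ln:
  assumes "2 \<le> n"
  shows "real (loglen n) \<le> 3 / ln 2 * ln (real n)"
proof -
  have n: "ln 2 \<le> ln (real n)" using assms by simp
  have "2 ^ floor_log (n + 2) \<le> n + 2" by (rule floor_log_exp2_le) simp
  also have "\<dots> \<le> n * n"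
    using mult_le_mono2[OF assms, of n] assms by linarith
  finally have "real (2 ^ floor_log (n + 2)) \<le> real (n * n)" by (simp only: of_nat_le_iff)
  then have "ln (2 ^ floor_log (n + 2)) \<le> ln (real n * real n)" using assms by (subst ln_le_cancel_iff) auto
  then have "real (floor_log (n + 2)) * ln 2 \<le> 2 * ln (real n)"
    using assms by (simp add: ln_realpow ln_mult)
  with n have "real (loglen n) * ln 2 \<le> 3 * ln (real n)" by (simp add: loglen_def algebra_simps)
  then show ?thesis by (simp add: field_simps)
qed

lemma loglen_bigo: "(\<lambda>n. real (a * loglen n + b)) \<in> O(\<lambda>n. ln (real n))"
proof (rule landau_o.bigI[where c = "real (a + b) * (3 / ln 2) + 1"])
  show "\<forall>\<^sub>F n in sequentially. norm (real (a * loglen n + b)) \<le> (real (a + b) * (3 / ln 2) + 1) * norm (ln (real n))"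
    unfolding eventually_sequentially
  proof (intro exI allI impI)
    fix n :: nat assume n: "2 \<le> n"
    have "a * loglen n + b \<le> (a + b) * loglen n" by (simp add: algebra_simps loglen_def)
    then have "real (a * loglen n + b) \<le> real (a + b) * real (loglen n)"
      unfolding of_nat_mult[symmetric] by (rule iffD2[OF of_nat_le_iff])
    also have "\<dots> \<le> real (a + b) * (3 / ln 2 * ln (real n))"
      by (intro mult_left_mono loglen_le_ln n) simp
    also have "\<dots> \<le> (real (a + b) * (3 / ln 2) + 1) * ln (real n)" using n by (simp add: algebra_simps)
    finally show "norm (real (a * loglen n + b)) \<le> (real (a + b) * (3 / ln 2) + 1) * norm (ln (real n))"
      using n by simp
  qed
qed (auto intro: add_nonneg_pos)

text \<open>Turns logarithmic depth into polynomial size, both for circuits of fan-in 2 and for the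
  leaves of unfolded formulas.\<close>

lemma poly_bounded_exp_loglen: "poly_bounded (\<lambda>n. c ^ (a * loglen n + b))"
proof (rule poly_bounded_mono)
  show "poly_bounded (\<lambda>n. (2 * (n + 2)) ^ (c * a) * 2 ^ (c * b))"
  proof -
    have "poly_bounded (\<lambda>n. ((n + 2 + (n + 2)) ^ (c * a) + 2 ^ (c * b)) ^ 2)"
      by (intro poly_bounded_power poly_bounded_add poly_bounded_id poly_bounded_const)
    moreover have "x * y \<le> (x + y) ^ 2" for x y :: nat by (simp add: power2_eq_square algebra_simps)
    moreover have "2 * (n + 2) = n + 2 + (n + 2)" for n :: nat by simp
    ultimately show ?thesis by (simp only: poly_bounded_mono)
  qed
  fix n
  have "c ^ (a * loglen n + b) \<le> (2 ^ c) ^ (a * loglen n + b)"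
    by (rule power_mono[OF less_imp_le[OF less_exp]]) simp
  also have "\<dots> = (2 ^ loglen n) ^ (c * a) * 2 ^ (c * b)"
    by (simp add: power_add mult_ac flip: power_mult)
  also have "\<dots> \<le> (2 * (n + 2)) ^ (c * a) * 2 ^ (c * b)"
    by (intro mult_right_mono power_mono loglen_pow) auto
  finally show "c ^ (a * loglen n + b) \<le> (2 * (n + 2)) ^ (c * a) * 2 ^ (c * b)" .
qed

lemma TC0_subset_NC1: "TC0 \<subseteq> NC1"
proof
  fix L assume "L \<in> TC0"
  then obtain C c where C: "decides C L" "\<And>n. circuit_depth (C n) \<le> c" "poly_bounded (\<lambda>n. circuit_size (C n))"
    unfolding TC0_def by blast
  then obtain k where k: "\<And>n. circuit_size (C n) \<le> (n + 2) ^ k" by (auto simp: poly_bounded_iff)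
  \<comment> \<open>The size, and with it the fan-in, is at most \<open>2 ^ (k * loglen n)\<close>,
    so each of the \<open>c\<close> levels becomes this many levels of fan-in 2.\<close>
  define dep where "dep n = c * (18 * (k * loglen n) + 20)" for n
  have "\<exists>B. circuit_wf B \<and> n_in B = n \<and> circuit_depth B \<le> Suc (dep n) \<and> circuit_size B \<le> 4 ^ Suc (dep n) \<and>
     (\<forall>g\<in>set (gates B). gate_ok 2 False g) \<and> (\<forall>x. length x = n \<longrightarrow> circuit_eval B x = [x \<in> L])" for n
  proof -
    have wf: "circuit_wf (C n)" "n_in (C n) = n" "\<And>x. length x = n \<Longrightarrow> circuit_eval (C n) x = [x \<in> L]"
      using C(1) by (auto simp: decides_def)
    have "length (circuit_eval (C n) (replicate n False)) = 1" using wf(3) by simp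
    then have o: "0 < length (outs (C n))" by (simp add: circuit_eval_def)
    have s: "circuit_size (C n) \<le> 2 ^ (k * loglen n)"
    proof -
      have "(n + 2) ^ k \<le> (2 ^ loglen n) ^ k" by (intro power_mono loglen_pow) simp
      with k[of n] show ?thesis by (simp add: power_mult[symmetric] mult.commute)
    qed
    have "\<forall>g\<in>set (gates (C n)). gate_ok (2 ^ (k * loglen n)) True g" using gate_ok_size[OF s] by blast
    from circuit_thr[OF wf(1) this o C(2)]
    have "thr {x. length x = n} ((\<lambda>i x. x ! i) ` {..<n}) (2 ^ (k * loglen n)) True c (\<lambda>x. circuit_eval (C n) x ! 0)"
      unfolding wf(2) .
    then have "thr {x. length x = n} ((\<lambda>i x. x ! i) ` {..<n}) 2 False (dep n) (\<lambda>x. circuit_eval (C n) x ! 0)"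
      unfolding dep_def by (rule thr_to_fanin2) simp
    then have "thr {x. length x = n} ((\<lambda>i x. x ! i) ` {..<n}) 2 False (dep n) (\<lambda>x. x \<in> L)"
      by (rule thr_cong) (use wf(3) in auto)
    from thr_circuit[OF this] show ?thesis by simp
  qed
  then obtain B where B: "\<And>n. circuit_wf (B n)" "\<And>n. n_in (B n) = n" "\<And>n. circuit_depth (B n) \<le> Suc (dep n)"
    "\<And>n. circuit_size (B n) \<le> 4 ^ Suc (dep n)" "\<And>n g. g \<in> set (gates (B n)) \<Longrightarrow> gate_ok 2 False g"
    "\<And>n x. length x = n \<Longrightarrow> circuit_eval (B n) x = [x \<in> L]" by metis
  have dep: "Suc (dep n) = (c * 18 * k) * loglen n + (c * 20 + 1)" for n by (simp add: dep_def algebra_simps)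
  have "decides B L" using B by (auto simp: decides_def)
  moreover have "bounded_fanin_gate 2 g" if "g \<in> set (gates (B n))" for g n
    using B(5)[OF that] by (cases g) auto
  moreover have "(\<lambda>n. real (circuit_depth (B n))) \<in> O(\<lambda>n. ln (real n))"
  proof (rule landau_o.big_trans[OF _ loglen_bigo[of "c * 18 * k" "c * 20 + 1"]])
    show "(\<lambda>n. real (circuit_depth (B n))) \<in> O(\<lambda>n. real (c * 18 * k * loglen n + (c * 20 + 1)))"
      using B(3) by (intro landau_o.bigI[where c = 1] always_eventually) (auto simp: dep simp del: of_nat_add of_nat_mult of_nat_Suc)
  qed
  moreover have "poly_bounded (\<lambda>n. circuit_size (B n))"
    by (rule poly_bounded_mono[OF poly_bounded_exp_loglen[of 4 "c * 18 * k" "c * 20 + 1"]]) (use B(4) in \<open>simp only: dep\<close>)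
  ultimately show "L \<in> NC1" unfolding NC1_def by blast
qed


section \<open>Formulas as connectivity problems\<close>

text \<open>\<open>sp D X k f\<close>: \<open>f\<close> has a formula with \<open>k\<close> leaves in negation normal form.\<close>

inductive sp :: "'a set \<Rightarrow> ('a \<Rightarrow> bool) set \<Rightarrow> nat \<Rightarrow> ('a \<Rightarrow> bool) \<Rightarrow> bool" for D X where
  sp_input: "f \<in> X \<Longrightarrow> sp D X 1 f"
| sp_neg: "f \<in> X \<Longrightarrow> sp D X 1 (\<lambda>a. \<not> f a)"
| sp_const: "sp D X 1 (\<lambda>_. b)"
| sp_and: "sp D X k f \<Longrightarrow> sp D X l g \<Longrightarrow> sp D X (k + l) (\<lambda>a. f a \<and> g a)"
| sp_or: "sp D X k f \<Longrightarrow> sp D X l g \<Longrightarrow> sp D X (k + l) (\<lambda>a. f a \<or> g a)"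
| sp_cong: "sp D X k f \<Longrightarrow> (\<And>a. a \<in> D \<Longrightarrow> f a = g a) \<Longrightarrow> sp D X k g"

text \<open>The additional leaf is the constant that stands for the empty list.\<close>

lemma sp_list:
  assumes "\<And>f. f \<in> set fs \<Longrightarrow> \<exists>k\<le>K. sp D X k f"
  shows "(\<exists>k\<le>length fs * K + 1. sp D X k (\<lambda>a. \<forall>f\<in>set fs. f a)) \<and>
    (\<exists>k\<le>length fs * K + 1. sp D X k (\<lambda>a. \<exists>f\<in>set fs. f a))"
  using assms
proof (induction fs)
  case Nil
  show ?case
    using sp_const[of D X True] sp_const[of D X False] by auto
next
  case (Cons f fs)
  obtain k where k: "k \<le> K" "sp D X k f" using Cons.prems[of f] by auto
  have "\<And>f. f \<in> set fs \<Longrightarrow> \<exists>k\<le>K. sp D X k f" using Cons.prems by simp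
  from Cons.IH[OF this] obtain l l' where
    l: "l \<le> length fs * K + 1" "sp D X l (\<lambda>a. \<forall>f\<in>set fs. f a)"
    "l' \<le> length fs * K + 1" "sp D X l' (\<lambda>a. \<exists>f\<in>set fs. f a)" by blast
  show ?case
    using sp_and[OF k(2) l(2)] sp_or[OF k(2) l(4)] k(1) l(1,3)
    by (intro conjI exI[of _ "k + l"] exI[of _ "k + l'"]) auto
qed

text \<open>\<open>f\<close> and its negation are treated together: a negation merely exchanges the
  two, and De Morgan's laws push it to the inputs.\<close>

lemma thr_sp:
  assumes "thr D X s False d f"
  shows "(\<exists>k\<le>(s + 1) ^ d. sp D X k f) \<and> (\<exists>k\<le>(s + 1) ^ d. sp D X k (\<lambda>a. \<not> f a))"
  using assms
proof induction
  case (thr_input f d)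
  have "1 \<le> (s + 1) ^ d" by (rule one_le_power) simp
  then show ?case using sp_input[OF thr_input] sp_neg[OF thr_input] by blast
next
  case (thr_const d b)
  have "1 \<le> (s + 1) ^ d" by (rule one_le_power) simp
  then show ?case using sp_const[of D X b] sp_const[of D X "\<not> b"] by blast
next
  case (thr_Not d f)
  have "(s + 1) ^ d \<le> (s + 1) ^ Suc d" by (rule power_increasing) auto
  with thr_Not.IH show ?case by (simp only: not_not) (meson le_trans)
next
  case (thr_And fs d)
  have le: "length fs * (s + 1) ^ d + 1 \<le> (s + 1) ^ Suc d"
  proof -
    have "length fs * (s + 1) ^ d \<le> s * (s + 1) ^ d" using thr_And by (intro mult_right_mono) auto
    moreover have "1 \<le> (s + 1) ^ d" by (rule one_le_power) simp
    ultimately show ?thesis unfolding power_Suc add_mult_distrib mult_1 by linarith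
  qed
  have "\<exists>k\<le>length fs * (s + 1) ^ d + 1. sp D X k (\<lambda>a. \<forall>f\<in>set fs. f a)"
    using thr_And by (intro sp_list[THEN conjunct1]) auto
  moreover have "\<exists>k\<le>length (map (\<lambda>f a. \<not> f a) fs) * (s + 1) ^ d + 1. sp D X k (\<lambda>a. \<exists>f\<in>set (map (\<lambda>f a. \<not> f a) fs). f a)"
    using thr_And by (intro sp_list[THEN conjunct2]) auto
  ultimately show ?case using le by (auto intro: le_trans)
next
  case (thr_Or fs d)
  have le: "length fs * (s + 1) ^ d + 1 \<le> (s + 1) ^ Suc d"
  proof -
    have "length fs * (s + 1) ^ d \<le> s * (s + 1) ^ d" using thr_Or by (intro mult_right_mono) auto
    moreover have "1 \<le> (s + 1) ^ d" by (rule one_le_power) simp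
    ultimately show ?thesis unfolding power_Suc add_mult_distrib mult_1 by linarith
  qed
  have "\<exists>k\<le>length fs * (s + 1) ^ d + 1. sp D X k (\<lambda>a. \<exists>f\<in>set fs. f a)"
    using thr_Or by (intro sp_list[THEN conjunct2]) auto
  moreover have "\<exists>k\<le>length (map (\<lambda>f a. \<not> f a) fs) * (s + 1) ^ d + 1. sp D X k (\<lambda>a. \<forall>f\<in>set (map (\<lambda>f a. \<not> f a) fs). f a)"
    using thr_Or by (intro sp_list[THEN conjunct1]) auto
  ultimately show ?case using le by (auto intro: le_trans)
next
  case (thr_Maj fs d)
  then show ?case by simp
next
  case (thr_cong d f g)
  then have "sp D X k g" if "sp D X k f" for k using that by (auto intro: sp_cong)
  moreover have "sp D X k (\<lambda>a. \<not> g a)" if "sp D X k (\<lambda>a. \<not> f a)" for k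
    using that thr_cong(2) by (auto intro: sp_cong)
  ultimately show ?case using thr_cong.IH by blast
qed

section \<open>Networks of switched edges, paths and cuts\<close>

type_synonym 'a net = "(nat \<times> nat \<times> ('a \<Rightarrow> bool)) list"

definition live :: "'a net \<Rightarrow> 'a \<Rightarrow> (nat \<times> nat) set" where
  "live es a = {(u, w). \<exists>l. ((u, w, l) \<in> set es \<or> (w, u, l) \<in> set es) \<and> l a}"

lemma live_append: "live (es @ fs) a = live es a \<union> live fs a"
  by (auto simp: live_def)

definition net_verts :: "'a net \<Rightarrow> nat set" where
  "net_verts es = (\<Union>(u, w, l)\<in>set es. {u, w})"

lemma net_verts_append [simp]: "net_verts (es @ fs) = net_verts es \<union> net_verts fs"
  by (auto simp: net_verts_def)

lemma live_verts: "(u, w) \<in> live es a \<Longrightarrow> u \<in> net_verts es \<and> w \<in> net_verts es"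
  by (fastforce simp: live_def net_verts_def)

definition literal :: "('a \<Rightarrow> bool) set \<Rightarrow> ('a \<Rightarrow> bool) \<Rightarrow> bool" where
  "literal X l \<longleftrightarrow> l \<in> X \<or> (\<exists>f\<in>X. l = (\<lambda>a. \<not> f a)) \<or> (\<exists>b. l = (\<lambda>_. b))"

text \<open>Such an \<open>S\<close> is a union of connected components. It serves as a certificate
  of disconnection that can be glued under series and parallel composition.\<close>

definition separates :: "nat set \<Rightarrow> (nat \<times> nat) set \<Rightarrow> bool" where
  "separates S E \<longleftrightarrow> (\<forall>(u, w)\<in>E. u \<in> S \<longleftrightarrow> w \<in> S)"

lemma separates_Un [simp]: "separates S (E \<union> E') \<longleftrightarrow> separates S E \<and> separates S E'"
  by (auto simp: separates_def)

lemma separates_cong: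
  assumes "separates S (live es a)" "\<And>u. u \<in> net_verts es \<Longrightarrow> u \<in> S \<longleftrightarrow> u \<in> S'"
  shows "separates S' (live es a)"
  unfolding separates_def
proof clarify
  fix u w assume e: "(u, w) \<in> live es a"
  then have "u \<in> S \<longleftrightarrow> w \<in> S" using assms(1) by (auto simp: separates_def)
  then show "u \<in> S' \<longleftrightarrow> w \<in> S'" using assms(2) live_verts[OF e] by blast
qed

text \<open>Conjunctions become series and disjunctions parallel connections of the terminals \<open>s\<close> and \<open>t\<close>.\<close>

lemma sp_net:
  assumes "sp D X k f" "s < v" "t < v" "s \<noteq> t"
  shows "\<exists>es v'. v \<le> v' \<and> v' < v + k \<and> length es \<le> k \<and> net_verts es \<subseteq> {s, t} \<union> {v..<v'} \<and>
     (\<forall>(u, w, l)\<in>set es. literal X l) \<and>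
     (\<forall>a\<in>D. (f a \<longrightarrow> (s, t) \<in> (live es a)\<^sup>*) \<and>
       (\<not> f a \<longrightarrow> (\<exists>S. s \<in> S \<and> S \<subseteq> {s} \<union> {v..<v'} \<and> separates S (live es a))))"
proof -
  have lit: "\<exists>es v'. v \<le> v' \<and> v' < v + 1 \<and> length es \<le> 1 \<and> net_verts es \<subseteq> {s, t} \<union> {v..<v'} \<and>
     (\<forall>(u, w, l)\<in>set es. literal X l) \<and>
     (\<forall>a\<in>D. (f a \<longrightarrow> (s, t) \<in> (live es a)\<^sup>*) \<and>
       (\<not> f a \<longrightarrow> (\<exists>S. s \<in> S \<and> S \<subseteq> {s} \<union> {v..<v'} \<and> separates S (live es a))))"
    if "literal X f" for f s t v
    using that by (intro exI[of _ "[(s, t, f)]"] exI[of _ v])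
      (auto simp: net_verts_def live_def separates_def intro!: exI[of _ "{s}"])
  show ?thesis using assms
  proof (induction arbitrary: s t v)
    case (sp_input f)
    then show ?case by (intro lit) (simp add: literal_def)
  next
    case (sp_neg f)
    then show ?case by (intro lit) (auto simp: literal_def)
  next
    case (sp_const b)
    then show ?case by (intro lit) (auto simp: literal_def)
  next
    case (sp_and k f l g)
    \<comment> \<open>The vertex \<open>v\<close> becomes the middle terminal, so the inner vertices
      of the first part start at \<open>v + 1\<close>.\<close>
    obtain es v1 where 1: "v + 1 \<le> v1" "v1 < v + 1 + k" "length es \<le> k" "net_verts es \<subseteq> {s, v} \<union> {v + 1..<v1}"
      "\<forall>(u, w, l)\<in>set es. literal X l" "\<And>a. a \<in> D \<Longrightarrow> f a \<Longrightarrow> (s, v) \<in> (live es a)\<^sup>*"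
      "\<And>a. a \<in> D \<Longrightarrow> \<not> f a \<Longrightarrow> \<exists>S. s \<in> S \<and> S \<subseteq> {s} \<union> {v + 1..<v1} \<and> separates S (live es a)"
      using sp_and.IH(1)[of s "v + 1" v] sp_and.prems by auto
    obtain fs v2 where 2: "v1 \<le> v2" "v2 < v1 + l" "length fs \<le> l" "net_verts fs \<subseteq> {v, t} \<union> {v1..<v2}"
      "\<forall>(u, w, l)\<in>set fs. literal X l" "\<And>a. a \<in> D \<Longrightarrow> g a \<Longrightarrow> (v, t) \<in> (live fs a)\<^sup>*"
      "\<And>a. a \<in> D \<Longrightarrow> \<not> g a \<Longrightarrow> \<exists>S. v \<in> S \<and> S \<subseteq> {v} \<union> {v1..<v2} \<and> separates S (live fs a)"
      using sp_and.IH(2)[of v v1 t] sp_and.prems 1(1) by auto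
    have "(s, t) \<in> (live (es @ fs) a)\<^sup>*" if "a \<in> D" "f a \<and> g a" for a
      using 1(6)[OF that(1)] 2(6)[OF that(1)] that(2) unfolding live_append
      by (meson rtrancl_trans rtrancl_mono subsetD Un_upper1 Un_upper2)
    moreover have "\<exists>S. s \<in> S \<and> S \<subseteq> {s} \<union> {v..<v2} \<and> separates S (live (es @ fs) a)" if a: "a \<in> D" "\<not> (f a \<and> g a)" for a
    proof (cases "f a")
      case False
      then obtain S where S: "s \<in> S" "S \<subseteq> {s} \<union> {v + 1..<v1}" "separates S (live es a)" using 1(7) a by blast
      \<comment> \<open>No vertex of the second part lies in \<open>S\<close>, so there the set acts
        like the empty one.\<close>
      have "separates S (live fs a)"
      proof (rule separates_cong[of "{}"])
        show "u \<in> {} \<longleftrightarrow> u \<in> S" if "u \<in> net_verts fs" for u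
          using that 2(4) S(2) sp_and.prems 1(1) by fastforce
      qed (simp add: separates_def)
      with S 2(1) show ?thesis unfolding live_append by (intro exI[of _ S]) auto
    next
      case True
      then obtain S where S: "v \<in> S" "S \<subseteq> {v} \<union> {v1..<v2}" "separates S (live fs a)" using 2(7) a by blast
      \<comment> \<open>The whole first part is put on the side of \<open>s\<close>, together with
        the cut of the second part around \<open>v\<close>.\<close>
      let ?S = "insert s ({v..<v1} \<union> S)"
      have "separates ?S (live es a)"
      proof (rule separates_cong[of UNIV])
        show "u \<in> UNIV \<longleftrightarrow> u \<in> ?S" if "u \<in> net_verts es" for u
          using that 1(1,4) S(1) by fastforce
      qed (simp add: separates_def)
      moreover have "separates ?S (live fs a)"
      proof (rule separates_cong[OF S(3)])
        show "u \<in> S \<longleftrightarrow> u \<in> ?S" if "u \<in> net_verts fs" for u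
          using that 2(4) S(1,2) sp_and.prems 1(1) by fastforce
      qed
      ultimately show ?thesis unfolding live_append using S(1,2) 1(1) 2(1)
        by (intro exI[of _ ?S]) auto
    qed
    moreover have "net_verts (es @ fs) \<subseteq> {s, t} \<union> {v..<v2}" using 1(1,4) 2(1,4) by auto
    ultimately show ?case using 1(1,2,3,5) 2(1,2,3,5)
      by (intro exI[of _ "es @ fs"] exI[of _ v2]) auto
  next
    case (sp_or k f l g)
    obtain es v1 where 1: "v \<le> v1" "v1 < v + k" "length es \<le> k" "net_verts es \<subseteq> {s, t} \<union> {v..<v1}"
      "\<forall>(u, w, l)\<in>set es. literal X l" "\<And>a. a \<in> D \<Longrightarrow> f a \<Longrightarrow> (s, t) \<in> (live es a)\<^sup>*"
      "\<And>a. a \<in> D \<Longrightarrow> \<not> f a \<Longrightarrow> \<exists>S. s \<in> S \<and> S \<subseteq> {s} \<union> {v..<v1} \<and> separates S (live es a)"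
      using sp_or.IH(1)[of s v t] sp_or.prems by auto
    obtain fs v2 where 2: "v1 \<le> v2" "v2 < v1 + l" "length fs \<le> l" "net_verts fs \<subseteq> {s, t} \<union> {v1..<v2}"
      "\<forall>(u, w, l)\<in>set fs. literal X l" "\<And>a. a \<in> D \<Longrightarrow> g a \<Longrightarrow> (s, t) \<in> (live fs a)\<^sup>*"
      "\<And>a. a \<in> D \<Longrightarrow> \<not> g a \<Longrightarrow> \<exists>S. s \<in> S \<and> S \<subseteq> {s} \<union> {v1..<v2} \<and> separates S (live fs a)"
      using sp_or.IH(2)[of s v1 t] sp_or.prems 1(1) by auto
    have "(s, t) \<in> (live (es @ fs) a)\<^sup>*" if "a \<in> D" "f a \<or> g a" for a
      using 1(6)[OF that(1)] 2(6)[OF that(1)] that(2) unfolding live_append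
      by (meson rtrancl_mono subsetD Un_upper1 Un_upper2)
    moreover have "\<exists>S. s \<in> S \<and> S \<subseteq> {s} \<union> {v..<v2} \<and> separates S (live (es @ fs) a)" if a: "a \<in> D" "\<not> (f a \<or> g a)" for a
    proof -
      from a obtain S where S: "s \<in> S" "S \<subseteq> {s} \<union> {v..<v1}" "separates S (live es a)" using 1(7) by blast
      from a obtain S' where S': "s \<in> S'" "S' \<subseteq> {s} \<union> {v1..<v2}" "separates S' (live fs a)" using 2(7) by blast
      \<comment> \<open>The inner vertices of the two parts are disjoint, so the two cuts meet only
        in the terminal \<open>s\<close> and do not disturb each other.\<close>
      have "separates (S \<union> S') (live es a)"
      proof (rule separates_cong[OF S(3)])
        show "u \<in> S \<longleftrightarrow> u \<in> S \<union> S'" if "u \<in> net_verts es" for u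
          using that 1(1,4) S(1) S'(2) sp_or.prems by fastforce
      qed
      moreover have "separates (S \<union> S') (live fs a)"
      proof (rule separates_cong[OF S'(3)])
        show "u \<in> S' \<longleftrightarrow> u \<in> S \<union> S'" if "u \<in> net_verts fs" for u
          using that 1(1) 2(4) S'(1) S(2) sp_or.prems by fastforce
      qed
      ultimately show ?thesis unfolding live_append using S(1,2) S'(2) 1(1) 2(1)
        by (intro exI[of _ "S \<union> S'"]) auto
    qed
    moreover have "net_verts (es @ fs) \<subseteq> {s, t} \<union> {v..<v2}" using 1(1,4) 2(1,4) by auto
    ultimately show ?case using 1(1,2,3,5) 2(1,2,3,5)
      by (intro exI[of _ "es @ fs"] exI[of _ v2]) auto
  next
    case (sp_cong k f g)
    then show ?case by (metis (no_types, lifting))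
  qed
qed

text \<open>\<open>connects\<close> demands distinct vertices: when the walk returns to a vertex of
  the path, the path is cut back to that vertex.\<close>

lemma ex_connects:
  assumes "(s, t) \<in> {(u, w). {u, w} \<in> E}\<^sup>*"
  shows "\<exists>xs. connects E xs s t"
  using assms
proof (induction rule: rtrancl_induct)
  case base
  then show ?case by (intro exI[of _ "[s]"]) (simp add: connects_def)
next
  case (step y z)
  then obtain xs where xs: "connects E xs s y" by blast
  show ?case
  proof (cases "z \<in> set xs")
    case True
    then obtain as bs where as: "xs = as @ z # bs" by (meson split_list)
    then have "successively (\<lambda>a b. {a, b} \<in> E) ((as @ [z]) @ bs)" using xs by (simp add: connects_def)
    then have "successively (\<lambda>a b. {a, b} \<in> E) (as @ [z])" unfolding successively_append_iff[of _ "as @ [z]"] by blast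
    moreover have "hd (as @ [z]) = s" using xs as by (cases as) (auto simp: connects_def)
    moreover have "distinct (as @ [z])" using xs as by (auto simp: connects_def)
    ultimately have "connects E (as @ [z]) s z" by (simp add: connects_def)
    then show ?thesis by blast
  next
    case False
    have "successively (\<lambda>a b. {a, b} \<in> E) (xs @ [z])"
      using xs step(2) unfolding successively_append_iff by (auto simp: connects_def)
    then have "connects E (xs @ [z]) s z" using xs False by (auto simp: connects_def)
    then show ?thesis by blast
  qed
qed

lemma connects_stays:
  assumes "connects E xs s t" "s \<in> S" "\<And>u w. {u, w} \<in> E \<Longrightarrow> u \<in> S \<longleftrightarrow> w \<in> S"
  shows "t \<in> S"
proof -
  have "last ys \<in> S" if "ys \<noteq> []" "hd ys \<in> S" "successively (\<lambda>a b. {a, b} \<in> E) ys" for ys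
    using that
  proof (induction ys)
    case (Cons y ys)
    show ?case
    proof (cases "ys = []")
      case False
      with Cons.prems have "{y, hd ys} \<in> E" "successively (\<lambda>a b. {a, b} \<in> E) ys" by (auto simp: successively_Cons)
      with assms(3)[of y "hd ys"] Cons False show ?thesis by simp
    qed (use Cons in simp)
  qed simp
  with assms(1,2) show ?thesis by (auto simp: connects_def)
qed

text \<open>Loops are dropped because the instances are simple graphs.\<close>

definition live_graph :: "'a net \<Rightarrow> 'a \<Rightarrow> nat set set" where
  "live_graph es a = {{u, w} | u w l. (u, w, l) \<in> set es \<and> l a \<and> u \<noteq> w}"

lemma live_graph_iff: "{u, w} \<in> live_graph es a \<longleftrightarrow> u \<noteq> w \<and> (u, w) \<in> live es a"
  unfolding live_graph_def live_def by (auto simp: doubleton_eq_iff)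

lemma live_graph_connects:
  assumes reach: "P \<Longrightarrow> (s, t) \<in> (live es a)\<^sup>*"
    and cut: "\<not> P \<Longrightarrow> \<exists>S. s \<in> S \<and> t \<notin> S \<and> separates S (live es a)"
  shows "(\<exists>xs. connects (live_graph es a) xs s t) \<longleftrightarrow> P"
proof
  assume P: P
  have "(s, y) \<in> {(u, w). {u, w} \<in> live_graph es a}\<^sup>*" if "(s, y) \<in> (live es a)\<^sup>*" for y
    using that
  proof (induction rule: rtrancl_induct)
    case (step y z)
    show ?case
    proof (cases "y = z")
      case False
      then have "(y, z) \<in> {(u, w). {u, w} \<in> live_graph es a}" using step(2) by (simp add: live_graph_iff)
      with step.IH show ?thesis by (rule rtrancl_into_rtrancl)
    qed (use step in simp)
  qed simp
  then show "\<exists>xs. connects (live_graph es a) xs s t" using reach[OF P] by (intro ex_connects)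
next
  assume "\<exists>xs. connects (live_graph es a) xs s t"
  then obtain xs where xs: "connects (live_graph es a) xs s t" by blast
  show P
  proof (rule ccontr)
    assume "\<not> P"
    then obtain S where S: "s \<in> S" "t \<notin> S" "separates S (live es a)" using cut by blast
    have "t \<in> S"
      by (rule connects_stays[OF xs S(1)]) (use S(3) in \<open>auto simp: live_graph_iff separates_def\<close>)
    with S(2) show False by contradiction
  qed
qed

section \<open>Encodings of connectivity instances\<close>

lemma ugc_bits_length: "length (ugc_bits k E u v) = k * k + 2 * ceillog2 k"
proof -
  have "length (concat (map (\<lambda>i. map (\<lambda>j. {i, j} \<in> E) [0..<k]) [0..<k])) = k * k"
    by (subst length_concat_equal[where L = k]) auto
  then show ?thesis by (simp add: ugc_bits_def)
qed

lemma ugc_bits_nth: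
  assumes "i < k" "j < k"
  shows "ugc_bits k E u v ! (i * k + j) \<longleftrightarrow> {i, j} \<in> E"
proof -
  let ?xss = "map (\<lambda>i. map (\<lambda>j. {i, j} \<in> E) [0..<k]) [0..<k]"
  have len: "length (concat ?xss) = k * k" by (subst length_concat_equal[where L = k]) auto
  have "i * k + j < (i + 1) * k" using assms by simp
  also have "\<dots> \<le> k * k" using assms by (intro mult_right_mono) auto
  finally have "ugc_bits k E u v ! (i * k + j) = concat ?xss ! (i * k + j)"
    unfolding ugc_bits_def nth_append len by simp
  also have "\<dots> = ?xss ! i ! j" by (rule nth_concat_equal) (use assms in auto)
  finally show ?thesis using assms by simp
qed

lemma ugc_bits_drop:
  "drop (k * k) (ugc_bits k E u v) = map (bit u) [0..<ceillog2 k] @ map (bit v) [0..<ceillog2 k]"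
proof -
  have "length (concat (map (\<lambda>i. map (\<lambda>j. {i, j} \<in> E) [0..<k]) [0..<k])) = k * k"
    by (subst length_concat_equal[where L = k]) auto
  then show ?thesis by (simp add: ugc_bits_def)
qed

text \<open>The length increases strictly with \<open>k\<close>, so a code determines the number of
  vertices and then everything else. Thus membership in \<open>ugc_yes\<close> cannot be due to a
  different graph with the same code.\<close>

lemma ugc_bits_inj:
  assumes eq: "ugc_bits k E u v = ugc_bits k' E' u' v'"
    and g: "ugraph k E" "u < k" "v < k" "ugraph k' E'" "u' < k'" "v' < k'"
  shows "E = E' \<and> u = u' \<and> v = v'"
proof -
  have len: "m * m + 2 * ceillog2 m < n * n + 2 * ceillog2 n" if "m < n" for m n :: nat
  proof -
    have "m * m < n * n" using that by (intro mult_strict_mono) auto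
    moreover have "ceillog2 m \<le> ceillog2 n" using that by (intro ceillog2_mono) auto
    ultimately show ?thesis by simp
  qed
  have k: "k' = k"
    using arg_cong[OF eq, of length] len[of k k'] len[of k' k] unfolding ugc_bits_length
    by (cases k k' rule: linorder_cases) auto
  have E: "{i, j} \<in> E \<longleftrightarrow> {i, j} \<in> E'" if "i < k" "j < k" for i j
    using ugc_bits_nth[OF that, of E u v] ugc_bits_nth[OF that, of E' u' v'] eq k by simp
  have "E \<subseteq> E'" "E' \<subseteq> E" using g(1,4) E k unfolding ugraph_def by blast+
  moreover have "map (bit u) [0..<ceillog2 k] @ map (bit v) [0..<ceillog2 k] =
      map (bit u') [0..<ceillog2 k] @ map (bit v') [0..<ceillog2 k]"
    using arg_cong[OF eq, of "drop (k * k)"] unfolding k ugc_bits_drop .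
  then have b: "bit u i = bit u' i" "bit v i = bit v' i" if "i < ceillog2 k" for i
    using that by auto
  have bb: "bit x i = bit y i" if "x < k" "y < k" "\<And>i. i < ceillog2 k \<Longrightarrow> bit x i = bit y i" for x y i :: nat
  proof (cases "i < ceillog2 k")
    case False
    have "x < 2 ^ ceillog2 k" "y < 2 ^ ceillog2 k" using that(1,2) le_two_power_ceillog2[of k] by linarith+
    then have "take_bit (ceillog2 k) x = x" "take_bit (ceillog2 k) y = y" by (simp_all add: take_bit_nat_eq_self)
    with False show ?thesis by (metis bit_take_bit_iff)
  qed (use that in simp)
  have "u = u'" by (rule bit_eqI) (rule bb[OF g(2) g(5)[unfolded k] b(1)])
  moreover have "v = v'" by (rule bit_eqI) (rule bb[OF g(3) g(6)[unfolded k] b(2)])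
  ultimately show ?thesis by blast
qed

lemma ugc_yes_iff:
  assumes "ugraph k E" "u < k" "v < k"
  shows "ugc_bits k E u v \<in> ugc_yes \<longleftrightarrow> (\<exists>xs. connects E xs u v)"
proof
  assume "ugc_bits k E u v \<in> ugc_yes"
  then obtain k' E' u' v' where "ugc_bits k E u v = ugc_bits k' E' u' v'" "ugraph k' E'" "u' < k'" "v' < k'"
    "\<exists>xs. connects E' xs u' v'" unfolding ugc_yes_def by blast
  with ugc_bits_inj[of k E u v k' E' u' v'] assms show "\<exists>xs. connects E xs u v" by blast
qed (use assms in \<open>unfold ugc_yes_def, blast\<close>)

text \<open>The adjacency bits of the encoded network are disjunctions of literals; the other bits are constant.\<close>

lemma ugc_bits_thr:
  assumes lits: "\<forall>(u, w, l)\<in>set es. literal X l" and s: "length es \<le> s" and j: "j < length (ugc_bits k (live_graph es a0) u v)"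
  shows "thr D X s True 2 (\<lambda>a. ugc_bits k (live_graph es a) u v ! j)"
proof (cases "j < k * k")
  case True
  then have k: "0 < k" by (cases k) auto
  define i i' where "i = j div k" and "i' = j mod k"
  have ij: "i < k" "i' < k" "j = i * k + i'"
    using True k by (simp_all add: i_def i'_def less_mult_imp_div_less)
  let ?ls = "map (snd \<circ> snd) (filter (\<lambda>(u, w, l). {u, w} = {i, i'} \<and> u \<noteq> w) es)"
  have "thr D X s True (Suc 1) (\<lambda>a. \<exists>l\<in>set ?ls. l a)"
  proof (rule thr_Or)
    show "thr D X s True 1 l" if "l \<in> set ?ls" for l
    proof -
      from that lits have "literal X l" by auto
      then show ?thesis unfolding literal_def
        using thr_Not[OF thr_input[of _ X D s True 0]] by (auto intro: thr_input thr_const)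
    qed
    show "length ?ls \<le> s" using s by (auto intro: order_trans[OF length_filter_le])
  qed
  then have "thr D X s True 2 (\<lambda>a. \<exists>l\<in>set ?ls. l a)" by (simp add: numeral_2_eq_2)
  then show ?thesis
  proof (rule thr_cong)
    fix a
    have "(\<exists>l\<in>set ?ls. l a) \<longleftrightarrow> {i, i'} \<in> live_graph es a"
    proof
      assume "\<exists>l\<in>set ?ls. l a"
      then obtain e where e: "e \<in> set es" "case e of (u, w, l) \<Rightarrow> {u, w} = {i, i'} \<and> u \<noteq> w" "snd (snd e) a"
        unfolding set_map set_filter by auto
      obtain u w l where "e = (u, w, l)" by (cases e)
      with e have "(u, w, l) \<in> set es" "l a" "u \<noteq> w" "{i, i'} = {u, w}" by simp_all
      then show "{i, i'} \<in> live_graph es a" unfolding live_graph_def mem_Collect_eq by blast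
    next
      assume "{i, i'} \<in> live_graph es a"
      then obtain u w l where e: "{i, i'} = {u, w}" "(u, w, l) \<in> set es" "l a" "u \<noteq> w"
        unfolding live_graph_def mem_Collect_eq by blast
      have "l \<in> set ?ls" unfolding set_map set_filter
        by (rule image_eqI[of _ _ "(u, w, l)"]) (use e in simp_all)
      with e(3) show "\<exists>l\<in>set ?ls. l a" by blast
    qed
    then show "(\<exists>l\<in>set ?ls. l a) = ugc_bits k (live_graph es a) u v ! j"
      unfolding ij(3) ugc_bits_nth[OF ij(1,2)] .
  qed
next
  case False
  let ?b = "(map (bit u) [0..<ceillog2 k] @ map (bit v) [0..<ceillog2 k]) ! (j - k * k)"
  have "ugc_bits k (live_graph es a) u v ! j = ?b" for a
    using False j unfolding ugc_bits_drop[of k "live_graph es a" u v, symmetric]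
    by (subst nth_drop) (auto simp: ugc_bits_length)
  then show ?thesis by (auto intro: thr_cong[OF thr_const[of D X s True 2 ?b]])
qed

section \<open>The reduction of \<open>NC1\<close> to connectivity\<close>

lemma NC1_subset_TC0:
  assumes s: "poly_bounded s"
    and ugc: "\<And>n. thr {x\<in>ugc_instances. length x = n} ((\<lambda>j x. x ! j) ` {..<n}) (s n) True c (\<lambda>x. x \<in> ugc_yes)"
  shows "NC1 \<subseteq> TC0"
proof
  fix L assume "L \<in> NC1"
  then obtain C b where C: "decides C L" "\<And>n g. g \<in> set (gates (C n)) \<Longrightarrow> bounded_fanin_gate b g"
    "(\<lambda>n. real (circuit_depth (C n))) \<in> O(\<lambda>n. ln (real n))" unfolding NC1_def by blast
  \<comment> \<open>The asymptotic bound is turned into one for every \<open>n\<close>; the finitely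
    many exceptions enter the factor \<open>a\<close>.\<close>
  have "\<exists>a. \<forall>n. circuit_depth (C n) \<le> a * loglen n"
  proof -
    from C(3) obtain q where "\<forall>\<^sub>F n in sequentially. norm (real (circuit_depth (C n))) \<le> q * norm (ln (real n))"
      by (auto elim!: landau_o.bigE)
    then obtain n0 where n0: "\<And>n. n0 \<le> n \<Longrightarrow> real (circuit_depth (C n)) \<le> q * \<bar>ln (real n)\<bar>"
      by (auto simp: eventually_sequentially)
    define a where "a = nat \<lceil>\<bar>q\<bar>\<rceil> + (\<Sum>n<n0. circuit_depth (C n))"
    have "circuit_depth (C n) \<le> a * loglen n" for n
    proof (cases "n < n0")
      case True
      then have "circuit_depth (C n) \<le> (\<Sum>n<n0. circuit_depth (C n))"
        by (intro member_le_sum[of n "{..<n0}" "\<lambda>n. circuit_depth (C n)"]) auto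
      also have "\<dots> \<le> a * 1" by (simp add: a_def)
      also have "\<dots> \<le> a * loglen n" by (intro mult_left_mono) (auto simp: loglen_def)
      finally show ?thesis .
    next
      case False
      have l: "\<bar>ln (real n)\<bar> \<le> real (loglen n)"
      proof (cases "n = 0")
        case n: False
        have "real n \<le> real (2 ^ loglen n)" using loglen_pow(1)[of n] by (simp only: of_nat_le_iff)
        then have "ln (real n) \<le> ln (2 ^ loglen n)" using n by (subst ln_le_cancel_iff) auto
        also have "\<dots> = real (loglen n) * ln 2" by (simp add: ln_realpow)
        also have "\<dots> \<le> real (loglen n) * 1" using ln_2_less_1 by (intro mult_left_mono) auto
        finally show ?thesis using n by simp
      qed simp
      have "real (circuit_depth (C n)) \<le> q * \<bar>ln (real n)\<bar>" using n0 False by simp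
      also have "\<dots> \<le> real a * real (loglen n)"
      proof (intro mult_mono l)
        have "q \<le> real (nat \<lceil>\<bar>q\<bar>\<rceil>)" by linarith
        also have "\<dots> \<le> real a" by (simp only: of_nat_le_iff a_def le_add1)
        finally show "q \<le> real a" .
      qed auto
      finally show ?thesis by (simp only: of_nat_mult[symmetric] of_nat_le_iff)
    qed
    then show ?thesis by blast
  qed
  then obtain a where a: "\<And>n. circuit_depth (C n) \<le> a * loglen n" by blast
  \<comment> \<open>\<open>K n\<close> bounds the leaves of the formula, and \<open>V n\<close>
    leaves room for the terminals 0 and 1. Both depend on \<open>n\<close> alone, so that all inputs
    of length \<open>n\<close> yield instances of one length \<open>N n\<close>; isolated vertices
    fill up the graph.\<close>
  define K where "K n = (b + 1) ^ (a * loglen n)" for n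
  define V where "V n = K n + 2" for n
  define N where "N n = V n * V n + 2 * ceillog2 (V n)" for n
  \<comment> \<open>The fan-in of the formula for connectivity at length \<open>N n\<close>, plus
    room for the disjunctions of \<open>ugc_bits_thr\<close>.\<close>
  define s' where "s' n = s (N n) + V n" for n
  have Kp: "poly_bounded V"
    unfolding V_def K_def using poly_bounded_exp_loglen[of "b + 1" a 0]
    by (intro poly_bounded_add poly_bounded_const) simp
  have "poly_bounded (\<lambda>n. V n ^ 2 + (V n + V n))" by (intro poly_bounded_add poly_bounded_power Kp)
  then have Np: "poly_bounded N"
  proof (rule poly_bounded_mono)
    fix n
    have "V n \<le> 2 ^ V n" by (rule less_imp_le[OF less_exp])
    then have "ceillog2 (V n) \<le> V n" by (subst ceillog2_le_iff) (auto simp: V_def)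
    then show "N n \<le> V n ^ 2 + (V n + V n)" by (simp add: N_def power2_eq_square)
  qed
  have sp: "poly_bounded s'" unfolding s'_def by (intro poly_bounded_add poly_bounded_comp[OF s Np] Kp)
  have "\<exists>B. circuit_wf B \<and> n_in B = n \<and> circuit_depth B \<le> Suc (2 + c) \<and> circuit_size B \<le> (s' n + 2) ^ Suc (2 + c) \<and>
     (\<forall>x. length x = n \<longrightarrow> circuit_eval B x = [x \<in> L])" for n
  proof -
    let ?D = "{x :: bool list. length x = n}" and ?X = "(\<lambda>i x. x ! i) ` {..<n} :: (bool list \<Rightarrow> bool) set"
    have wf: "circuit_wf (C n)" "n_in (C n) = n" "\<And>x. length x = n \<Longrightarrow> circuit_eval (C n) x = [x \<in> L]"
      using C(1) by (auto simp: decides_def)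
    have "length (circuit_eval (C n) (replicate n False)) = 1" using wf(3) by simp
    then have o: "0 < length (outs (C n))" by (simp add: circuit_eval_def)
    have "gate_ok b False g" if "g \<in> set (gates (C n))" for g
      using C(2)[OF that] by (cases g) auto
    then have "\<forall>g\<in>set (gates (C n)). gate_ok b False g" by blast
    from circuit_thr[OF wf(1) this o a]
    have "thr ?D ?X b False (a * loglen n) (\<lambda>x. circuit_eval (C n) x ! 0)" unfolding wf(2) .
    then have "thr ?D ?X b False (a * loglen n) (\<lambda>x. x \<in> L)"
      by (rule thr_cong) (use wf(3) in auto)
    from thr_sp[OF this] obtain k where k: "k \<le> K n" "sp ?D ?X k (\<lambda>x. x \<in> L)" unfolding K_def by blast
    obtain es v' where es: "2 \<le> v'" "v' < 2 + k" "length es \<le> k" "net_verts es \<subseteq> {0, 1} \<union> {2..<v'}"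
      "\<forall>(u, w, l)\<in>set es. literal ?X l" "\<And>x. x \<in> ?D \<Longrightarrow> x \<in> L \<Longrightarrow> (0, 1) \<in> (live es x)\<^sup>*"
      "\<And>x. x \<in> ?D \<Longrightarrow> x \<notin> L \<Longrightarrow> \<exists>S. 0 \<in> S \<and> S \<subseteq> {0} \<union> {2..<v'} \<and> separates S (live es x)"
      using sp_net[OF k(2), of 0 2 1] by auto
    define h where "h x = ugc_bits (V n) (live_graph es x) 0 1" for x
    have ug: "ugraph (V n) (live_graph es x)" for x
    proof -
      have "u < V n \<and> w < V n" if "(u, w, l) \<in> set es" for u w l
      proof -
        have "{u, w} \<subseteq> net_verts es" using that by (auto simp: net_verts_def)
        then show ?thesis using es(2,4) k(1) by (fastforce simp: V_def)
      qed
      then show ?thesis unfolding ugraph_def live_graph_def by blast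
    qed
    have V: "0 < V n" "1 < V n" by (simp_all add: V_def)
    have hL: "h x \<in> ugc_yes \<longleftrightarrow> x \<in> L" if "x \<in> ?D" for x
      unfolding h_def ugc_yes_iff[OF ug V]
    proof (rule live_graph_connects)
      show "(0, 1) \<in> (live es x)\<^sup>*" if "x \<in> L" using es(6)[OF \<open>x \<in> ?D\<close> that] .
      show "\<exists>S. 0 \<in> S \<and> 1 \<notin> S \<and> separates S (live es x)" if "x \<notin> L"
        using es(7)[OF \<open>x \<in> ?D\<close> that] by fastforce
    qed
    have hin: "h x \<in> {y \<in> ugc_instances. length y = N n}" for x
    proof -
      have "h x \<in> ugc_instances" using ug V unfolding h_def ugc_instances_def by blast
      then show ?thesis by (simp add: h_def ugc_bits_length N_def)
    qed
    have "thr ?D ?X (s' n) True (2 + c) (\<lambda>x. h x \<in> ugc_yes)"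
    proof (rule thr_comp[OF ugc])
      show "thr ?D ?X (s' n) True 2 (\<lambda>x. g (h x))" if "g \<in> (\<lambda>j x. x ! j) ` {..<N n}" for g
      proof -
        from that obtain j where j: "j < N n" "g = (\<lambda>x. x ! j)" by auto
        show ?thesis unfolding j(2) h_def
          by (rule ugc_bits_thr[OF es(5)]) (use es(3) k(1) j(1) in \<open>auto simp: s'_def V_def ugc_bits_length N_def\<close>)
      qed
    qed (use hin in \<open>auto simp: s'_def\<close>)
    then have "thr ?D ?X (s' n) True (2 + c) (\<lambda>x. x \<in> L)" by (rule thr_cong) (use hL in auto)
    from thr_circuit[OF this] show ?thesis by (auto simp: s'_def V_def)
  qed
  then obtain B where B: "\<And>n. circuit_wf (B n)" "\<And>n. n_in (B n) = n" "\<And>n. circuit_depth (B n) \<le> Suc (2 + c)"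
    "\<And>n. circuit_size (B n) \<le> (s' n + 2) ^ Suc (2 + c)" "\<And>n x. length x = n \<Longrightarrow> circuit_eval (B n) x = [x \<in> L]" by metis
  have "decides B L" using B by (auto simp: decides_def)
  moreover have "poly_bounded (\<lambda>n. circuit_size (B n))"
    by (rule poly_bounded_mono[OF _ B(4)]) (intro poly_bounded_power poly_bounded_add sp poly_bounded_const)
  ultimately show "L \<in> TC0" using B(3) unfolding TC0_def by blast
qed

theorem theorem6p9:
  fixes ex :: "nat \<Rightarrow> fp \<Rightarrow> fp"
  assumes "TC0 \<noteq> NC1"
    and "fp_exp_approx ex"
  shows "\<not> (\<exists>p d N. mhn_family p d N \<and> mhn_solves ex p d N ugc_instances ugc_yes)"
proof
  assume "\<exists>p d N. mhn_family p d N \<and> mhn_solves ex p d N ugc_instances ugc_yes"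
  then obtain p d N where "mhn_family p d N" "mhn_solves ex p d N ugc_instances ugc_yes" by blast
  from mhn_thr[OF this assms(2)] obtain c s where "poly_bounded s"
    "\<And>n. thr {x\<in>ugc_instances. length x = n} ((\<lambda>j x. x ! j) ` {..<n}) (s n) True c (\<lambda>x. x \<in> ugc_yes)" by blast
  then have "NC1 \<subseteq> TC0" by (rule NC1_subset_TC0)
  with TC0_subset_NC1 assms(1) show False by blast
qed

end
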